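(* Let $G$ be a simply-connected four-dimensional solvable real Lie group. Then $G$ admits a left-invariant SKT structure if and only if its Lie algebra $\mathfrak g$ is isomorphic to one of the following: $\mathbb R^4$; $\mathbb R\times\mathfrak h_3$; $\mathbb R\times\mathfrak r_{3,0}$; $\mathbb R\times\mathfrak r'_{3,0}$; $\mathfrak{aff}_{\mathbb R}\times\mathfrak{aff}_{\mathbb R}$; $\mathfrak r'_{4,\lambda,0}$ with $\lambda>0$; $\mathfrak r_{4,-1/2,-1/2}$; $\mathfrak r'_{4,2\lambda,-\lambda}$ with $\lambda>0$; $\mathfrak d_4$; $\mathfrak d_{4,2}$; $\mathfrak d'_{4,0}$; $\mathfrak d_{4,1/2}$; $\mathfrak d'_{4,\lambda}$ with $\lambda>0$.
   Context: SKT structures. A left-invariant almost Hermitian structure on $G$ is given by an inner product $g$ on $\mathfrak g$ and a linear endomorphism $J$ of $\mathfrak g$ with $J^2=-1$ and $g(JX,JY)=g(X,Y)$. Put $\omega(X,Y)=g(JX,Y)$. Let $d$ be the exterior derivative on $\Lambda^*\mathfrak g^*$ determined by $d\alpha(X,Y)=-\alpha([X,Y])$ for $\alpha\in\mathfrak g^*$. The structure $(g,J)$ is SKT (strong Kähler with torsion) if $J$ is integrable (i.e. the corresponding left-invariant almost complex structure on $G$ is integrable) and $d(Jd\omega)=0$, where $Jd\omega=-d\omega(J\cdot,J\cdot,J\cdot)$. (Kähler structures, i.e. those with $d\omega=0$, are included.) Notation for Lie algebras. A Lie algebra with basis $E_1,\dots,E_n$ and dual basis $e_1,\dots,e_n$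 is written as the list $(de_1,\dots,de_n)$, where $ij$ stands for $e_i\wedge e_j$ (for example, $(0,0,21)$ means $de_1=de_2=0$, $de_3=e_2\wedge e_1$) and coefficients multiply these two-forms (a dot separates a coefficient from a two-form, e.g. $2\lambda.41=2\lambda\, e_4\wedge e_1$). $\mathbb R^k$ denotes the Abelian Lie algebra. Then: $\mathfrak{aff}_{\mathbb R}=(0,21)$; $\mathfrak h_3=(0,0,21)$; $\mathfrak r_{3,\lambda}=(0,21,\lambda.31)$, $|\lambda|\le 1$; $\mathfrak r'_{3,\lambda}=(0,\lambda.21+31,-21+\lambda.31)$, $\lambda\ge 0$; $\mathfrak r_{4,\mu,\lambda}=(0,21,\mu.31,\lambda.41)$; $\mathfrak r'_{4,\mu,\lambda}=(0,\mu.21,\lambda.31+41,-31+\lambda.41)$, $\mu>0$; $\mathfrak d_4=(0,21,-31,32)$; $\mathfrak d_{4,\lambda}=(0,\lambda.21,(1-\lambda).31,41+32)$, $\lambda\ge\tfrac12$; $\mathfrak d'_{4,\lambda}=(0,\lambda.21+31,-21+\lambda.31,2\lambda.41+32)$, $\lambda\ge 0$. *)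

theory Defs
  imports "HOL-Analysis.Analysis" "HOL-Algebra.Solvable_Groups"
begin

section \<open>Smooth manifolds and Lie groups\<close>

primrec Ck_on :: "nat \<Rightarrow> 'a::euclidean_space set \<Rightarrow> ('a \<Rightarrow> 'b::euclidean_space) \<Rightarrow> bool" where
  "Ck_on 0 S f \<longleftrightarrow> continuous_on S f"
| "Ck_on (Suc k) S f \<longleftrightarrow>
     (\<forall>x\<in>S. f differentiable (at x)) \<and> (\<forall>v. Ck_on k S (\<lambda>x. frechet_derivative f (at x) v))"

text \<open>Meaningful for open sets \<open>S\<close> only.\<close>
definition smooth_on :: "'a::euclidean_space set \<Rightarrow> ('a \<Rightarrow> 'b::euclidean_space) \<Rightarrow> bool" where
  "smooth_on S f \<longleftrightarrow> (\<forall>k. Ck_on k S f)"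

text \<open>A chart is a pair consisting of its domain and its coordinate map; outside of the domain
  the values of the coordinate map are irrelevant.\<close>
type_synonym ('a, 'b) chart = "'a set \<times> ('a \<Rightarrow> 'b)"

definition chart_inv :: "('a, 'b) chart \<Rightarrow> 'b \<Rightarrow> 'a" where
  "chart_inv c = inv_into (fst c) (snd c)"

definition is_chart :: "('a::topological_space, 'b::euclidean_space) chart \<Rightarrow> bool" where
  "is_chart c \<longleftrightarrow> open (fst c) \<and> open (snd c ` fst c) \<and>
     homeomorphism (fst c) (snd c ` fst c) (snd c) (chart_inv c)"

definition smooth_atlas :: "('a::topological_space, 'b::euclidean_space) chart set \<Rightarrow> bool" where
  "smooth_atlas A \<longleftrightarrow> (\<forall>c\<in>A. is_chart c) \<and> (\<Union>c\<in>A. fst c) = UNIV \<and>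
     (\<forall>c\<in>A. \<forall>d\<in>A. smooth_on (snd c ` (fst c \<inter> fst d)) (snd d \<circ> chart_inv c))"

definition prod_atlas ::
  "('a, 'b) chart set \<Rightarrow> ('c, 'd) chart set \<Rightarrow> ('a \<times> 'c, 'b \<times> 'd) chart set" where
  "prod_atlas A B = {(fst c \<times> fst d, map_prod (snd c) (snd d)) | c d. c \<in> A \<and> d \<in> B}"

definition smooth_map ::
  "('a::topological_space, 'b::euclidean_space) chart set \<Rightarrow>
   ('c::topological_space, 'd::euclidean_space) chart set \<Rightarrow> ('a \<Rightarrow> 'c) \<Rightarrow> bool" where
  "smooth_map A B f \<longleftrightarrow> continuous_on UNIV f \<and>
     (\<forall>c\<in>A. \<forall>d\<in>B. smooth_on (snd c ` (fst c \<inter> f -` fst d)) (snd d \<circ> f \<circ> chart_inv c))"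

text \<open>The underlying manifold is the whole type, with its Hausdorff and second countable topology
  and the smooth structure generated by the atlas \<open>A\<close>; its dimension is the dimension of \<open>'b\<close>.\<close>
definition lie_group ::
  "('a::{t2_space, second_countable_topology}) monoid \<Rightarrow> ('a, 'b::euclidean_space) chart set \<Rightarrow> bool" where
  "lie_group G A \<longleftrightarrow> group G \<and> carrier G = UNIV \<and> smooth_atlas A \<and>
     smooth_map (prod_atlas A A) A (\<lambda>p. fst p \<otimes>\<^bsub>G\<^esub> snd p) \<and>
     smooth_map A A (\<lambda>x. inv\<^bsub>G\<^esub> x)"

section \<open>The Lie algebra of a Lie group\<close>

text \<open>A chart \<open>c\<close> around the identity identifies the tangent space at the identity with the model
  space \<open>'b\<close>, and vector fields near the identity with \<open>'b\<close>-valued functions.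
  \<open>left_inv_field G c v\<close> is the coordinate expression of the left-invariant vector field with
  value \<open>v\<close> at the identity: at the point \<open>p\<close> with coordinates \<open>x\<close> it is the image of \<open>v\<close> under the
  differential at the identity of the left translation by \<open>p\<close>.\<close>
definition left_inv_field ::
  "('a, 'm) monoid_scheme \<Rightarrow> ('a, 'b::euclidean_space) chart \<Rightarrow> 'b \<Rightarrow> 'b \<Rightarrow> 'b" where
  "left_inv_field G c v x =
     frechet_derivative (\<lambda>y. snd c (chart_inv c x \<otimes>\<^bsub>G\<^esub> chart_inv c y)) (at (snd c \<one>\<^bsub>G\<^esub>)) v"

text \<open>The coordinate formula for the commutator of vector fields as derivations,
  \<open>[V, W] f = V (W f) - W (V f)\<close>.\<close>
definition vf_bracket ::
  "('b::euclidean_space \<Rightarrow> 'b) \<Rightarrow> ('b \<Rightarrow> 'b) \<Rightarrow> 'b \<Rightarrow> 'b" where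
  "vf_bracket V W x =
     frechet_derivative W (at x) (V x) - frechet_derivative V (at x) (W x)"

definition lie_bracket ::
  "('a, 'm) monoid_scheme \<Rightarrow> ('a, 'b::euclidean_space) chart \<Rightarrow> 'b \<Rightarrow> 'b \<Rightarrow> 'b" where
  "lie_bracket G c v w =
     vf_bracket (left_inv_field G c v) (left_inv_field G c w) (snd c \<one>\<^bsub>G\<^esub>)"

section \<open>SKT structures\<close>

text \<open>From here on a Lie algebra is given by its bracket \<open>br\<close> on a real vector space.\<close>

definition inner_product :: "('v::real_vector \<Rightarrow> 'v \<Rightarrow> real) \<Rightarrow> bool" where
  "inner_product g \<longleftrightarrow> (\<forall>x. linear (g x)) \<and> (\<forall>x y. g x y = g y x) \<and> (\<forall>x. x \<noteq> 0 \<longrightarrow> 0 < g x x)"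

definition almost_hermitian ::
  "('v::real_vector \<Rightarrow> 'v \<Rightarrow> real) \<Rightarrow> ('v \<Rightarrow> 'v) \<Rightarrow> bool" where
  "almost_hermitian g J \<longleftrightarrow> inner_product g \<and> linear J \<and>
     (\<forall>X. J (J X) = - X) \<and> (\<forall>X Y. g (J X) (J Y) = g X Y)"

text \<open>The Nijenhuis tensor of a left-invariant almost complex structure is left-invariant, so its
  vanishing, i.e. integrability, can be tested on left-invariant vector fields.\<close>
definition nijenhuis :: "('v::real_vector \<Rightarrow> 'v \<Rightarrow> 'v) \<Rightarrow> ('v \<Rightarrow> 'v) \<Rightarrow> 'v \<Rightarrow> 'v \<Rightarrow> 'v" where
  "nijenhuis br J X Y = br (J X) (J Y) - J (br (J X) Y) - J (br X (J Y)) - br X Y"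

definition integrable_cs :: "('v::real_vector \<Rightarrow> 'v \<Rightarrow> 'v) \<Rightarrow> ('v \<Rightarrow> 'v) \<Rightarrow> bool" where
  "integrable_cs br J \<longleftrightarrow> (\<forall>X Y. nijenhuis br J X Y = 0)"

text \<open>A \<open>k\<close>-form is a function on lists of vectors of which only the values on lists of length \<open>k\<close>
  matter. \<open>ext_d br\<close> is the unique antiderivation of the exterior algebra of the dual space that
  extends \<open>(d\<alpha>)(X, Y) = - \<alpha> [X, Y]\<close>; on a \<open>k\<close>-form \<open>\<alpha>\<close> it is
  \<open>(d\<alpha>)(X\<^sub>0, ..., X\<^sub>k) = (\<Sum>i<j. (-1) ^ (i + j) * \<alpha> ([X\<^sub>i, X\<^sub>j], X\<^sub>0, ..., X\<^sub>k))\<close>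
  with \<open>X\<^sub>i\<close> and \<open>X\<^sub>j\<close> omitted from the trailing arguments.\<close>
definition ext_d ::
  "('v \<Rightarrow> 'v \<Rightarrow> 'v) \<Rightarrow> ('v list \<Rightarrow> real) \<Rightarrow> 'v list \<Rightarrow> real" where
  "ext_d br \<alpha> Xs = (\<Sum>j<length Xs. \<Sum>i<j.
     (-1) ^ (i + j) * \<alpha> (br (Xs ! i) (Xs ! j) # nths Xs (- {i, j})))"

lemma ext_d_one_form: "ext_d br \<alpha> [X, Y] = - \<alpha> [br X Y]"
  by (simp add: ext_d_def numeral_2_eq_2 nths_Cons)

lemma ext_d_two_form:
  "ext_d br \<alpha> [X, Y, Z] = - \<alpha> [br X Y, Z] + \<alpha> [br X Z, Y] - \<alpha> [br Y Z, X]"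
  by (simp add: ext_d_def numeral_3_eq_3 nths_Cons)

definition fundamental_form ::
  "('v \<Rightarrow> 'v \<Rightarrow> real) \<Rightarrow> ('v \<Rightarrow> 'v) \<Rightarrow> 'v list \<Rightarrow> real" where
  "fundamental_form g J Xs = g (J (Xs ! 0)) (Xs ! 1)"

definition SKT ::
  "('v::real_vector \<Rightarrow> 'v \<Rightarrow> 'v) \<Rightarrow> ('v \<Rightarrow> 'v \<Rightarrow> real) \<Rightarrow> ('v \<Rightarrow> 'v) \<Rightarrow> bool" where
  "SKT br g J \<longleftrightarrow> almost_hermitian g J \<and> integrable_cs br J \<and>
     (let d\<omega> = ext_d br (fundamental_form g J);
          Jd\<omega> = (\<lambda>Xs. - d\<omega> (map J Xs))
      in \<forall>X Y Z W. ext_d br Jd\<omega> [X, Y, Z, W] = 0)"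

section \<open>Lie algebras given by structure equations\<close>

definition lie_iso ::
  "('v::real_vector \<Rightarrow> 'v \<Rightarrow> 'v) \<Rightarrow> ('w::real_vector \<Rightarrow> 'w \<Rightarrow> 'w) \<Rightarrow> bool" where
  "lie_iso br br' \<longleftrightarrow>
     (\<exists>f. linear f \<and> bij f \<and> (\<forall>X Y. f (br X Y) = br' (f X) (f Y)))"

definition abelian :: "'v::real_vector \<Rightarrow> 'v \<Rightarrow> 'v" where
  "abelian X Y = 0"

definition lie_prod ::
  "('v \<Rightarrow> 'v \<Rightarrow> 'v) \<Rightarrow> ('w \<Rightarrow> 'w \<Rightarrow> 'w) \<Rightarrow> 'v \<times> 'w \<Rightarrow> 'v \<times> 'w \<Rightarrow> 'v \<times> 'w"
  (infixr "\<times>\<^sub>L" 70) where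
  "(b1 \<times>\<^sub>L b2) p q = (b1 (fst p) (fst q), b2 (snd p) (snd q))"

text \<open>The argument \<open>de\<close> lists \<open>de\<^sub>1, ..., de\<^sub>n\<close>, where \<open>e i j\<close> stands for \<open>e\<^sub>i \<and> e\<^sub>j\<close> evaluated on
  \<open>(X, Y)\<close>. Since \<open>e\<^sub>k [X, Y] = - de\<^sub>k (X, Y)\<close>, the bracket is the negative of the vector listed.
  The index \<open>n\<close> of type \<open>n\<close> is the residue \<open>0\<close>, so the indices \<open>1, ..., n\<close> are distinct.\<close>
definition lie_eqs ::
  "(('n::{finite,numeral} \<Rightarrow> 'n \<Rightarrow> real) \<Rightarrow> real list) \<Rightarrow> (real, 'n) vec \<Rightarrow> (real, 'n) vec \<Rightarrow> (real, 'n) vec" where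
  "lie_eqs de X Y = - vector (de (\<lambda>i j. X $ i * Y $ j - X $ j * Y $ i))"

definition aff_R :: "real^2 \<Rightarrow> real^2 \<Rightarrow> real^2" where
  "aff_R = lie_eqs (\<lambda>e. [0, e 2 1])"

definition h3 :: "real^3 \<Rightarrow> real^3 \<Rightarrow> real^3" where
  "h3 = lie_eqs (\<lambda>e. [0, 0, e 2 1])"

definition r3 :: "real \<Rightarrow> real^3 \<Rightarrow> real^3 \<Rightarrow> real^3" where
  "r3 l = lie_eqs (\<lambda>e. [0, e 2 1, l * e 3 1])"

definition r3' :: "real \<Rightarrow> real^3 \<Rightarrow> real^3 \<Rightarrow> real^3" where
  "r3' l = lie_eqs (\<lambda>e. [0, l * e 2 1 + e 3 1, - e 2 1 + l * e 3 1])"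

definition r4 :: "real \<Rightarrow> real \<Rightarrow> real^4 \<Rightarrow> real^4 \<Rightarrow> real^4" where
  "r4 m l = lie_eqs (\<lambda>e. [0, e 2 1, m * e 3 1, l * e 4 1])"

definition r4' :: "real \<Rightarrow> real \<Rightarrow> real^4 \<Rightarrow> real^4 \<Rightarrow> real^4" where
  "r4' m l = lie_eqs (\<lambda>e. [0, m * e 2 1, l * e 3 1 + e 4 1, - e 3 1 + l * e 4 1])"

definition d4 :: "real^4 \<Rightarrow> real^4 \<Rightarrow> real^4" where
  "d4 = lie_eqs (\<lambda>e. [0, e 2 1, - e 3 1, e 3 2])"

text \<open>The one-parameter family \<open>d\<^sub>4\<^sub>,\<^sub>\<lambda>\<close>, as opposed to the algebra \<open>d\<^sub>4\<close> above.\<close>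
definition d4l :: "real \<Rightarrow> real^4 \<Rightarrow> real^4 \<Rightarrow> real^4" where
  "d4l l = lie_eqs (\<lambda>e. [0, l * e 2 1, (1 - l) * e 3 1, e 4 1 + e 3 2])"

definition d4' :: "real \<Rightarrow> real^4 \<Rightarrow> real^4 \<Rightarrow> real^4" where
  "d4' l = lie_eqs (\<lambda>e. [0, l * e 2 1 + e 3 1, - e 2 1 + l * e 3 1, 2 * l * e 4 1 + e 3 2])"

end

(* The bracket of the Lie algebra is the leading coefficient of commutators: curves with expansions
   e + t^n v and e + t^k w in a chart have a commutator with expansion e + t^(n+k) [v, w]. Only the
   second-order expansion of the product at the identity is needed for this. The Hall-Witt identity
   then yields the Jacobi identity, and the directions tangent to the derived subgroups show that a
   solvable group has no nonzero perfect subspace in its Lie algebra.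

   For the classification take a hyperplane that contains all brackets and on which the trace of ad
   vanishes, a unit normal e1 of it, e2 = J e1, and a J-invariant complement spanned by e3 and
   e4 = J e3. Integrability makes the structure constants depend on eleven real parameters, and the SKT
   equation becomes (delta - 2 a) (alpha + 2 a) = 0, where delta is the e2-coefficient of [e3, e4],
   alpha that of [e1, e2], and 2 a the trace of ad e1 on the span of e3 and e4. After a change of frame the
   Jacobi identity leaves a short case distinction whose cases are exactly the algebras of the list;
   conversely each of them has such a frame. *)
theory Submission
  imports Defs
begin

section \<open>Second-order expansion of a product\<close>

text \<open>The remainder of the product expansion is o(|x| |y|) and not merely o(|x|^2 + |y|^2),
  because the product minus its linear part is constant as soon as one factor is the identity. This
  makes commutators of curves of different orders visible, and the Hall-Witt identity pairs a curve
  of order two with one of order one. Curves need an expansion at the identity and nothing else, so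
  nothing has to be known about the topology of the derived subgroups.

  The algebraic half uses the group only through the Jacobi identity and the absence of perfect
  subspaces. Its frame changes destroy orthonormality, so the SKT equation does not survive them
  literally. What survives is the trace \<alpha> + 2 a of ad e1, since e1 moves only by vectors of
  trace zero, and the sign of its product with \<delta>, since \<delta> changes only by positive
  factors.\<close>

lemma bilinear_norm_le_sum_Basis:
  fixes h :: "'m::euclidean_space \<Rightarrow> 'n::euclidean_space \<Rightarrow> 'k::real_normed_vector"
  assumes "bilinear h"
  shows "norm (h x y) \<le> (\<Sum>i\<in>Basis. \<Sum>j\<in>Basis. norm (h i j)) * norm x * norm y"
proof -
  have "h x y = h (\<Sum>i\<in>Basis. (x \<bullet> i) *\<^sub>R i) (\<Sum>j\<in>Basis. (y \<bullet> j) *\<^sub>R j)"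
    by (simp add: euclidean_representation)
  also have "\<dots> = (\<Sum>(i,j)\<in>Basis \<times> Basis. h ((x \<bullet> i) *\<^sub>R i) ((y \<bullet> j) *\<^sub>R j))"
    by (rule bilinear_sum[OF assms])
  also have "\<dots> = (\<Sum>i\<in>Basis. \<Sum>j\<in>Basis. ((x \<bullet> i) * (y \<bullet> j)) *\<^sub>R h i j)"
    by (simp add: sum.cartesian_product bilinear_lmul[OF assms] bilinear_rmul[OF assms] mult.commute)
  finally have "norm (h x y) \<le> (\<Sum>i\<in>Basis. \<Sum>j\<in>Basis. norm (((x \<bullet> i) * (y \<bullet> j)) *\<^sub>R h i j))"
    by (auto intro!: sum_norm_le)
  also have "\<dots> \<le> (\<Sum>i\<in>Basis. \<Sum>j\<in>Basis. (norm x * norm y) * norm (h i j))"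
    by (auto intro!: sum_mono mult_right_mono mult_mono simp: abs_mult Basis_le_norm)
  also have "\<dots> = (\<Sum>i\<in>Basis. \<Sum>j\<in>Basis. norm (h i j)) * norm x * norm y"
    by (simp add: sum_distrib_left sum_distrib_right mult_ac)
  finally show ?thesis .
qed

lemma Ck_on_2_has_derivative:
  assumes "Ck_on 2 S f" "p \<in> S"
  shows "(f has_derivative frechet_derivative f (at p)) (at p)"
    and "((\<lambda>q. frechet_derivative f (at q) v) has_derivative
           frechet_derivative (\<lambda>q. frechet_derivative f (at q) v) (at p)) (at p)"
  using assms by (auto simp: numeral_2_eq_2 frechet_derivative_works)

lemma Ck_on_2_continuous_on:
  assumes "Ck_on 2 S f"
  shows "continuous_on S (\<lambda>p. frechet_derivative (\<lambda>q. frechet_derivative f (at q) v) (at p) w)"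
  using assms by (auto simp: numeral_2_eq_2)

lemma has_derivative_Pair_slices:
  assumes "(f has_derivative f') (at (x, y))"
  shows "((\<lambda>x. f (x, y)) has_derivative (\<lambda>v. f' (v, 0))) (at x)"
    and "((\<lambda>y. f (x, y)) has_derivative (\<lambda>v. f' (0, v))) (at y)"
proof -
  have "((\<lambda>x. (x, y)) has_derivative (\<lambda>v. (v, 0))) (at x)" "((\<lambda>y. (x, y)) has_derivative (\<lambda>v. (0, v))) (at y)"
    by (auto intro!: derivative_eq_intros)
  with assms show "((\<lambda>x. f (x, y)) has_derivative (\<lambda>v. f' (v, 0))) (at x)"
    and "((\<lambda>y. f (x, y)) has_derivative (\<lambda>v. f' (0, v))) (at y)"
    by (auto dest: has_derivative_compose)
qed

lemma bilinear_second_derivative: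
  assumes f: "Ck_on 2 S f" and S: "open S" "p \<in> S" and L: "linear L" "linear K"
  shows "bilinear (\<lambda>v w. frechet_derivative (\<lambda>q. frechet_derivative f (at q) (L w)) (at p) (K v))"
proof -
  let ?D = "\<lambda>u. frechet_derivative (\<lambda>q. frechet_derivative f (at q) u) (at p)"
  note D2 = Ck_on_2_has_derivative(2)[OF f S(2)]
  have lin: "linear (frechet_derivative f (at q))" if "q \<in> S" for q
    using has_derivative_linear[OF Ck_on_2_has_derivative(1)[OF f that]] .
  have eqI: "?D u = E" if "((\<lambda>q. g q) has_derivative E) (at p)" "\<And>q. q \<in> S \<Longrightarrow> g q = frechet_derivative f (at q)
    u" for u g E
    using frechet_derivative_at[OF has_derivative_transform_within_open[OF that(1) S that(2)]] by simp
  have add: "?D (u + u') = (\<lambda>v. ?D u v + ?D u' v)" for u u'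
    by (rule eqI[OF has_derivative_add[OF D2 D2]]) (simp add: linear_add[OF lin])
  have scale: "?D (c *\<^sub>R u) = (\<lambda>v. c *\<^sub>R ?D u v)" for u c
    by (rule eqI[OF has_derivative_scaleR_right[OF D2]]) (simp add: linear_scale[OF lin])
  have "linear (?D u)" for u
    using D2 has_derivative_linear by blast
  then show ?thesis
    using L by (auto simp: bilinear_def linear_iff add scale)
qed

text \<open>The mean value inequality is applied twice: along x to the derivative in the second
  variable, then along y to the product itself. Each time the starting point is the unit, where the
  unit laws give the exact value, so the error picks up one factor \<open>norm (x - e)\<close> and
  one factor \<open>norm (y - e)\<close>.\<close>

lemma product_expansion:
  fixes m :: "'b::euclidean_space \<times> 'b \<Rightarrow> 'b" and e :: 'b
  defines "B \<equiv> \<lambda>v w. frechet_derivative (\<lambda>q. frechet_derivative m (at q) (0, w)) (at (e, e)) (v, 0)"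
  assumes m: "Ck_on 2 S m" and S: "open S" "(e, e) \<in> S"
    and unit: "\<And>x. (x, e) \<in> S \<Longrightarrow> m (x, e) = x" "\<And>y. (e, y) \<in> S \<Longrightarrow> m (e, y) = y"
    and eps: "0 < \<epsilon>"
  shows "\<exists>\<delta>>0. \<forall>x y. norm (x - e) < \<delta> \<longrightarrow> norm (y - e) < \<delta> \<longrightarrow>
     norm (m (x, y) - x - y + e - B (x - e) (y - e)) \<le> \<epsilon> * norm (x - e) * norm (y - e)"
proof -
  define C where "C p v w = frechet_derivative (\<lambda>q. frechet_derivative m (at q) (0, w)) (at p) (v, 0)" for p v w
  have bilC: "bilinear (C p)" if "p \<in> S" for p
    unfolding C_def using bilinear_second_derivative[OF m S(1) that, of "\<lambda>w. (0, w)" "\<lambda>v. (v, 0)"]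
    by (auto simp: linear_iff)
  have BC: "B = C (e, e)" by (auto simp: B_def C_def fun_eq_iff)
  have bilB: "bilinear B" using bilC S(2) BC by simp
  \<comment> \<open>\<open>N p\<close> dominates the operator norm of \<open>C p - B\<close>. As a
    finite sum of continuous entries it is small near \<open>(e, e)\<close>, for all directions
    \<open>v\<close>, \<open>w\<close> at once.\<close>
  define N where "N p = (\<Sum>i\<in>Basis. \<Sum>j\<in>Basis. norm (C p i j - B i j))" for p
  have "continuous_on S N"
    unfolding N_def C_def by (intro continuous_intros Ck_on_2_continuous_on m)
  then have "isCont N (e, e)" using S continuous_on_eq_continuous_at by blast
  moreover have "N (e, e) = 0" by (simp add: N_def BC)
  ultimately have "\<forall>\<^sub>F p in nhds (e, e). N p < \<epsilon>"
    using eps order_tendstoD(2)[of N 0 "at (e, e)" \<epsilon>]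
    by (auto simp: isCont_def eventually_at_filter elim!: eventually_mono)
  then have "\<forall>\<^sub>F p in nhds (e, e). N p < \<epsilon> \<and> p \<in> S"
    using eventually_nhds_in_open[OF S] by (rule eventually_conj)
  then obtain T where T: "open T" "(e, e) \<in> T" "\<And>p. p \<in> T \<Longrightarrow> N p < \<epsilon> \<and> p \<in> S"
    unfolding eventually_nhds by blast
  then obtain U V where UV: "open U" "open V" "e \<in> U" "e \<in> V" "U \<times> V \<subseteq> T"
    using open_prod_elim[OF T(1,2)] by (metis mem_Sigma_iff)
  obtain d1 d2 where d: "d1 > 0" "ball e d1 \<subseteq> U" "d2 > 0" "ball e d2 \<subseteq> V"
    using UV by (meson openE)
  define d where "d = min d1 d2"
  have dpos: "d > 0" using d by (simp add: d_def)
  have inS: "(x, y) \<in> S" and Cle: "norm (C (x, y) v w - B v w) \<le> \<epsilon> * norm v * norm w"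
    if "x \<in> ball e d" "y \<in> ball e d" for x y v w
  proof -
    have "(x, y) \<in> T" using that d(2,4) UV(5) by (auto simp: d_def subset_iff)
    then show inS: "(x, y) \<in> S" and "norm (C (x, y) v w - B v w) \<le> \<epsilon> * norm v * norm w"
    proof -
      assume xy: "(x, y) \<in> T"
      have "bilinear (\<lambda>v w. C (x, y) v w - B v w)"
        using bilC[of "(x, y)"] bilB T(3)[OF xy] by (auto simp: bilinear_def intro!: linear_compose_sub)
      from bilinear_norm_le_sum_Basis[OF this, of v w]
      have "norm (C (x, y) v w - B v w) \<le> N (x, y) * norm v * norm w" by (simp add: N_def)
      also have "\<dots> \<le> \<epsilon> * norm v * norm w"
        using T(3)[OF xy] by (intro mult_right_mono) auto
      finally show "norm (C (x, y) v w - B v w) \<le> \<epsilon> * norm v * norm w" .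
    qed (use T in auto)
  qed
  have e0: "e \<in> ball e d" using dpos by simp
  define g where "g w p = frechet_derivative m (at p) (0, w)" for w p
  have g_e: "g w (e, y) = w" if "y \<in> ball e d" for y w
  proof -
    have "((\<lambda>y. m (e, y)) has_derivative (\<lambda>w. frechet_derivative m (at (e, y)) (0, w))) (at y)"
      by (rule has_derivative_Pair_slices(2)[OF Ck_on_2_has_derivative(1)[OF m inS[OF e0 that]]])
    moreover have "((\<lambda>y. m (e, y)) has_derivative (\<lambda>w. w)) (at y)"
      by (rule has_derivative_transform_within_open[OF has_derivative_ident open_ball that])
        (use inS[OF e0] unit in auto)
    ultimately have "(\<lambda>w. frechet_derivative m (at (e, y)) (0, w)) = (\<lambda>w. w)"
      by (rule has_derivative_unique)
    then show ?thesis by (auto simp: g_def dest: fun_cong)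
  qed
  have g_le: "norm (g w (x, y) - w - B (x - e) w) \<le> \<epsilon> * norm (x - e) * norm w"
    if "x \<in> ball e d" "y \<in> ball e d" for x y w
  proof -
    have der: "((\<lambda>x. g w (x, y) - B x w) has_derivative (\<lambda>v. C (x, y) v w - B v w)) (at x within ball e d)"
      if "x \<in> ball e d" for x
    proof -
      have "((\<lambda>x. g w (x, y)) has_derivative (\<lambda>v. C (x, y) v w)) (at x)"
        unfolding g_def C_def
        by (rule has_derivative_Pair_slices(1)[OF Ck_on_2_has_derivative(2)[OF m inS[OF that \<open>y \<in> ball e d\<close>]]])
      moreover have "((\<lambda>x. B x w) has_derivative (\<lambda>v. B v w)) (at x)"
        using bilB linear_conv_bounded_linear
        by (intro bounded_linear_imp_has_derivative) (auto simp: bilinear_def)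
      ultimately show ?thesis
        by (rule has_derivative_at_withinI[OF has_derivative_diff])
    qed
    have "norm ((g w (x, y) - B x w) - (g w (e, y) - B e w)) \<le> \<epsilon> * norm w * norm (x - e)"
    proof (rule differentiable_bound[OF convex_ball der])
      fix x assume "x \<in> ball e d"
      then show "onorm (\<lambda>v. C (x, y) v w - B v w) \<le> \<epsilon> * norm w"
        using Cle[OF _ \<open>y \<in> ball e d\<close>] eps by (intro onorm_le) (simp add: mult_ac)
    qed (use that e0 in auto)
    then show ?thesis
      using g_e[OF that(2)] by (simp add: bilinear_lsub[OF bilB] algebra_simps)
  qed
  have "norm (m (x, y) - x - y + e - B (x - e) (y - e)) \<le> \<epsilon> * norm (x - e) * norm (y - e)"
    if x: "x \<in> ball e d" and y: "y \<in> ball e d" for x y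
  proof -
    have der: "((\<lambda>y. m (x, y) - y - B (x - e) y) has_derivative (\<lambda>w. g w (x, y) - w - B (x - e) w)) (at y
      within ball e d)"
      if "y \<in> ball e d" for y
    proof -
      have "((\<lambda>y. m (x, y)) has_derivative (\<lambda>w. g w (x, y))) (at y)"
        unfolding g_def by (rule has_derivative_Pair_slices(2)[OF Ck_on_2_has_derivative(1)[OF m inS[OF x
          that]]])
      moreover have "(B (x - e) has_derivative B (x - e)) (at y)"
        using bilB linear_conv_bounded_linear
        by (intro bounded_linear_imp_has_derivative) (auto simp: bilinear_def)
      ultimately show ?thesis
        by (rule has_derivative_at_withinI[OF has_derivative_diff[OF has_derivative_diff[OF _
          has_derivative_ident]]])
    qed
    have "norm ((m (x, y) - y - B (x - e) y) - (m (x, e) - e - B (x - e) e)) \<le> \<epsilon> * norm (x - e) * norm (y - e)"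
    proof (rule differentiable_bound[OF convex_ball der])
      fix y assume "y \<in> ball e d"
      then show "onorm (\<lambda>w. g w (x, y) - w - B (x - e) w) \<le> \<epsilon> * norm (x - e)"
        using g_le[OF x] eps by (intro onorm_le)
    qed (use y e0 in auto)
    then show ?thesis
      using unit(1)[OF inS[OF x e0]] by (simp add: bilinear_rsub[OF bilB] algebra_simps)
  qed
  then show ?thesis
    using dpos by (intro exI[of _ d]) (auto simp: dist_norm norm_minus_commute)
qed

section \<open>The group operations in a chart around the identity\<close>

locale lie_group_chart =
  fixes G :: "('a::{t2_space, second_countable_topology}) monoid" (structure)
    and A :: "('a, 'b::euclidean_space) chart set" and c :: "('a, 'b) chart"
  assumes lie: "lie_group G A" and c: "c \<in> A" and one_in_chart: "\<one> \<in> fst c"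
begin

sublocale group G using lie by (simp add: lie_group_def)

lemma carrier_eq [simp]: "carrier G = UNIV"
  using lie by (simp add: lie_group_def)

abbreviation U where "U \<equiv> fst c"
abbreviation \<phi> where "\<phi> \<equiv> snd c"
abbreviation \<psi> where "\<psi> \<equiv> chart_inv c"
definition e where "e = \<phi> \<one>"
definition X where "X p = \<phi> p - e"

lemma chart: "open U" "open (\<phi> ` U)" "homeomorphism U (\<phi> ` U) \<phi> \<psi>"
  using lie c by (auto simp: lie_group_def smooth_atlas_def is_chart_def)

lemma inj_chart: "inj_on \<phi> U"
  using homeomorphism_apply1[OF chart(3)] by (rule inj_on_inverseI)

lemma chart_inv_chart: "p \<in> U \<Longrightarrow> \<psi> (\<phi> p) = p"
  using chart(3) by (rule homeomorphism_apply1)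

lemma chart_chart_inv: "x \<in> \<phi> ` U \<Longrightarrow> \<phi> (\<psi> x) = x"
  using chart(3) by (rule homeomorphism_apply2)

lemma chart_inv_in: "x \<in> \<phi> ` U \<Longrightarrow> \<psi> x \<in> U"
  by (auto simp: chart_inv_chart)

lemma e_in: "e \<in> \<phi> ` U" and chart_inv_e: "\<psi> e = \<one>"
  using one_in_chart by (auto simp: e_def chart_inv_chart)

lemma tendsto_chart:
  assumes "(\<gamma> \<longlongrightarrow> \<one>) F"
  shows "((\<lambda>t. X (\<gamma> t)) \<longlongrightarrow> 0) F" "\<forall>\<^sub>F t in F. \<gamma> t \<in> U"
proof -
  show "\<forall>\<^sub>F t in F. \<gamma> t \<in> U"
    using assms chart(1) one_in_chart topological_tendstoD by blast
  have "isCont \<phi> \<one>"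
    using chart(1,3) one_in_chart by (auto simp: homeomorphism_def continuous_on_eq_continuous_at)
  from isCont_tendsto_compose[OF this assms] show "((\<lambda>t. X (\<gamma> t)) \<longlongrightarrow> 0) F"
    unfolding X_def e_def by (auto intro!: tendsto_eq_intros)
qed

lemma tendsto_chart_inv:
  assumes "((\<lambda>t. X (\<gamma> t)) \<longlongrightarrow> 0) F" "\<forall>\<^sub>F t in F. \<gamma> t \<in> U"
  shows "(\<gamma> \<longlongrightarrow> \<one>) F"
proof -
  have "isCont \<psi> e"
    using chart(2,3) e_in by (auto simp: homeomorphism_def continuous_on_eq_continuous_at)
  moreover have "((\<lambda>t. \<phi> (\<gamma> t)) \<longlongrightarrow> e) F"
    using assms(1) LIM_zero_iff unfolding X_def by blast
  ultimately have "((\<lambda>t. \<psi> (\<phi> (\<gamma> t))) \<longlongrightarrow> \<psi> e) F"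
    by (rule isCont_tendsto_compose)
  moreover have "\<forall>\<^sub>F t in F. \<psi> (\<phi> (\<gamma> t)) = \<gamma> t"
    using assms(2) by eventually_elim (simp add: chart_inv_chart)
  ultimately show ?thesis
    by (simp add: chart_inv_e tendsto_cong)
qed

lemma tendsto_mult_one:
  assumes "(\<gamma> \<longlongrightarrow> \<one>) F" "(\<eta> \<longlongrightarrow> \<one>) F"
  shows "((\<lambda>t. \<gamma> t \<otimes> \<eta> t) \<longlongrightarrow> \<one>) F"
proof -
  have "isCont (\<lambda>p. fst p \<otimes> snd p) (\<one>, \<one>)"
    using lie by (simp add: lie_group_def smooth_map_def continuous_on_eq_continuous_at)
  from isCont_tendsto_compose[OF this tendsto_Pair[OF assms]] show ?thesis by simp
qed

lemma tendsto_inv_one: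
  assumes "(\<gamma> \<longlongrightarrow> \<one>) F"
  shows "((\<lambda>t. inv (\<gamma> t)) \<longlongrightarrow> \<one>) F"
proof -
  have "isCont (\<lambda>x. inv x) \<one>"
    using lie by (simp add: lie_group_def smooth_map_def continuous_on_eq_continuous_at)
  from isCont_tendsto_compose[OF this assms] show ?thesis by simp
qed

definition mult_dom where
  "mult_dom = map_prod \<phi> \<phi> ` (U \<times> U \<inter> (\<lambda>p. fst p \<otimes> snd p) -` U)"

text \<open>Written with the inverse of the product chart, exactly as in \<open>smooth_map\<close>,
  so that smoothness can be read off from \<open>lie_group\<close>; \<open>mult_coord_eq\<close>
  gives the usable form.\<close>

definition mult_coord where
  "mult_coord = \<phi> \<circ> (\<lambda>p. fst p \<otimes> snd p) \<circ> chart_inv (U \<times> U, map_prod \<phi> \<phi>)"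

lemma mem_mult_dom: "(x, y) \<in> mult_dom \<longleftrightarrow> x \<in> \<phi> ` U \<and> y \<in> \<phi> ` U \<and> \<psi> x \<otimes> \<psi> y \<in> U"
  by (force simp: mult_dom_def chart_inv_chart)

lemma mult_coord_eq: "x \<in> \<phi> ` U \<Longrightarrow> y \<in> \<phi> ` U \<Longrightarrow> mult_coord (x, y) = \<phi> (\<psi> x \<otimes> \<psi> y)"
proof -
  have "inj_on (map_prod \<phi> \<phi>) (U \<times> U)"
    using inj_chart by (auto simp: inj_on_def)
  then have "inv_into (U \<times> U) (map_prod \<phi> \<phi>) (map_prod \<phi> \<phi> (p, q)) = (p, q)" if "p \<in> U" "q \<in> U" for p q
    using that by (intro inv_into_f_f) auto
  then show "x \<in> \<phi> ` U \<Longrightarrow> y \<in> \<phi> ` U \<Longrightarrow> mult_coord (x, y) = \<phi> (\<psi> x \<otimes> \<psi> y)"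
    by (auto simp: mult_coord_def chart_inv_def[of "(U \<times> U, map_prod \<phi> \<phi>)"] chart_inv_chart)
qed

lemma Ck_mult_coord: "Ck_on 2 mult_dom mult_coord"
proof -
  have "(U \<times> U, map_prod \<phi> \<phi>) \<in> prod_atlas A A"
    unfolding prod_atlas_def using c by blast
  moreover have "\<forall>c'\<in>prod_atlas A A. \<forall>d\<in>A. smooth_on (snd c' ` (fst c' \<inter> (\<lambda>p. fst p \<otimes> snd p) -` fst d))
      (snd d \<circ> (\<lambda>p. fst p \<otimes> snd p) \<circ> chart_inv c')"
    using lie unfolding lie_group_def smooth_map_def by blast
  ultimately have "smooth_on mult_dom mult_coord"
    using c unfolding mult_dom_def mult_coord_def by fastforce
  then show ?thesis
    by (simp add: smooth_on_def)
qed

lemma open_mult_dom: "open mult_dom"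
proof -
  have "continuous_on (\<phi> ` U \<times> \<phi> ` U) (\<lambda>p. (\<psi> (fst p), \<psi> (snd p)))"
    using chart(3) unfolding homeomorphism_def
    by (auto intro!: continuous_intros continuous_on_compose2[of "\<phi> ` U" \<psi>])
  moreover have "continuous_on UNIV (\<lambda>p. fst p \<otimes> snd p)"
    using lie by (simp add: lie_group_def smooth_map_def)
  ultimately have "continuous_on (\<phi> ` U \<times> \<phi> ` U) (\<lambda>p. \<psi> (fst p) \<otimes> \<psi> (snd p))"
    using continuous_on_compose2[of UNIV "\<lambda>p. fst p \<otimes> snd p" _ "\<lambda>p. (\<psi> (fst p), \<psi> (snd p))"] by simp
  from continuous_open_preimage[OF this open_Times[OF chart(2) chart(2)] chart(1)]
  have "open (\<phi> ` U \<times> \<phi> ` U \<inter> (\<lambda>p. \<psi> (fst p) \<otimes> \<psi> (snd p)) -` U)" .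
  also have "\<phi> ` U \<times> \<phi> ` U \<inter> (\<lambda>p. \<psi> (fst p) \<otimes> \<psi> (snd p)) -` U = mult_dom"
    using mem_mult_dom by auto
  finally show ?thesis .
qed

lemma unit_mem_mult_dom: "x \<in> \<phi> ` U \<Longrightarrow> (x, e) \<in> mult_dom" "x \<in> \<phi> ` U \<Longrightarrow> (e, x) \<in> mult_dom"
  using e_in by (auto simp: mem_mult_dom chart_inv_e chart_inv_chart)

lemma mult_coord_unit: "(x, e) \<in> mult_dom \<Longrightarrow> mult_coord (x, e) = x" "(e, y) \<in> mult_dom \<Longrightarrow> mult_coord (e, y) = y"
  by (auto simp: mem_mult_dom mult_coord_eq chart_inv_e chart_inv_chart)

text \<open>The mixed second derivative of the multiplication at the identity; \<open>v\<close>
  moves the left factor and \<open>w\<close> the right one.\<close>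

definition B where
  "B v w = frechet_derivative (\<lambda>q. frechet_derivative mult_coord (at q) (0, w)) (at (e, e)) (v, 0)"

lemma bilinear_B: "bilinear B"
  unfolding B_def
  using bilinear_second_derivative[OF Ck_mult_coord open_mult_dom unit_mem_mult_dom(1)[OF e_in],
      of "\<lambda>w. (0, w)" "\<lambda>v. (v, 0)"]
  by (auto simp: linear_iff)

lemma left_inv_field_eq:
  assumes "x \<in> \<phi> ` U"
  shows "left_inv_field G c v x = frechet_derivative mult_coord (at (x, e)) (0, v)"
proof -
  have "((\<lambda>y. mult_coord (x, y)) has_derivative (\<lambda>v. frechet_derivative mult_coord (at (x, e)) (0, v))) (at e)"
    by (rule has_derivative_Pair_slices(2)[OF
          Ck_on_2_has_derivative(1)[OF Ck_mult_coord unit_mem_mult_dom(1)[OF assms]]])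
  then have "((\<lambda>y. \<phi> (\<psi> x \<otimes> \<psi> y)) has_derivative (\<lambda>v. frechet_derivative mult_coord (at (x, e)) (0, v))) (at e)"
    by (rule has_derivative_transform_within_open[OF _ chart(2) e_in]) (simp add: mult_coord_eq assms)
  from fun_cong[OF frechet_derivative_at[OF this], of v] show ?thesis
    by (simp add: left_inv_field_def e_def)
qed

text \<open>In coordinates the left-invariant field of \<open>w\<close> is the derivative of the
  product in its right factor at \<open>e\<close>. At \<open>e\<close> it has the value
  \<open>w\<close>, and its derivative along \<open>v\<close> is \<open>B v w\<close>.\<close>

lemma lie_bracket_eq: "lie_bracket G c v w = B v w - B w v"
proof -
  have at_e: "left_inv_field G c v e = v" for v
  proof -
    have "((\<lambda>y. \<phi> (\<one> \<otimes> \<psi> y)) has_derivative (\<lambda>v. v)) (at e)"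
      by (rule has_derivative_transform_within_open[OF has_derivative_ident chart(2) e_in])
        (auto simp: chart_chart_inv chart_inv_chart)
    from fun_cong[OF frechet_derivative_at[OF this], of v] show ?thesis
      by (simp add: left_inv_field_def chart_inv_e flip: e_def)
  qed
  have "frechet_derivative (left_inv_field G c w) (at e) v = B v w" for v w
  proof -
    have "((\<lambda>x. frechet_derivative mult_coord (at (x, e)) (0, w)) has_derivative (\<lambda>v. B v w)) (at e)"
      unfolding B_def
      by (rule has_derivative_Pair_slices(1)[OF
            Ck_on_2_has_derivative(2)[OF Ck_mult_coord unit_mem_mult_dom(1)[OF e_in]]])
    then have "(left_inv_field G c w has_derivative (\<lambda>v. B v w)) (at e)"
      by (rule has_derivative_transform_within_open[OF _ chart(2) e_in]) (simp add: left_inv_field_eq)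
    from fun_cong[OF frechet_derivative_at[OF this], of v] show ?thesis by simp
  qed
  then show ?thesis
    by (simp add: lie_bracket_def vf_bracket_def at_e flip: e_def)
qed

lemma lie_bracket_bilinear: "bilinear (lie_bracket G c)"
  unfolding lie_bracket_eq using bilinear_B by (auto simp: bilinear_def intro!: linear_compose_sub)

lemma lie_bracket_alternating: "lie_bracket G c v v = 0"
  by (simp add: lie_bracket_eq)

lemma mult_expansion:
  assumes "(\<gamma> \<longlongrightarrow> \<one>) F" "(\<eta> \<longlongrightarrow> \<one>) F" "0 < \<epsilon>"
  shows "\<forall>\<^sub>F t in F. norm (X (\<gamma> t \<otimes> \<eta> t) - X (\<gamma> t) - X (\<eta> t) - B (X (\<gamma> t)) (X (\<eta> t)))
     \<le> \<epsilon> * norm (X (\<gamma> t)) * norm (X (\<eta> t))"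
proof -
  from product_expansion[OF Ck_mult_coord open_mult_dom unit_mem_mult_dom(1)[OF e_in] mult_coord_unit
    assms(3), folded B_def]
  obtain \<delta> where "\<delta> > 0" and \<delta>: "\<And>x y. norm (x - e) < \<delta> \<Longrightarrow> norm (y - e) < \<delta> \<Longrightarrow>
     norm (mult_coord (x, y) - x - y + e - B (x - e) (y - e)) \<le> \<epsilon> * norm (x - e) * norm (y - e)"
    by blast
  have "\<forall>\<^sub>F t in F. norm (X (\<gamma> t)) < \<delta>" "\<forall>\<^sub>F t in F. norm (X (\<eta> t)) < \<delta>"
    using tendsto_chart(1)[OF assms(1)] tendsto_chart(1)[OF assms(2)] \<open>\<delta> > 0\<close>
    unfolding tendsto_iff by simp_all
  with tendsto_chart(2)[OF assms(1)] tendsto_chart(2)[OF assms(2)]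
  show ?thesis
  proof eventually_elim
    case (elim t)
    then show ?case
      using \<delta>[of "\<phi> (\<gamma> t)" "\<phi> (\<eta> t)"]
      by (simp add: X_def mult_coord_eq chart_inv_chart algebra_simps)
  qed
qed

text \<open>Here the bilinear term is absorbed into the constant. This form suffices wherever the
  product only has to be additive up to higher order.\<close>

lemma mult_bound:
  "\<exists>C>0. \<forall>F (\<gamma> :: real \<Rightarrow> 'a) \<eta>. (\<gamma> \<longlongrightarrow> \<one>) F \<longrightarrow> (\<eta> \<longlongrightarrow> \<one>) F \<longrightarrow>
     (\<forall>\<^sub>F t in F. norm (X (\<gamma> t \<otimes> \<eta> t) - X (\<gamma> t) - X (\<eta> t)) \<le> C * norm (X (\<gamma> t)) * norm (X (\<eta> t)))"
proof -
  obtain K where K: "K > 0" "\<And>x y. norm (B x y) \<le> K * norm x * norm y"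
    using bilinear_bounded_pos[OF bilinear_B] by blast
  show ?thesis
  proof (intro exI[of _ "1 + K"] conjI allI impI)
    fix F and \<gamma> \<eta> :: "real \<Rightarrow> 'a"
    assume "(\<gamma> \<longlongrightarrow> \<one>) F" "(\<eta> \<longlongrightarrow> \<one>) F"
    from mult_expansion[OF this zero_less_one]
    show "\<forall>\<^sub>F t in F. norm (X (\<gamma> t \<otimes> \<eta> t) - X (\<gamma> t) - X (\<eta> t)) \<le> (1 + K) * norm (X (\<gamma> t)) * norm (X (\<eta> t))"
    proof eventually_elim
      case (elim t)
      then show ?case
        using K(2)[of "X (\<gamma> t)" "X (\<eta> t)"]
          norm_triangle_sub[of "X (\<gamma> t \<otimes> \<eta> t) - X (\<gamma> t) - X (\<eta> t)" "B (X (\<gamma> t)) (X (\<eta> t))"]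
        by (simp add: algebra_simps)
    qed
  qed (use K in auto)
qed

end

section \<open>The Lie bracket from group commutators\<close>

text \<open>The error is bounded in terms of the unknown \<open>a\<close> itself, which is what
  solving a product equation for its left factor yields. As soon as \<open>C * norm (z t)\<close> is
  below 1/2 the right-hand side can be absorbed, and \<open>norm (a t)\<close> is at most twice
  \<open>norm (b t)\<close>.\<close>

lemma tendsto_scaled_if_close:
  fixes a b z :: "real \<Rightarrow> 'v::real_normed_vector"
  assumes close: "\<forall>\<^sub>F t in F. norm (a t - b t) \<le> C * norm (a t) * norm (z t)"
    and z: "(z \<longlongrightarrow> 0) F" and b: "((\<lambda>t. s t *\<^sub>R b t) \<longlongrightarrow> v) F" and "C > 0"
  shows "((\<lambda>t. s t *\<^sub>R a t) \<longlongrightarrow> v) F"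
proof -
  have small: "\<forall>\<^sub>F t in F. norm (z t) < 1 / (2 * C)"
    using tendstoD[OF z, of "1 / (2 * C)"] \<open>C > 0\<close> by simp
  have "\<forall>\<^sub>F t in F. norm (s t *\<^sub>R a t - s t *\<^sub>R b t) \<le> 2 * C * norm (z t) * norm (s t *\<^sub>R b t)"
    using close small
  proof eventually_elim
    case (elim t)
    have "C * norm (z t) \<le> 1 / 2"
      using elim(2) \<open>C > 0\<close> by (simp add: field_simps)
    then have "norm (a t) * (C * norm (z t)) \<le> norm (a t) * (1 / 2)"
      by (rule mult_left_mono) simp
    then have "norm (a t) \<le> norm (b t) + norm (a t) / 2"
      using elim(1) norm_triangle_sub[of "a t" "b t"] by (simp add: mult_ac)
    then have "C * norm (z t) * norm (a t) \<le> C * norm (z t) * (2 * norm (b t))"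
      using \<open>C > 0\<close> by (intro mult_left_mono) auto
    then have "norm (a t - b t) \<le> 2 * C * norm (z t) * norm (b t)"
      using elim(1) by (simp add: mult_ac)
    then have "\<bar>s t\<bar> * norm (a t - b t) \<le> \<bar>s t\<bar> * (2 * C * norm (z t) * norm (b t))"
      by (rule mult_left_mono) simp
    then show ?case
      by (simp add: mult_ac flip: scaleR_diff_right)
  qed
  moreover have "((\<lambda>t. 2 * C * norm (z t) * norm (s t *\<^sub>R b t)) \<longlongrightarrow> 0) F"
    using tendsto_mult[OF tendsto_mult_right_zero[OF tendsto_norm_zero[OF z], of "2 * C"] tendsto_norm[OF b]]
      by simp
  ultimately have "((\<lambda>t. s t *\<^sub>R a t - s t *\<^sub>R b t) \<longlongrightarrow> 0) F"
    by (rule Lim_null_comparison)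
  from tendsto_add[OF this b] show ?thesis by simp
qed

section \<open>Curves with a leading coefficient at the identity\<close>

context lie_group_chart
begin

text \<open>The expansion X (\<gamma> t) = t^n v + o(t^n) from the right. Convergence to the
  identity is a separate condition because the coordinate map has arbitrary values outside of its
  domain.\<close>

definition lead :: "nat \<Rightarrow> (real \<Rightarrow> 'a) \<Rightarrow> 'b \<Rightarrow> bool" where
  "lead n \<gamma> v \<longleftrightarrow> (\<gamma> \<longlongrightarrow> \<one>) (at_right 0) \<and> ((\<lambda>t. (1 / t ^ n) *\<^sub>R X (\<gamma> t)) \<longlongrightarrow> v) (at_right 0)"

lemma leadD:
  assumes "lead n \<gamma> v"
  shows "(\<gamma> \<longlongrightarrow> \<one>) (at_right 0)" "((\<lambda>t. (1 / t ^ n) *\<^sub>R X (\<gamma> t)) \<longlongrightarrow> v) (at_right 0)"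
  using assms by (auto simp: lead_def)

lemma lead_unique: "lead n \<gamma> v \<Longrightarrow> lead n \<gamma> w \<Longrightarrow> v = w"
  using tendsto_unique[OF trivial_limit_at_right_real] leadD(2) by blast

lemma lead_one: "lead n (\<lambda>t. \<one>) 0"
  by (simp add: lead_def X_def e_def)

lemma lead_mult:
  assumes "lead n \<gamma> v" "lead n \<eta> w"
  shows "lead n (\<lambda>t. \<gamma> t \<otimes> \<eta> t) (v + w)"
proof -
  note g = leadD[OF assms(1)] and h = leadD[OF assms(2)]
  obtain C where "C > 0" and C: "\<forall>\<^sub>F t in at_right 0. norm (X (\<gamma> t \<otimes> \<eta> t) - X (\<gamma> t) - X (\<eta> t)) \<le> C * norm (X
    (\<gamma> t)) * norm (X (\<eta> t))"
    using mult_bound g(1) h(1) by blast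
  from C have "\<forall>\<^sub>F t in at_right 0. norm ((1 / t ^ n) *\<^sub>R (X (\<gamma> t \<otimes> \<eta> t) - X (\<gamma> t) - X (\<eta> t)))
      \<le> C * norm ((1 / t ^ n) *\<^sub>R X (\<gamma> t)) * norm (X (\<eta> t))"
  proof eventually_elim
    case (elim t)
    from mult_left_mono[OF this, of "\<bar>1 / t ^ n\<bar>"] show ?case by (simp add: mult_ac)
  qed
  moreover have "((\<lambda>t. C * norm ((1 / t ^ n) *\<^sub>R X (\<gamma> t)) * norm (X (\<eta> t))) \<longlongrightarrow> C * norm v * 0) (at_right 0)"
    using tendsto_chart(1)[OF h(1)] g(2) by (intro tendsto_mult tendsto_const tendsto_norm tendsto_norm_zero)
  ultimately have "((\<lambda>t. (1 / t ^ n) *\<^sub>R (X (\<gamma> t \<otimes> \<eta> t) - X (\<gamma> t) - X (\<eta> t))) \<longlongrightarrow> 0) (at_right 0)"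
    by (auto intro: Lim_null_comparison)
  from tendsto_add[OF this tendsto_add[OF g(2) h(2)]]
  show ?thesis
    using tendsto_mult_one[OF g(1) h(1)] by (simp add: lead_def algebra_simps)
qed

lemma lead_inv:
  assumes "lead n \<gamma> v"
  shows "lead n (\<lambda>t. inv (\<gamma> t)) (- v)"
proof -
  note g = leadD[OF assms]
  note h = tendsto_inv_one[OF g(1)]
  obtain C where "C > 0" and C: "\<forall>\<^sub>F t in at_right 0. norm (X (inv (\<gamma> t) \<otimes> \<gamma> t) - X (inv (\<gamma> t)) - X (\<gamma> t)) \<le> C
    * norm (X (inv (\<gamma> t))) * norm (X (\<gamma> t))"
    using mult_bound g(1) h by blast
  from C have "\<forall>\<^sub>F t in at_right 0. norm (X (inv (\<gamma> t)) - (- X (\<gamma> t))) \<le> C * norm (X (inv (\<gamma> t))) * norm (X (\<gamma>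
    t))"
  proof eventually_elim
    case (elim t)
    have "X (inv (\<gamma> t) \<otimes> \<gamma> t) = 0" by (simp add: X_def e_def)
    with elim show ?case
      using norm_minus_cancel[of "X (inv (\<gamma> t)) + X (\<gamma> t)"] by (simp del: norm_minus_cancel)
  qed
  from tendsto_scaled_if_close[OF this tendsto_chart(1)[OF g(1)] _ \<open>C > 0\<close>, of "\<lambda>t. 1 / t ^ n" "- v"]
  show ?thesis
    using tendsto_minus[OF g(2)] h by (simp add: lead_def)
qed

lemma inv_cancel: "inv x \<otimes> (x \<otimes> y) = y" "x \<otimes> (inv x \<otimes> y) = y"
  using m_assoc[of "inv x" x y] m_assoc[of x "inv x" y] by simp_all

definition comm where "comm a b = a \<otimes> b \<otimes> inv a \<otimes> inv b"

lemma mult_second_order: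
  assumes "lead n \<gamma> v" "lead k \<eta> w"
  shows "((\<lambda>t. (1 / t ^ (n + k)) *\<^sub>R (X (\<gamma> t \<otimes> \<eta> t) - X (\<gamma> t) - X (\<eta> t))) \<longlongrightarrow> B v w) (at_right 0)"
proof -
  note g = leadD[OF assms(1)] and h = leadD[OF assms(2)]
  let ?err = "\<lambda>t. (1 / t ^ (n + k)) *\<^sub>R (X (\<gamma> t \<otimes> \<eta> t) - X (\<gamma> t) - X (\<eta> t) - B (X (\<gamma> t)) (X (\<eta> t)))"
  let ?M = "\<lambda>t. norm ((1 / t ^ n) *\<^sub>R X (\<gamma> t)) * norm ((1 / t ^ k) *\<^sub>R X (\<eta> t))"
  have "(?M \<longlongrightarrow> norm v * norm w) (at_right 0)"
    by (intro tendsto_mult tendsto_norm g h)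
  then have M: "\<forall>\<^sub>F t in at_right 0. ?M t < norm v * norm w + 1"
    by (rule order_tendstoD) simp
  have "(?err \<longlongrightarrow> 0) (at_right 0)"
  proof (rule tendstoI)
    fix \<eta>' :: real assume "0 < \<eta>'"
    \<comment> \<open>\<open>norm v * norm w + 1\<close> eventually bounds the product of the scaled
      norms; the summand 1 keeps it positive when \<open>v\<close> or \<open>w\<close> is
      zero.\<close>
    define \<epsilon> where "\<epsilon> = \<eta>' / (norm v * norm w + 1)"
    have pos: "norm v * norm w + 1 > 0" by (simp add: add_nonneg_pos)
    have "\<epsilon> > 0" using \<open>0 < \<eta>'\<close> pos by (simp add: \<epsilon>_def)
    from mult_expansion[OF g(1) h(1) this] M
    show "\<forall>\<^sub>F t in at_right 0. dist (?err t) 0 < \<eta>'"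
    proof eventually_elim
      case (elim t)
      from mult_left_mono[OF elim(1), of "\<bar>1 / t ^ (n + k)\<bar>"]
      moreover have "\<bar>1 / t ^ (n + k)\<bar> = \<bar>1 / t ^ n\<bar> * \<bar>1 / t ^ k\<bar>"
        by (simp add: power_add abs_mult)
      ultimately have "norm (?err t) \<le> \<epsilon> * ?M t"
        by (simp only: norm_scaleR mult_ac abs_ge_zero simp_thms)
      also have "\<dots> < \<epsilon> * (norm v * norm w + 1)"
        using elim(2) \<open>\<epsilon> > 0\<close> by (rule mult_strict_left_mono)
      also have "\<dots> = \<eta>'" using pos by (simp add: \<epsilon>_def)
      finally show ?case by simp
    qed
  qed
  moreover have "((\<lambda>t. B ((1 / t ^ n) *\<^sub>R X (\<gamma> t)) ((1 / t ^ k) *\<^sub>R X (\<eta> t))) \<longlongrightarrow> B v w) (at_right 0)"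
    using bilinear_B g(2) h(2) by (auto simp: bilinear_conv_bounded_bilinear intro: bounded_bilinear.tendsto)
  ultimately have "((\<lambda>t. ?err t + B ((1 / t ^ n) *\<^sub>R X (\<gamma> t)) ((1 / t ^ k) *\<^sub>R X (\<eta> t))) \<longlongrightarrow> 0 + B v w)
    (at_right 0)"
    by (rule tendsto_add)
  then show ?thesis
    by (simp add: bilinear_lmul[OF bilinear_B] bilinear_rmul[OF bilinear_B] power_add mult.commute flip:
      scaleR_add_right)
qed

text \<open>The commutator times \<open>\<eta> t \<otimes> \<gamma> t\<close> is
  \<open>\<gamma> t \<otimes> \<eta> t\<close>. The linear parts of these two products cancel and
  their second-order parts differ by \<open>B v w - B w v\<close>. The factor
  \<open>\<eta> t \<otimes> \<gamma> t\<close> tends to the identity and so does not affect the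
  leading term.\<close>

lemma lead_comm:
  assumes "lead n \<gamma> v" "lead k \<eta> w"
  shows "lead (n + k) (\<lambda>t. comm (\<gamma> t) (\<eta> t)) (lie_bracket G c v w)"
proof -
  note g = leadD[OF assms(1)] and h = leadD[OF assms(2)]
  let ?K = "\<lambda>t. comm (\<gamma> t) (\<eta> t)" and ?z = "\<lambda>t. \<eta> t \<otimes> \<gamma> t"
  have K: "(?K \<longlongrightarrow> \<one>) (at_right 0)"
    unfolding comm_def by (intro tendsto_mult_one tendsto_inv_one g h)
  have z: "(?z \<longlongrightarrow> \<one>) (at_right 0)"
    by (intro tendsto_mult_one g h)
  have Kz: "?K t \<otimes> ?z t = \<gamma> t \<otimes> \<eta> t" for t
    by (simp add: comm_def m_assoc inv_cancel)
  obtain C where "C > 0" and C: "\<forall>\<^sub>F t in at_right 0. norm (X (?K t \<otimes> ?z t) - X (?K t) - X (?z t)) \<le> C * norm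
    (X (?K t)) * norm (X (?z t))"
    using mult_bound K z by blast
  from C have "\<forall>\<^sub>F t in at_right 0. norm (X (?K t) - (X (\<gamma> t \<otimes> \<eta> t) - X (?z t))) \<le> C * norm (X (?K t)) * norm
    (X (?z t))"
    unfolding Kz
  proof eventually_elim
    case (elim t)
    then show ?case
      using norm_minus_commute[of "X (?K t)" "X (\<gamma> t \<otimes> \<eta> t) - X (?z t)"] by (simp add: algebra_simps)
  qed
  moreover have "((\<lambda>t. (1 / t ^ (n + k)) *\<^sub>R (X (\<gamma> t \<otimes> \<eta> t) - X (?z t))) \<longlongrightarrow> lie_bracket G c v w) (at_right 0)"
  proof -
    have "((\<lambda>t. (1 / t ^ (n + k)) *\<^sub>R (X (?z t) - X (\<eta> t) - X (\<gamma> t))) \<longlongrightarrow> B w v) (at_right 0)"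
      using mult_second_order[OF assms(2,1)] by (simp only: add.commute)
    from tendsto_diff[OF mult_second_order[OF assms] this]
    show ?thesis
      unfolding lie_bracket_eq scaleR_diff_right[symmetric] by simp
  qed
  ultimately have "((\<lambda>t. (1 / t ^ (n + k)) *\<^sub>R X (?K t)) \<longlongrightarrow> lie_bracket G c v w) (at_right 0)"
    by (rule tendsto_scaled_if_close[OF _ tendsto_chart(1)[OF z] _ \<open>C > 0\<close>])
  with K show ?thesis by (simp add: lead_def)
qed

lemma lead_lower:
  assumes "lead (n + k) \<gamma> v" "k > 0"
  shows "lead n \<gamma> 0"
proof -
  have "((\<lambda>t. t ^ k *\<^sub>R (1 / t ^ (n + k)) *\<^sub>R X (\<gamma> t)) \<longlongrightarrow> 0 ^ k *\<^sub>R v) (at_right 0)"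
    by (intro tendsto_scaleR tendsto_power leadD[OF assms(1)] tendsto_ident_at)
  then have "((\<lambda>t. t ^ k *\<^sub>R (1 / t ^ (n + k)) *\<^sub>R X (\<gamma> t)) \<longlongrightarrow> 0) (at_right 0)"
    using assms(2) unfolding power_0_left by (simp only: if_False less_not_refl2 scaleR_zero_left)
  moreover have "\<forall>\<^sub>F t in at_right 0. t ^ k *\<^sub>R (1 / t ^ (n + k)) *\<^sub>R X (\<gamma> t) = (1 / t ^ n) *\<^sub>R X (\<gamma> t)"
    using eventually_at_right_less[of "0::real"] by eventually_elim (simp add: power_add)
  ultimately have "((\<lambda>t. (1 / t ^ n) *\<^sub>R X (\<gamma> t)) \<longlongrightarrow> 0) (at_right 0)"
    by (rule Lim_transform_eventually)
  then show ?thesis using leadD(1)[OF assms(1)] by (simp add: lead_def)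
qed

text \<open>Conjugation is multiplication by a commutator, whose order \<open>n + k\<close> exceeds
  \<open>n\<close>.\<close>

lemma lead_conj:
  assumes "lead n \<gamma> v" "lead k \<eta> w" "k > 0"
  shows "lead n (\<lambda>t. \<eta> t \<otimes> \<gamma> t \<otimes> inv (\<eta> t)) v"
proof -
  have "lead n (\<lambda>t. comm (\<eta> t) (\<gamma> t)) 0"
    using lead_comm[OF assms(2,1)] lead_lower[of n k] assms(3) by (simp add: add.commute)
  from lead_mult[OF this assms(1)] have "lead n (\<lambda>t. comm (\<eta> t) (\<gamma> t) \<otimes> \<gamma> t) v" by simp
  moreover have "comm (\<eta> t) (\<gamma> t) \<otimes> \<gamma> t = \<eta> t \<otimes> \<gamma> t \<otimes> inv (\<eta> t)" for t
    by (simp add: comm_def m_assoc)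
  ultimately show ?thesis by simp
qed

lemma lead_exists: "\<exists>\<gamma>. lead 1 \<gamma> v"
proof -
  have lim: "((\<lambda>t. e + t *\<^sub>R v) \<longlongrightarrow> e) (at_right 0)"
    by (auto intro!: tendsto_eq_intros)
  then have ev: "\<forall>\<^sub>F t in at_right 0. e + t *\<^sub>R v \<in> \<phi> ` U"
    using chart(2) e_in topological_tendstoD by blast
  then have X: "\<forall>\<^sub>F t in at_right 0. X (\<psi> (e + t *\<^sub>R v)) = t *\<^sub>R v"
    by eventually_elim (simp add: X_def chart_chart_inv)
  have "((\<lambda>t. X (\<psi> (e + t *\<^sub>R v))) \<longlongrightarrow> 0) (at_right 0)"
    unfolding tendsto_cong[OF X] by (auto intro!: tendsto_eq_intros)
  moreover have "\<forall>\<^sub>F t in at_right 0. \<psi> (e + t *\<^sub>R v) \<in> U"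
    using ev by eventually_elim (rule chart_inv_in)
  ultimately have "((\<lambda>t. \<psi> (e + t *\<^sub>R v)) \<longlongrightarrow> \<one>) (at_right 0)"
    by (rule tendsto_chart_inv)
  moreover have "\<forall>\<^sub>F t in at_right 0. (1 / t ^ 1) *\<^sub>R X (\<psi> (e + t *\<^sub>R v)) = v"
    using X eventually_at_right_less[of "0::real"] by eventually_elim simp
  then have "((\<lambda>t. (1 / t ^ 1) *\<^sub>R X (\<psi> (e + t *\<^sub>R v))) \<longlongrightarrow> v) (at_right 0)"
    by (rule tendsto_eventually)
  ultimately show ?thesis unfolding lead_def by blast
qed

lemma hall_witt:
  "(y \<otimes> comm (inv (comm x (inv y))) z \<otimes> inv y) \<otimes> (z \<otimes> comm (inv (comm y (inv z))) x \<otimes> inv z)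
     \<otimes> (x \<otimes> comm (inv (comm z (inv x))) y \<otimes> inv x) = \<one>"
  by (simp add: comm_def inv_mult_group m_assoc inv_cancel)

text \<open>Each factor of the Hall-Witt identity is a curve of order three whose leading
  coefficient is an iterated bracket, unaffected by the conjugation. The product is constantly the
  identity, so the three coefficients sum to zero.\<close>

lemma lie_bracket_jacobi:
  "lie_bracket G c (lie_bracket G c u v) w + lie_bracket G c (lie_bracket G c v w) u
     + lie_bracket G c (lie_bracket G c w u) v = 0"
proof -
  obtain x y z where x: "lead 1 x u" and y: "lead 1 y v" and z: "lead 1 z w"
    using lead_exists by metis
  \<comment> \<open>The inverse of \<open>y t\<close> turns the inner coefficient into - [u, v], and
    the inverse of the inner commutator restores the sign.\<close>
  have step: "lead 3 (\<lambda>t. y t \<otimes> comm (inv (comm (x t) (inv (y t)))) (z t) \<otimes> inv (y t))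
      (lie_bracket G c (lie_bracket G c u v) w)"
    if "lead 1 x u" "lead 1 y v" "lead 1 z w" for x y z u v w
    using lead_conj[OF lead_comm[OF lead_inv[OF lead_comm[OF that(1) lead_inv[OF that(2)]]] that(3)] that(2)]
    by (simp add: bilinear_rneg[OF lie_bracket_bilinear] numeral_3_eq_3)
  from lead_mult[OF lead_mult[OF step[OF x y z] step[OF y z x]] step[OF z x y]]
  show ?thesis
    unfolding hall_witt using lead_one lead_unique by blast
qed

section \<open>Tangent directions of subgroups and solvability\<close>

definition tangent :: "'a set \<Rightarrow> 'b set" where
  "tangent H = {v. \<exists>\<gamma>. (\<forall>t. \<gamma> t \<in> H) \<and> lead 1 \<gamma> v}"

lemma tangentI: "(\<And>t. \<gamma> t \<in> H) \<Longrightarrow> lead 1 \<gamma> v \<Longrightarrow> v \<in> tangent H"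
  by (auto simp: tangent_def)

lemma tangentE:
  assumes "v \<in> tangent H"
  obtains \<gamma> where "\<And>t. \<gamma> t \<in> H" "lead 1 \<gamma> v"
  using assms by (auto simp: tangent_def)

lemma lead_rescale:
  assumes "lead 1 \<gamma> v" "r > 0"
  shows "lead 1 (\<lambda>t. \<gamma> (r * t)) (r *\<^sub>R v)"
proof -
  have f: "filterlim (\<lambda>t. r * t) (at_right 0) (at_right 0)"
    using filterlim_times_pos[OF filterlim_ident assms(2), of 0 0] by simp
  from tendsto_scaleR[OF tendsto_const[of r] filterlim_compose[OF leadD(2)[OF assms(1)] f]]
  show ?thesis
    using filterlim_compose[OF leadD(1)[OF assms(1)] f] assms(2) by (simp add: lead_def)
qed

text \<open>A commutator of two curves of order one has order two; the substitution makes it a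
  tangent curve again. That the square root is not differentiable at 0 is harmless, since only a
  one-sided limit is asked for.\<close>

lemma lead_sqrt:
  assumes "lead 2 \<gamma> v"
  shows "lead 1 (\<lambda>t. \<gamma> (sqrt t)) v"
proof -
  have f: "filterlim sqrt (at_right 0) (at_right 0)"
    unfolding filterlim_at
    using eventually_at_right_less[of "0::real"]
    by (auto intro!: tendsto_eq_intros elim: eventually_mono)
  have "\<forall>\<^sub>F t in at_right 0. (1 / sqrt t ^ 2) *\<^sub>R X (\<gamma> (sqrt t)) = (1 / t ^ 1) *\<^sub>R X (\<gamma> (sqrt t))"
    using eventually_at_right_less[of "0::real"] by eventually_elim simp
  from Lim_transform_eventually[OF filterlim_compose[OF leadD(2)[OF assms] f] this]
  show ?thesis
    using filterlim_compose[OF leadD(1)[OF assms] f] by (simp add: lead_def)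
qed

lemma subspace_tangent:
  assumes "subgroup H G"
  shows "subspace (tangent H)"
proof (rule subspaceI)
  show "0 \<in> tangent H"
    using lead_one[of 1] subgroup.one_closed[OF assms] by (auto simp: tangent_def)
  show "v + w \<in> tangent H" if v: "v \<in> tangent H" and w: "w \<in> tangent H" for v w
  proof -
    obtain \<gamma> where g: "\<And>t. \<gamma> t \<in> H" "lead 1 \<gamma> v" using tangentE[OF v] by blast
    obtain \<eta> where h: "\<And>t. \<eta> t \<in> H" "lead 1 \<eta> w" using tangentE[OF w] by blast
    show ?thesis
      by (rule tangentI[OF _ lead_mult[OF g(2) h(2)]]) (rule subgroup.m_closed[OF assms g(1) h(1)])
  qed
  have pos: "r *\<^sub>R v \<in> tangent H" if v: "v \<in> tangent H" and "r > 0" for v r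
  proof -
    obtain \<gamma> where g: "\<And>t. \<gamma> t \<in> H" "lead 1 \<gamma> v" using tangentE[OF v] by blast
    show ?thesis by (rule tangentI[OF _ lead_rescale[OF g(2) \<open>r > 0\<close>]]) (rule g(1))
  qed
  have neg: "- v \<in> tangent H" if v: "v \<in> tangent H" for v
  proof -
    obtain \<gamma> where g: "\<And>t. \<gamma> t \<in> H" "lead 1 \<gamma> v" using tangentE[OF v] by blast
    show ?thesis by (rule tangentI[OF _ lead_inv[OF g(2)]]) (rule subgroup.m_inv_closed[OF assms g(1)])
  qed
  show "r *\<^sub>R v \<in> tangent H" if "v \<in> tangent H" for v r
    using pos[OF that, of r] neg[OF pos[OF that, of "- r"]] \<open>0 \<in> tangent H\<close>
    by (cases r "0::real" rule: linorder_cases) auto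
qed

lemma lie_bracket_tangent_derived:
  assumes "v \<in> tangent H" "w \<in> tangent H"
  shows "lie_bracket G c v w \<in> tangent (derived G H)"
proof -
  obtain \<gamma> where g: "\<And>t. \<gamma> t \<in> H" "lead 1 \<gamma> v" using tangentE[OF assms(1)] by blast
  obtain \<eta> where h: "\<And>t. \<eta> t \<in> H" "lead 1 \<eta> w" using tangentE[OF assms(2)] by blast
  have "comm (\<gamma> t) (\<eta> t) \<in> derived G H" for t
    using g(1) h(1) unfolding derived_def comm_def by (blast intro: generate.incl)
  moreover have "lead 2 (\<lambda>t. comm (\<gamma> t) (\<eta> t)) (lie_bracket G c v w)"
    using lead_comm[OF g(2) h(2)] by (simp add: numeral_2_eq_2)
  ultimately show ?thesis
    by (intro tangentI[OF _ lead_sqrt])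
qed

text \<open>By induction \<open>S\<close> is tangent to every derived subgroup: brackets of tangent
  vectors are tangent to the next one, and tangent vectors form a subspace. The last derived
  subgroup is trivial and has only the zero tangent vector. \<open>S\<close> may be any set, so a
  basis of a perfect subalgebra is enough to reach a contradiction.\<close>

lemma no_perfect_subspace:
  assumes "solvable G" and S: "S \<subseteq> span {lie_bracket G c v w | v w. v \<in> S \<and> w \<in> S}"
  shows "S \<subseteq> {0}"
proof -
  obtain n where n: "(derived G ^^ n) UNIV = {\<one>}"
    using assms(1) solvable_iff_trivial_derived_seq by auto
  have sub: "subgroup ((derived G ^^ n) UNIV) G" for n
    using exp_of_derived_is_subgroup[OF subgroup_self, of n] by simp
  have "S \<subseteq> tangent ((derived G ^^ n) UNIV)" for n
  proof (induction n)
    case 0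
    show ?case using lead_exists by (auto simp: tangent_def)
  next
    case (Suc n)
    have "{lie_bracket G c v w | v w. v \<in> S \<and> w \<in> S} \<subseteq> tangent ((derived G ^^ Suc n) UNIV)"
    proof clarify
      fix v w assume "v \<in> S" "w \<in> S"
      with Suc have "v \<in> tangent ((derived G ^^ n) UNIV)" "w \<in> tangent ((derived G ^^ n) UNIV)" by auto
      from lie_bracket_tangent_derived[OF this]
      show "lie_bracket G c v w \<in> tangent ((derived G ^^ Suc n) UNIV)" by simp
    qed
    then show ?case
      using S span_minimal[OF _ subspace_tangent[OF sub[of "Suc n"]]] by blast
  qed
  moreover have "tangent {\<one>} \<subseteq> {0}"
  proof
    fix v assume "v \<in> tangent {\<one>}"
    then obtain \<gamma> where "\<And>t. \<gamma> t \<in> {\<one>}" "lead 1 \<gamma> v" using tangentE by blast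
    moreover from this(1) have "\<gamma> = (\<lambda>t. \<one>)" by auto
    ultimately show "v \<in> {0}" using lead_unique[OF lead_one, of 1 v] by simp
  qed
  ultimately show ?thesis using n subset_trans[of S "tangent {\<one>}"] by metis
qed

end

section \<open>Lie algebras in frames\<close>

definition comb :: "'v::real_vector \<Rightarrow> 'v \<Rightarrow> 'v \<Rightarrow> 'v \<Rightarrow> real^4 \<Rightarrow> 'v" where
  "comb v1 v2 v3 v4 x = x $ 1 *\<^sub>R v1 + x $ 2 *\<^sub>R v2 + x $ 3 *\<^sub>R v3 + x $ 4 *\<^sub>R v4"

definition frame :: "'v::real_vector \<Rightarrow> 'v \<Rightarrow> 'v \<Rightarrow> 'v \<Rightarrow> bool" where
  "frame v1 v2 v3 v4 \<longleftrightarrow> (\<forall>a b c d. a *\<^sub>R v1 + b *\<^sub>R v2 + c *\<^sub>R v3 + d *\<^sub>R v4 = 0 \<longrightarrow> a = 0 \<and> b = 0 \<and> c = 0 \<and> d =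
    0)"

lemma linear_comb: "linear (comb v1 v2 v3 v4)"
  by (auto simp: linear_iff comb_def algebra_simps)

lemma comb_linear: "linear f \<Longrightarrow> f (comb v1 v2 v3 v4 x) = comb (f v1) (f v2) (f v3) (f v4) x"
  by (simp add: comb_def linear_add linear_scale)

lemma vector_4_nth:
  "(vector [a, b, c, d] :: 'a::zero^4) $ 1 = a"
  "(vector [a, b, c, d] :: 'a::zero^4) $ 2 = b"
  "(vector [a, b, c, d] :: 'a::zero^4) $ 3 = c"
  "(vector [a, b, c, d] :: 'a::zero^4) $ 4 = d"
  by (simp_all add: vector_def)

lemma comb_vector: "comb v1 v2 v3 v4 (vector [a, b, c, d]) = a *\<^sub>R v1 + b *\<^sub>R v2 + c *\<^sub>R v3 + d *\<^sub>R v4"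
  by (simp add: comb_def vector_4_nth)

lemma frame_iff_inj: "frame v1 v2 v3 v4 \<longleftrightarrow> inj (comb v1 v2 v3 v4)"
proof -
  have "frame v1 v2 v3 v4 \<longleftrightarrow> (\<forall>x. comb v1 v2 v3 v4 x = 0 \<longrightarrow> x = 0)"
  proof
    assume "frame v1 v2 v3 v4"
    then show "\<forall>x. comb v1 v2 v3 v4 x = 0 \<longrightarrow> x = 0"
      by (auto simp: frame_def comb_def vec_eq_iff forall_4)
  next
    assume *: "\<forall>x. comb v1 v2 v3 v4 x = 0 \<longrightarrow> x = 0"
    show "frame v1 v2 v3 v4"
      unfolding frame_def
    proof (intro allI impI)
      fix a b c d assume "a *\<^sub>R v1 + b *\<^sub>R v2 + c *\<^sub>R v3 + d *\<^sub>R v4 = 0"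
      with * have "(vector [a, b, c, d] :: real^4) = 0" by (simp add: comb_vector)
      then show "a = 0 \<and> b = 0 \<and> c = 0 \<and> d = 0"
        by (simp add: vec_eq_iff forall_4 vector_4_nth)
    qed
  qed
  then show ?thesis
    by (simp add: linear_inj_iff_eq_0[OF linear_comb])
qed

lemma frame_imp_bij:
  fixes v1 :: "real^4"
  assumes "frame v1 v2 v3 v4"
  shows "bij (comb v1 v2 v3 v4)"
  using assms linear_injective_imp_surjective[OF linear_comb, of v1 v2 v3 v4]
  by (auto simp: frame_iff_inj bij_def)

lemma frame_coords:
  fixes v1 :: "real^4"
  assumes "frame v1 v2 v3 v4"
  obtains a b c d where "x = a *\<^sub>R v1 + b *\<^sub>R v2 + c *\<^sub>R v3 + d *\<^sub>R v4"
proof -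
  obtain y where "x = comb v1 v2 v3 v4 y"
    using frame_imp_bij[OF assms] by (metis bij_pointE)
  then show ?thesis using that by (simp add: comb_def)
qed

lemma frame_eqD:
  assumes "frame v1 v2 v3 v4" "a *\<^sub>R v1 + b *\<^sub>R v2 + c *\<^sub>R v3 + d *\<^sub>R v4 = 0"
  shows "a = 0" "b = 0" "c = 0" "d = 0"
  using assms unfolding frame_def by blast+

lemma alternating_swap:
  assumes "bilinear br" "\<And>x. br x x = 0"
  shows "br y x = - br x y"
proof -
  have "br (x + y) (x + y) = br x x + br x y + (br y x + br y y)"
    by (simp add: bilinear_ladd[OF assms(1)] bilinear_radd[OF assms(1)])
  then show ?thesis
    using assms(2) by (simp add: eq_neg_iff_add_eq_0 add.commute)
qed

lemma bracket_comb:
  assumes br: "bilinear br" "\<And>x. br x x = 0"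
  shows "br (comb v1 v2 v3 v4 x) (comb v1 v2 v3 v4 y) =
    (x $ 1 * y $ 2 - x $ 2 * y $ 1) *\<^sub>R br v1 v2 + (x $ 1 * y $ 3 - x $ 3 * y $ 1) *\<^sub>R br v1 v3
  + (x $ 1 * y $ 4 - x $ 4 * y $ 1) *\<^sub>R br v1 v4 + (x $ 2 * y $ 3 - x $ 3 * y $ 2) *\<^sub>R br v2 v3
  + (x $ 2 * y $ 4 - x $ 4 * y $ 2) *\<^sub>R br v2 v4 + (x $ 3 * y $ 4 - x $ 4 * y $ 3) *\<^sub>R br v3 v4"
proof -
  note sw = alternating_swap[OF br]
  show ?thesis
    unfolding comb_def
    by (simp add: bilinear_ladd[OF br(1)] bilinear_radd[OF br(1)] bilinear_lmul[OF br(1)] bilinear_rmul[OF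
      br(1)]
        br(2) sw[of v2 v1] sw[of v3 v1] sw[of v4 v1] sw[of v3 v2] sw[of v4 v2] sw[of v4 v3]
        algebra_simps)
qed

text \<open>An isomorphism is the same as a basis with prescribed structure constants: the inverse
  map carries the \<open>w\<close> to such a basis, and conversely equal coordinates define the map.
  The second algebra may live on any vector space, which covers the products in the list.\<close>

lemma lie_iso_iff_frame:
  fixes br :: "real^4 \<Rightarrow> real^4 \<Rightarrow> real^4" and br' :: "'w::real_vector \<Rightarrow> 'w \<Rightarrow> 'w"
  assumes br: "bilinear br" "\<And>x. br x x = 0" and br': "bilinear br'" "\<And>x. br' x x = 0"
    and bij: "bij (comb w1 w2 w3 w4)"
    and c: "br' w1 w2 = comb w1 w2 w3 w4 cp" "br' w1 w3 = comb w1 w2 w3 w4 cq" "br' w1 w4 = comb w1 w2 w3 w4 cr"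
      "br' w2 w3 = comb w1 w2 w3 w4 cs" "br' w2 w4 = comb w1 w2 w3 w4 ct" "br' w3 w4 = comb w1 w2 w3 w4 cu"
  shows "lie_iso br br' \<longleftrightarrow> (\<exists>v1 v2 v3 v4. frame v1 v2 v3 v4 \<and>
     br v1 v2 = comb v1 v2 v3 v4 cp \<and> br v1 v3 = comb v1 v2 v3 v4 cq \<and> br v1 v4 = comb v1 v2 v3 v4 cr \<and>
     br v2 v3 = comb v1 v2 v3 v4 cs \<and> br v2 v4 = comb v1 v2 v3 v4 ct \<and> br v3 v4 = comb v1 v2 v3 v4 cu)"
    (is "_ \<longleftrightarrow> ?R")
proof
  assume "lie_iso br br'"
  then obtain f where f: "linear f" "bij f" "\<And>x y. f (br x y) = br' (f x) (f y)"
    by (auto simp: lie_iso_def)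
  define h where "h = inv_into UNIV f"
  have fh: "f (h x) = x" for x
    unfolding h_def using f(2) by (meson bij_inv_eq_iff)
  have inj: "f x = f y \<Longrightarrow> x = y" for x y
    using f(2) by (simp add: bij_is_inj inj_eq)
  have h: "linear h"
    by (intro linearI; rule inj) (simp_all add: fh linear_add[OF f(1)] linear_scale[OF f(1)])
  have hbr: "br (h x) (h y) = h (br' x y)" for x y
    by (rule inj) (simp add: fh f(3))
  have "inj h" by (metis fh injI)
  then have "frame (h w1) (h w2) (h w3) (h w4)"
    unfolding frame_iff_inj using bij
    by (auto simp: inj_def bij_def simp flip: comb_linear[OF h])
  then show ?R
    by (intro exI[of _ "h w1"] exI[of _ "h w2"] exI[of _ "h w3"] exI[of _ "h w4"])
      (simp add: hbr c comb_linear[OF h])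
next
  assume ?R
  then obtain v1 v2 v3 v4 where v: "frame v1 v2 v3 v4"
     "br v1 v2 = comb v1 v2 v3 v4 cp" "br v1 v3 = comb v1 v2 v3 v4 cq" "br v1 v4 = comb v1 v2 v3 v4 cr"
     "br v2 v3 = comb v1 v2 v3 v4 cs" "br v2 v4 = comb v1 v2 v3 v4 ct" "br v3 v4 = comb v1 v2 v3 v4 cu"
    by auto
  let ?V = "comb v1 v2 v3 v4" and ?W = "comb w1 w2 w3 w4"
  define q where "q = inv_into UNIV ?V"
  have Vq: "?V (q x) = x" and qV: "q (?V y) = y" for x y
    unfolding q_def using frame_imp_bij[OF v(1)] by (auto simp: bij_def surj_f_inv_f)
  have inj: "?V x = ?V y \<Longrightarrow> x = y" for x y by (metis qV)
  have q: "linear q"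
    by (intro linearI; rule inj) (simp_all add: Vq linear_add[OF linear_comb] linear_scale[OF linear_comb])
  have "?W (q (br (?V x) (?V y))) = br' (?W x) (?W y)" for x y
    unfolding bracket_comb[OF br] bracket_comb[OF br'] v c
    by (simp add: linear_add[OF q] linear_scale[OF q] qV linear_add[OF linear_comb] linear_scale[OF
      linear_comb])
  then have "?W (q (br x y)) = br' (?W (q x)) (?W (q y))" for x y
    by (metis Vq)
  moreover have "bij q" unfolding q_def using frame_imp_bij[OF v(1)] bij_imp_bij_inv by blast
  then have "bij (\<lambda>x. ?W (q x))"
    using bij bij_comp by (fastforce simp: comp_def)
  moreover have "linear (\<lambda>x. ?W (q x))"
    using linear_compose[OF q linear_comb] by (simp add: comp_def)
  ultimately show "lie_iso br br'"
    unfolding lie_iso_def by blast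
qed

section \<open>The algebras of the list in terms of structure constants\<close>

lemma bij_comb_axis: "bij (comb (axis 1 1) (axis 2 1) (axis 3 1) (axis 4 1) :: real^4 \<Rightarrow> real^4)"
proof -
  have "comb (axis 1 1) (axis 2 1) (axis 3 1) (axis 4 1) = (\<lambda>x::real^4. x)"
    by (simp add: fun_eq_iff comb_def vec_eq_iff forall_4 axis_def)
  then show ?thesis by (simp add: bij_def)
qed

lemma bij_comb_real_times: "bij (comb (1, 0) (0, axis 1 1) (0, axis 2 1) (0, axis 3 1) :: real^4 \<Rightarrow> real \<times>
  (real^3))"
proof (rule o_bij)
  let ?f = "\<lambda>p::real \<times> (real^3). vector [fst p, snd p $ 1, snd p $ 2, snd p $ 3] :: real^4"
  show "?f \<circ> comb (1, 0) (0, axis 1 1) (0, axis 2 1) (0, axis 3 1) = id"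
    by (simp add: fun_eq_iff comb_def vec_eq_iff forall_4 vector_4_nth axis_def)
  show "comb (1, 0) (0, axis 1 1) (0, axis 2 1) (0, axis 3 1) \<circ> ?f = id"
    by (simp add: fun_eq_iff comb_def vec_eq_iff forall_3 vector_4_nth axis_def)
qed

lemma bij_comb_times: "bij (comb (axis 1 1, 0) (axis 2 1, 0) (0, axis 1 1) (0, axis 2 1) :: real^4 \<Rightarrow> (real^2)
  \<times> (real^2))"
proof (rule o_bij)
  let ?f = "\<lambda>p::(real^2) \<times> (real^2). vector [fst p $ 1, fst p $ 2, snd p $ 1, snd p $ 2] :: real^4"
  show "?f \<circ> comb (axis 1 1, 0) (axis 2 1, 0) (0, axis 1 1) (0, axis 2 1) = id"
    by (simp add: fun_eq_iff comb_def vec_eq_iff forall_4 vector_4_nth axis_def)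
  show "comb (axis 1 1, 0) (axis 2 1, 0) (0, axis 1 1) (0, axis 2 1) \<circ> ?f = id"
    by (simp add: fun_eq_iff comb_def vec_eq_iff forall_2 vector_4_nth axis_def)
qed

lemmas lie_algebra_defs = abelian_def lie_prod_def aff_R_def h3_def r3_def r3'_def r4_def r4'_def d4_def
  d4l_def d4'_def lie_eqs_def

lemma bilinear_lie_algebras:
  "bilinear (abelian :: 'v::real_vector \<Rightarrow> _)" "bilinear aff_R" "bilinear h3" "bilinear (r3 l)" "bilinear (r3'
    l)"
  "bilinear (r4 m l)" "bilinear (r4' m l)" "bilinear d4" "bilinear (d4l l)" "bilinear (d4' l)"
  by (auto simp: lie_algebra_defs bilinear_def linear_iff vec_eq_iff forall_2 forall_3 forall_4 vector_2
    vector_3 vector_4_nth algebra_simps)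

lemma alternating_lie_algebras:
  "abelian x (x::'v::real_vector) = 0" "aff_R y y = 0" "h3 z z = 0" "r3 l z z = 0" "r3' l z z = 0"
  "r4 m l w w = 0" "r4' m l w w = 0" "d4 w w = 0" "d4l l w w = 0" "d4' l w w = 0"
  by (simp_all add: lie_algebra_defs vec_eq_iff forall_2 forall_3 forall_4 vector_2 vector_3 vector_4_nth
    algebra_simps)

lemma bilinear_lie_prod: "bilinear b1 \<Longrightarrow> bilinear b2 \<Longrightarrow> bilinear (b1 \<times>\<^sub>L b2)"
  by (simp add: bilinear_def linear_iff lie_prod_def)

lemma alternating_lie_prod: "(\<And>x. b1 x x = 0) \<Longrightarrow> (\<And>x. b2 x x = 0) \<Longrightarrow> (b1 \<times>\<^sub>L b2) p p = 0"
  by (simp add: lie_prod_def zero_prod_def)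

context
  fixes br :: "real^4 \<Rightarrow> real^4 \<Rightarrow> real^4"
  assumes br: "bilinear br" "\<And>x. br x x = 0"
begin

lemma lie_iso_abelian_iff:
  "lie_iso br (abelian :: real^4 \<Rightarrow> _) \<longleftrightarrow> (\<exists>v1 v2 v3 v4. frame v1 v2 v3 v4 \<and>
     br v1 v2 = 0 \<and> br v1 v3 = 0 \<and> br v1 v4 = 0 \<and> br v2 v3 = 0 \<and> br v2 v4 = 0 \<and> br v3 v4 = 0)"
  by (subst lie_iso_iff_frame[OF br bilinear_lie_algebras(1) alternating_lie_algebras(1) bij_comb_axis,
        where cp = "vector [0,0,0,0]" and cq = "vector [0,0,0,0]" and cr = "vector [0,0,0,0]" and cs = "vector
          [0,0,0,0]" and ct = "vector [0,0,0,0]" and cu = "vector [0,0,0,0]"])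
    (simp_all add: comb_vector abelian_def lie_eqs_def vec_eq_iff forall_2 forall_3 forall_4 vector_4_nth
      axis_def)

text \<open>The indices are shifted in the products with R: \<open>v1\<close> spans the factor R,
  and \<open>v2\<close>, \<open>v3\<close>, \<open>v4\<close> are the basis vectors E_1, E_2, E_3 of
  the other factor.\<close>

lemma lie_iso_R_h3_iff:
  "lie_iso br ((abelian :: real \<Rightarrow> _) \<times>\<^sub>L h3) \<longleftrightarrow> (\<exists>v1 v2 v3 v4. frame v1 v2 v3 v4 \<and>
     br v1 v2 = 0 \<and> br v1 v3 = 0 \<and> br v1 v4 = 0 \<and> br v2 v3 = v4 \<and> br v2 v4 = 0 \<and> br v3 v4 = 0)"
  by (subst lie_iso_iff_frame[OF br bilinear_lie_prod[OF bilinear_lie_algebras(1) bilinear_lie_algebras(3)]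
    alternating_lie_prod[OF alternating_lie_algebras(1) alternating_lie_algebras(3)] bij_comb_real_times,
        where cp = "vector [0,0,0,0]" and cq = "vector [0,0,0,0]" and cr = "vector [0,0,0,0]" and cs = "vector
          [0,0,0,1]" and ct = "vector [0,0,0,0]" and cu = "vector [0,0,0,0]"])
    (simp_all add: comb_vector abelian_def lie_prod_def h3_def lie_eqs_def vec_eq_iff forall_2 forall_3
      forall_4 vector_4_nth axis_def)

lemma lie_iso_R_r3_0_iff:
  "lie_iso br ((abelian :: real \<Rightarrow> _) \<times>\<^sub>L r3 0) \<longleftrightarrow> (\<exists>v1 v2 v3 v4. frame v1 v2 v3 v4 \<and>
     br v1 v2 = 0 \<and> br v1 v3 = 0 \<and> br v1 v4 = 0 \<and> br v2 v3 = v3 \<and> br v2 v4 = 0 \<and> br v3 v4 = 0)"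
  by (subst lie_iso_iff_frame[OF br bilinear_lie_prod[OF bilinear_lie_algebras(1) bilinear_lie_algebras(4)]
    alternating_lie_prod[OF alternating_lie_algebras(1) alternating_lie_algebras(4)] bij_comb_real_times,
        where cp = "vector [0,0,0,0]" and cq = "vector [0,0,0,0]" and cr = "vector [0,0,0,0]" and cs = "vector
          [0,0,1,0]" and ct = "vector [0,0,0,0]" and cu = "vector [0,0,0,0]"])
    (simp_all add: comb_vector abelian_def lie_prod_def r3_def lie_eqs_def vec_eq_iff forall_2 forall_3
      forall_4 vector_4_nth axis_def)

lemma lie_iso_R_r3'_0_iff:
  "lie_iso br ((abelian :: real \<Rightarrow> _) \<times>\<^sub>L r3' 0) \<longleftrightarrow> (\<exists>v1 v2 v3 v4. frame v1 v2 v3 v4 \<and>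
     br v1 v2 = 0 \<and> br v1 v3 = 0 \<and> br v1 v4 = 0 \<and> br v2 v3 = - v4 \<and> br v2 v4 = v3 \<and> br v3 v4 = 0)"
  by (subst lie_iso_iff_frame[OF br bilinear_lie_prod[OF bilinear_lie_algebras(1) bilinear_lie_algebras(5)]
    alternating_lie_prod[OF alternating_lie_algebras(1) alternating_lie_algebras(5)] bij_comb_real_times,
        where cp = "vector [0,0,0,0]" and cq = "vector [0,0,0,0]" and cr = "vector [0,0,0,0]" and cs = "vector
          [0,0,0,-1]" and ct = "vector [0,0,1,0]" and cu = "vector [0,0,0,0]"])
    (simp_all add: comb_vector abelian_def lie_prod_def r3'_def lie_eqs_def vec_eq_iff forall_2 forall_3
      forall_4 vector_4_nth axis_def)

lemma lie_iso_aff_aff_iff: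
  "lie_iso br (aff_R \<times>\<^sub>L aff_R) \<longleftrightarrow> (\<exists>v1 v2 v3 v4. frame v1 v2 v3 v4 \<and>
     br v1 v2 = v2 \<and> br v1 v3 = 0 \<and> br v1 v4 = 0 \<and> br v2 v3 = 0 \<and> br v2 v4 = 0 \<and> br v3 v4 = v4)"
  by (subst lie_iso_iff_frame[OF br bilinear_lie_prod[OF bilinear_lie_algebras(2) bilinear_lie_algebras(2)]
    alternating_lie_prod[OF alternating_lie_algebras(2) alternating_lie_algebras(2)] bij_comb_times,
        where cp = "vector [0,1,0,0]" and cq = "vector [0,0,0,0]" and cr = "vector [0,0,0,0]" and cs = "vector
          [0,0,0,0]" and ct = "vector [0,0,0,0]" and cu = "vector [0,0,0,1]"])
    (simp_all add: comb_vector abelian_def lie_prod_def aff_R_def lie_eqs_def vec_eq_iff forall_2 forall_3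
      forall_4 vector_4_nth axis_def)

lemma lie_iso_r4_iff:
  "lie_iso br (r4 m l) \<longleftrightarrow> (\<exists>v1 v2 v3 v4. frame v1 v2 v3 v4 \<and>
     br v1 v2 = v2 \<and> br v1 v3 = m *\<^sub>R v3 \<and> br v1 v4 = l *\<^sub>R v4 \<and> br v2 v3 = 0 \<and> br v2 v4 = 0 \<and> br v3 v4 = 0)"
  by (subst lie_iso_iff_frame[OF br bilinear_lie_algebras(6) alternating_lie_algebras(6) bij_comb_axis,
        where cp = "vector [0,1,0,0]" and cq = "vector [0,0,m,0]" and cr = "vector [0,0,0,l]" and cs = "vector
          [0,0,0,0]" and ct = "vector [0,0,0,0]" and cu = "vector [0,0,0,0]"])
    (simp_all add: comb_vector r4_def lie_eqs_def vec_eq_iff forall_2 forall_3 forall_4 vector_4_nth axis_def)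

lemma lie_iso_r4'_iff:
  "lie_iso br (r4' m l) \<longleftrightarrow> (\<exists>v1 v2 v3 v4. frame v1 v2 v3 v4 \<and>
     br v1 v2 = m *\<^sub>R v2 \<and> br v1 v3 = l *\<^sub>R v3 - v4 \<and> br v1 v4 = v3 + l *\<^sub>R v4 \<and> br v2 v3 = 0 \<and> br v2 v4 = 0 \<and>
       br v3 v4 = 0)"
  by (subst lie_iso_iff_frame[OF br bilinear_lie_algebras(7) alternating_lie_algebras(7) bij_comb_axis,
        where cp = "vector [0,m,0,0]" and cq = "vector [0,0,l,-1]" and cr = "vector [0,0,1,l]" and cs =
          "vector [0,0,0,0]" and ct = "vector [0,0,0,0]" and cu = "vector [0,0,0,0]"])
    (simp_all add: comb_vector r4'_def lie_eqs_def vec_eq_iff forall_2 forall_3 forall_4 vector_4_nth axis_def)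

lemma lie_iso_d4_iff:
  "lie_iso br d4 \<longleftrightarrow> (\<exists>v1 v2 v3 v4. frame v1 v2 v3 v4 \<and>
     br v1 v2 = v2 \<and> br v1 v3 = - v3 \<and> br v1 v4 = 0 \<and> br v2 v3 = v4 \<and> br v2 v4 = 0 \<and> br v3 v4 = 0)"
  by (subst lie_iso_iff_frame[OF br bilinear_lie_algebras(8) alternating_lie_algebras(8) bij_comb_axis,
        where cp = "vector [0,1,0,0]" and cq = "vector [0,0,-1,0]" and cr = "vector [0,0,0,0]" and cs =
          "vector [0,0,0,1]" and ct = "vector [0,0,0,0]" and cu = "vector [0,0,0,0]"])
    (simp_all add: comb_vector d4_def lie_eqs_def vec_eq_iff forall_2 forall_3 forall_4 vector_4_nth axis_def)

lemma lie_iso_d4l_iff: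
  "lie_iso br (d4l l) \<longleftrightarrow> (\<exists>v1 v2 v3 v4. frame v1 v2 v3 v4 \<and>
     br v1 v2 = l *\<^sub>R v2 \<and> br v1 v3 = (1 - l) *\<^sub>R v3 \<and> br v1 v4 = v4 \<and> br v2 v3 = v4 \<and> br v2 v4 = 0 \<and> br v3 v4
       = 0)"
  by (subst lie_iso_iff_frame[OF br bilinear_lie_algebras(9) alternating_lie_algebras(9) bij_comb_axis,
        where cp = "vector [0,l,0,0]" and cq = "vector [0,0,1 - l,0]" and cr = "vector [0,0,0,1]" and cs =
          "vector [0,0,0,1]" and ct = "vector [0,0,0,0]" and cu = "vector [0,0,0,0]"])
    (simp_all add: comb_vector d4l_def lie_eqs_def vec_eq_iff forall_2 forall_3 forall_4 vector_4_nth axis_def)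

lemma lie_iso_d4'_iff:
  "lie_iso br (d4' l) \<longleftrightarrow> (\<exists>v1 v2 v3 v4. frame v1 v2 v3 v4 \<and>
     br v1 v2 = l *\<^sub>R v2 - v3 \<and> br v1 v3 = v2 + l *\<^sub>R v3 \<and> br v1 v4 = (2 * l) *\<^sub>R v4 \<and> br v2 v3 = v4 \<and> br v2
       v4 = 0 \<and> br v3 v4 = 0)"
  by (subst lie_iso_iff_frame[OF br bilinear_lie_algebras(10) alternating_lie_algebras(10) bij_comb_axis,
        where cp = "vector [0,l,-1,0]" and cq = "vector [0,1,l,0]" and cr = "vector [0,0,0,2 * l]" and cs =
          "vector [0,0,0,1]" and ct = "vector [0,0,0,0]" and cu = "vector [0,0,0,0]"])
    (simp_all add: comb_vector d4'_def lie_eqs_def vec_eq_iff forall_2 forall_3 forall_4 vector_4_nth axis_def)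

end

section \<open>SKT structures in frames\<close>

lemma ext_d_three_form:
  "ext_d br \<alpha> [X, Y, Z, W] = - \<alpha> [br X Y, Z, W] + \<alpha> [br X Z, Y, W] - \<alpha> [br X W, Y, Z]
     - \<alpha> [br Y Z, X, W] + \<alpha> [br Y W, X, Z] - \<alpha> [br Z W, X, Y]"
  by (simp add: ext_d_def eval_nat_numeral nths_Cons)

text \<open>The value of \<open>Jd\<omega>\<close> on three vectors, with the signs of \<open>Jd\<omega> = - d\<omega>(J\<cdot>, J\<cdot>, J\<cdot>)\<close> and of \<open>ext_d\<close> cancelled.\<close>
definition JdJ :: "('v::real_vector \<Rightarrow> 'v \<Rightarrow> 'v) \<Rightarrow> ('v \<Rightarrow> 'v \<Rightarrow> real) \<Rightarrow> ('v \<Rightarrow> 'v) \<Rightarrow> 'v \<Rightarrow> 'v \<Rightarrow> 'v \<Rightarrow> real" where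
  "JdJ br g J X Y Z = g (J (br (J X) (J Y))) (J Z) - g (J (br (J X) (J Z))) (J Y) + g (J (br (J Y) (J Z))) (J
    X)"

lemma SKT_iff:
  "SKT br g J \<longleftrightarrow> almost_hermitian g J \<and> integrable_cs br J \<and>
     (\<forall>X Y Z W. JdJ br g J (br X Y) Z W - JdJ br g J (br X Z) Y W + JdJ br g J (br X W) Y Z
        + JdJ br g J (br Y Z) X W - JdJ br g J (br Y W) X Z + JdJ br g J (br Z W) X Y = 0)"
proof -
  have "ext_d br (\<lambda>Xs. - ext_d br (fundamental_form g J) (map J Xs)) [X, Y, Z, W] =
     - (JdJ br g J (br X Y) Z W - JdJ br g J (br X Z) Y W + JdJ br g J (br X W) Y Z
        + JdJ br g J (br Y Z) X W - JdJ br g J (br Y W) X Z + JdJ br g J (br Z W) X Y)" for X Y Z W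
    by (simp add: ext_d_three_form ext_d_two_form fundamental_form_def JdJ_def)
  then show ?thesis
    unfolding SKT_def Let_def by (simp only: neg_equal_0_iff_equal)
qed

lemma SKT_lie_iso:
  assumes iso: "lie_iso br br'" and skt: "SKT br' g J"
  shows "\<exists>g J. SKT br g J"
proof -
  obtain f where f: "linear f" "bij f" "\<And>x y. f (br x y) = br' (f x) (f y)"
    using iso by (auto simp: lie_iso_def)
  have inj: "f x = f y \<Longrightarrow> x = y" for x y
    using f(2) by (simp add: bij_is_inj inj_eq)
  define J' where "J' x = inv_into UNIV f (J (f x))" for x
  define g' where "g' x y = g (f x) (f y)" for x y
  have fJ: "f (J' x) = J (f x)" for x
    unfolding J'_def using f(2) by (simp add: bij_is_surj surj_f_inv_f)
  have J: "linear J" "\<And>X. J (J X) = - X" and g: "inner_product g" "\<And>X Y. g (J X) (J Y) = g X Y"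
    and int: "integrable_cs br' J"
    using skt by (auto simp: SKT_iff almost_hermitian_def)
  have "linear J'"
    by (intro linearI; rule inj)
      (simp_all add: fJ linear_add[OF f(1)] linear_scale[OF f(1)] linear_add[OF J(1)] linear_scale[OF J(1)])
  moreover have "J' (J' X) = - X" for X
    by (rule inj) (simp add: fJ J linear_neg[OF f(1)])
  moreover have "inner_product g'"
    using g(1) linear_compose[OF f(1)] linear_injective_0[OF f(1)] f(2)
    unfolding inner_product_def g'_def by (auto simp: comp_def bij_def)
  ultimately have "almost_hermitian g' J'"
    by (simp add: almost_hermitian_def g'_def fJ g)
  moreover have "integrable_cs br J'"
    unfolding integrable_cs_def nijenhuis_def
  proof (intro allI)
    fix X Y
    have "f (br (J' X) (J' Y) - J' (br (J' X) Y) - J' (br X (J' Y)) - br X Y) = nijenhuis br' J (f X) (f Y)"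
      by (simp add: linear_diff[OF f(1)] fJ f(3) nijenhuis_def)
    then show "br (J' X) (J' Y) - J' (br (J' X) Y) - J' (br X (J' Y)) - br X Y = 0"
      using int by (intro inj) (simp add: linear_0[OF f(1)] integrable_cs_def)
  qed
  moreover have "JdJ br g' J' X Y Z = JdJ br' g J (f X) (f Y) (f Z)" for X Y Z
    by (simp add: JdJ_def g'_def fJ f(3))
  ultimately have "SKT br g' J'"
    using skt by (simp add: SKT_iff f(3))
  then show ?thesis by blast
qed

text \<open>The brackets of a \<open>complex_frame\<close>, defined below, in which
  \<open>k3\<close>, \<open>k4\<close>, \<open>f3\<close>, \<open>f4\<close> and \<sigma> vanish.
  Every algebra of the list has a frame of this kind.\<close>

definition model :: "real \<Rightarrow> real \<Rightarrow> real \<Rightarrow> real \<Rightarrow> real \<Rightarrow> real \<Rightarrow> real^4 \<Rightarrow> real^4 \<Rightarrow> real^4" where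
  "model \<alpha> a s \<rho> y \<delta> X Y = (let p = (\<lambda>i j. X $ i * Y $ j - X $ j * Y $ i) in
     vector [0, \<alpha> * p 1 2 + \<delta> * p 3 4, (a + \<rho>) * p 1 3 - s * p 1 4 + (\<rho> - y) * p 2 4,
       s * p 1 3 + (a - \<rho>) * p 1 4 + (y + \<rho>) * p 2 3])"

definition J0 :: "real^4 \<Rightarrow> real^4" where
  "J0 X = vector [- X $ 2, X $ 1, - X $ 4, X $ 3]"

lemma SKT_model:
  assumes "(\<delta> - 2 * a) * (\<alpha> + 2 * a) = 0"
  shows "SKT (model \<alpha> a s \<rho> y \<delta>) (\<bullet>) J0"
proof -
  \<comment> \<open>\<open>D\<close> is the 3-form e_2 e_3 e_4. The two factors of the hypothesis
    have separate origins: Jd\<omega> is \<delta> - 2 a times \<open>D\<close>, and the exterior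
    derivative of \<open>D\<close> is, up to sign, the trace \<alpha> + 2 a of ad e1 times the
    volume form.\<close>
  define D :: "real^4 \<Rightarrow> real^4 \<Rightarrow> real^4 \<Rightarrow> real" where
    "D X Y Z = X $ 2 * (Y $ 3 * Z $ 4 - Y $ 4 * Z $ 3) - Y $ 2 * (X $ 3 * Z $ 4 - X $ 4 * Z $ 3)
       + Z $ 2 * (X $ 3 * Y $ 4 - X $ 4 * Y $ 3)" for X Y Z
  have "JdJ (model \<alpha> a s \<rho> y \<delta>) (\<bullet>) J0 X Y Z = (\<delta> - 2 * a) * D X Y Z" for X Y Z
    unfolding JdJ_def J0_def model_def D_def Let_def inner_vec_def sum_4 vector_4_nth inner_real_def
    by algebra
  moreover have "almost_hermitian (\<bullet>) J0"
  proof -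
    have "inner_product ((\<bullet>) :: real^4 \<Rightarrow> _)"
      by (auto simp: inner_product_def linear_iff inner_commute inner_add_right)
    then show ?thesis
      by (auto simp: almost_hermitian_def linear_iff J0_def vec_eq_iff forall_4 vector_4_nth inner_vec_def
        sum_4)
  qed
  moreover have "integrable_cs (model \<alpha> a s \<rho> y \<delta>) J0"
    unfolding integrable_cs_def nijenhuis_def J0_def model_def Let_def
    by (auto simp: vec_eq_iff forall_4 vector_4_nth algebra_simps)
  moreover have "(\<delta> - 2 * a) * (D (model \<alpha> a s \<rho> y \<delta> X Y) Z W - D (model \<alpha> a s \<rho> y \<delta> X Z) Y W
      + D (model \<alpha> a s \<rho> y \<delta> X W) Y Z + D (model \<alpha> a s \<rho> y \<delta> Y Z) X W
      - D (model \<alpha> a s \<rho> y \<delta> Y W) X Z + D (model \<alpha> a s \<rho> y \<delta> Z W) X Y) = 0" for X Y Z W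
    using assms unfolding D_def model_def Let_def vector_4_nth by algebra
  ultimately show ?thesis
    unfolding SKT_iff by (simp add: distrib_left right_diff_distrib)
qed

lemma SKT_frame:
  fixes br :: "real^4 \<Rightarrow> real^4 \<Rightarrow> real^4"
  assumes br: "bilinear br" "\<And>x. br x x = 0" and v: "frame v1 v2 v3 v4"
    "br v1 v2 = \<alpha> *\<^sub>R v2" "br v1 v3 = (a + \<rho>) *\<^sub>R v3 + s *\<^sub>R v4" "br v1 v4 = - s *\<^sub>R v3 + (a - \<rho>) *\<^sub>R v4"
    "br v2 v3 = (y + \<rho>) *\<^sub>R v4" "br v2 v4 = (\<rho> - y) *\<^sub>R v3" "br v3 v4 = \<delta> *\<^sub>R v2"
    and "(\<delta> - 2 * a) * (\<alpha> + 2 * a) = 0"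
  shows "\<exists>g J. SKT br g J"
proof -
  have m: "bilinear (model \<alpha> a s \<rho> y \<delta>)" "\<And>x. model \<alpha> a s \<rho> y \<delta> x x = 0"
    by (auto simp: model_def Let_def bilinear_def linear_iff vec_eq_iff forall_4 vector_4_nth algebra_simps)
  have "lie_iso br (model \<alpha> a s \<rho> y \<delta>)"
  proof (subst lie_iso_iff_frame[OF br m bij_comb_axis,
        where cp = "vector [0, \<alpha>, 0, 0]" and cq = "vector [0, 0, a + \<rho>, s]" and cr = "vector [0, 0, - s, a - \<rho>]"
          and cs = "vector [0, 0, 0, y + \<rho>]" and ct = "vector [0, 0, \<rho> - y, 0]" and cu = "vector [0, \<delta>, 0, 0]"])
    show "\<exists>v1 v2 v3 v4. frame v1 v2 v3 v4 \<and>
      br v1 v2 = comb v1 v2 v3 v4 (vector [0, \<alpha>, 0, 0]) \<and> br v1 v3 = comb v1 v2 v3 v4 (vector [0, 0, a + \<rho>,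
        s]) \<and>
      br v1 v4 = comb v1 v2 v3 v4 (vector [0, 0, - s, a - \<rho>]) \<and> br v2 v3 = comb v1 v2 v3 v4 (vector [0, 0, 0,
        y + \<rho>]) \<and>
      br v2 v4 = comb v1 v2 v3 v4 (vector [0, 0, \<rho> - y, 0]) \<and> br v3 v4 = comb v1 v2 v3 v4 (vector [0, \<delta>, 0, 0])"
      using v by (intro exI[of _ v1] exI[of _ v2] exI[of _ v3] exI[of _ v4]) (simp add: comb_vector)
  qed (simp_all add: comb_vector model_def Let_def vec_eq_iff forall_4 vector_4_nth axis_def)
  from SKT_lie_iso[OF this SKT_model[OF assms(10)]] show ?thesis .
qed

lemma frame_change:
  assumes v: "frame v1 v2 v3 v4"
    and e: "e1 = a1 *\<^sub>R v1 + a2 *\<^sub>R v2 + a3 *\<^sub>R v3 + a4 *\<^sub>R v4"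
      "e2 = b1 *\<^sub>R v1 + b2 *\<^sub>R v2 + b3 *\<^sub>R v3 + b4 *\<^sub>R v4"
      "e3 = c1 *\<^sub>R v1 + c2 *\<^sub>R v2 + c3 *\<^sub>R v3 + c4 *\<^sub>R v4"
      "e4 = k1 *\<^sub>R v1 + k2 *\<^sub>R v2 + k3 *\<^sub>R v3 + k4 *\<^sub>R v4"
    and inv: "\<And>p q r t. p * a1 + q * b1 + r * c1 + t * k1 = 0 \<Longrightarrow> p * a2 + q * b2 + r * c2 + t * k2 = 0 \<Longrightarrow>
      p * a3 + q * b3 + r * c3 + t * k3 = 0 \<Longrightarrow> p * a4 + q * b4 + r * c4 + t * k4 = 0 \<Longrightarrow>
      p = 0 \<and> q = 0 \<and> r = 0 \<and> t = 0"
  shows "frame e1 e2 e3 e4"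
  unfolding frame_def
proof (intro allI impI)
  fix p q r t assume "p *\<^sub>R e1 + q *\<^sub>R e2 + r *\<^sub>R e3 + t *\<^sub>R e4 = 0"
  then have "(p * a1 + q * b1 + r * c1 + t * k1) *\<^sub>R v1 + (p * a2 + q * b2 + r * c2 + t * k2) *\<^sub>R v2
      + (p * a3 + q * b3 + r * c3 + t * k3) *\<^sub>R v3 + (p * a4 + q * b4 + r * c4 + t * k4) *\<^sub>R v4 = 0"
    by (simp add: e algebra_simps)
  from frame_eqD[OF v this] show "p = 0 \<and> q = 0 \<and> r = 0 \<and> t = 0"
    by (rule inv)
qed

section \<open>SKT structures on the algebras of the list\<close>

context
  fixes br :: "real^4 \<Rightarrow> real^4 \<Rightarrow> real^4"
  assumes br: "bilinear br" "\<And>x. br x x = 0"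
begin

lemmas swap = alternating_swap[OF br]
lemmas bracket_simps = br(2) bilinear_ladd[OF br(1)] bilinear_radd[OF br(1)] bilinear_lmul[OF br(1)]
  bilinear_rmul[OF br(1)]
  bilinear_lneg[OF br(1)] bilinear_rneg[OF br(1)] bilinear_lsub[OF br(1)] bilinear_rsub[OF br(1)]

lemma SKT_if_lie_iso_abelian:
  assumes "lie_iso br (abelian :: real^4 \<Rightarrow> _)"
  shows "\<exists>g J. SKT br g J"
proof -
  obtain v1 v2 v3 v4 where v: "frame v1 v2 v3 v4" and t: "br v1 v2 = 0" "br v1 v3 = 0" "br v1 v4 = 0" "br v2
    v3 = 0" "br v2 v4 = 0" "br v3 v4 = 0"
    using assms(1) unfolding lie_iso_abelian_iff[OF br] by auto
  note [simp] = t bracket_simps swap[of v2 v1] swap[of v3 v1] swap[of v4 v1] swap[of v3 v2] swap[of v4 v2]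
    swap[of v4 v3]
  define e1 e2 e3 e4 where e: "e1 = v1" "e2 = v2" "e3 = v3" "e4 = v4"
  have "frame e1 e2 e3 e4"
    by (rule frame_change[OF v, of _ 1 0 0 0 _ 0 1 0 0 _ 0 0 1 0 _ 0 0 0 1])
      (auto simp: e algebra_simps)
  then show ?thesis
    by (rule SKT_frame[OF br, where \<alpha> = 0 and a = 0 and s = 0 and \<rho> = 0 and y = 0 and \<delta> = 0])
      (simp_all add: e algebra_simps)
qed

lemma SKT_if_lie_iso_R_h3:
  assumes "lie_iso br ((abelian :: real \<Rightarrow> _) \<times>\<^sub>L h3)"
  shows "\<exists>g J. SKT br g J"
proof -
  obtain v1 v2 v3 v4 where v: "frame v1 v2 v3 v4" and t: "br v1 v2 = 0" "br v1 v3 = 0" "br v1 v4 = 0" "br v2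
    v3 = v4" "br v2 v4 = 0" "br v3 v4 = 0"
    using assms(1) unfolding lie_iso_R_h3_iff[OF br] by auto
  note [simp] = t bracket_simps swap[of v2 v1] swap[of v3 v1] swap[of v4 v1] swap[of v3 v2] swap[of v4 v2]
    swap[of v4 v3]
  define e1 e2 e3 e4 where e: "e1 = v1" "e2 = v4" "e3 = v2" "e4 = v3"
  have "frame e1 e2 e3 e4"
    by (rule frame_change[OF v, of _ 1 0 0 0 _ 0 0 0 1 _ 0 1 0 0 _ 0 0 1 0])
      (auto simp: e algebra_simps)
  then show ?thesis
    by (rule SKT_frame[OF br, where \<alpha> = 0 and a = 0 and s = 0 and \<rho> = 0 and y = 0 and \<delta> = 1])
      (simp_all add: e algebra_simps)
qed

lemma SKT_if_lie_iso_R_r3_0: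
  assumes "lie_iso br ((abelian :: real \<Rightarrow> _) \<times>\<^sub>L r3 0)"
  shows "\<exists>g J. SKT br g J"
proof -
  obtain v1 v2 v3 v4 where v: "frame v1 v2 v3 v4" and t: "br v1 v2 = 0" "br v1 v3 = 0" "br v1 v4 = 0" "br v2
    v3 = v3" "br v2 v4 = 0" "br v3 v4 = 0"
    using assms(1) unfolding lie_iso_R_r3_0_iff[OF br] by auto
  note [simp] = t bracket_simps swap[of v2 v1] swap[of v3 v1] swap[of v4 v1] swap[of v3 v2] swap[of v4 v2]
    swap[of v4 v3]
  define e1 e2 e3 e4 where e: "e1 = v2" "e2 = v3" "e3 = v1" "e4 = v4"
  have "frame e1 e2 e3 e4"
    by (rule frame_change[OF v, of _ 0 1 0 0 _ 0 0 1 0 _ 1 0 0 0 _ 0 0 0 1])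
      (auto simp: e algebra_simps)
  then show ?thesis
    by (rule SKT_frame[OF br, where \<alpha> = 1 and a = 0 and s = 0 and \<rho> = 0 and y = 0 and \<delta> = 0])
      (simp_all add: e algebra_simps)
qed

lemma SKT_if_lie_iso_R_r3'_0:
  assumes "lie_iso br ((abelian :: real \<Rightarrow> _) \<times>\<^sub>L r3' 0)"
  shows "\<exists>g J. SKT br g J"
proof -
  obtain v1 v2 v3 v4 where v: "frame v1 v2 v3 v4" and t: "br v1 v2 = 0" "br v1 v3 = 0" "br v1 v4 = 0" "br v2
    v3 = - v4" "br v2 v4 = v3" "br v3 v4 = 0"
    using assms(1) unfolding lie_iso_R_r3'_0_iff[OF br] by auto
  note [simp] = t bracket_simps swap[of v2 v1] swap[of v3 v1] swap[of v4 v1] swap[of v3 v2] swap[of v4 v2]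
    swap[of v4 v3]
  define e1 e2 e3 e4 where e: "e1 = v2" "e2 = v1" "e3 = v3" "e4 = v4"
  have "frame e1 e2 e3 e4"
    by (rule frame_change[OF v, of _ 0 1 0 0 _ 1 0 0 0 _ 0 0 1 0 _ 0 0 0 1])
      (auto simp: e algebra_simps)
  then show ?thesis
    by (rule SKT_frame[OF br, where \<alpha> = 0 and a = 0 and s = "-1" and \<rho> = 0 and y = 0 and \<delta> = 0])
      (simp_all add: e algebra_simps)
qed

lemma SKT_if_lie_iso_aff_aff:
  assumes "lie_iso br (aff_R \<times>\<^sub>L aff_R)"
  shows "\<exists>g J. SKT br g J"
proof -
  obtain v1 v2 v3 v4 where v: "frame v1 v2 v3 v4" and t: "br v1 v2 = v2" "br v1 v3 = 0" "br v1 v4 = 0" "br v2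
    v3 = 0" "br v2 v4 = 0" "br v3 v4 = v4"
    using assms(1) unfolding lie_iso_aff_aff_iff[OF br] by auto
  note [simp] = t bracket_simps swap[of v2 v1] swap[of v3 v1] swap[of v4 v1] swap[of v3 v2] swap[of v4 v2]
    swap[of v4 v3]
  \<comment> \<open>The complex structure is the product one, J v1 = v2 / 2 and J v3 = v4 / 2. The
    frame mixes the two factors because the trace of ad takes the same value on \<open>v1\<close>
    and \<open>v3\<close>: its kernel contains \<open>v1 - v3\<close>, and \<open>e1\<close> has to
    be normal to this kernel.\<close>
  define e1 e2 e3 e4 where e: "e1 = v1 + v3" "e2 = (1/2) *\<^sub>R v2 + (1/2) *\<^sub>R v4" "e3 = v1 - v3" "e4 = (1/2) *\<^sub>R
    v2 - (1/2) *\<^sub>R v4"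
  have "frame e1 e2 e3 e4"
    by (rule frame_change[OF v, of _ 1 0 1 0 _ 0 "1/2" 0 "1/2" _ 1 0 "-1" 0 _ 0 "1/2" 0 "-1/2"])
      (auto simp: e algebra_simps)
  then show ?thesis
    by (rule SKT_frame[OF br, where \<alpha> = 1 and a = "1/2" and s = 0 and \<rho> = "-1/2" and y = "-1/2" and \<delta> = 1])
      (simp_all add: e algebra_simps)
qed

lemma SKT_if_lie_iso_r4'_0:
  assumes "lie_iso br (r4' l 0)"
  shows "\<exists>g J. SKT br g J"
proof -
  obtain v1 v2 v3 v4 where v: "frame v1 v2 v3 v4" and t: "br v1 v2 = l *\<^sub>R v2" "br v1 v3 = - v4" "br v1 v4 =
    v3" "br v2 v3 = 0" "br v2 v4 = 0" "br v3 v4 = 0"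
    using assms(1) unfolding lie_iso_r4'_iff[OF br] by auto
  note [simp] = t bracket_simps swap[of v2 v1] swap[of v3 v1] swap[of v4 v1] swap[of v3 v2] swap[of v4 v2]
    swap[of v4 v3]
  define e1 e2 e3 e4 where e: "e1 = v1" "e2 = v2" "e3 = v3" "e4 = v4"
  have "frame e1 e2 e3 e4"
    by (rule frame_change[OF v, of _ 1 0 0 0 _ 0 1 0 0 _ 0 0 1 0 _ 0 0 0 1])
      (auto simp: e algebra_simps)
  then show ?thesis
    by (rule SKT_frame[OF br, where \<alpha> = "l" and a = 0 and s = "-1" and \<rho> = 0 and y = 0 and \<delta> = 0])
      (simp_all add: e algebra_simps)
qed

lemma SKT_if_lie_iso_r4:
  assumes "lie_iso br (r4 (- 1/2) (- 1/2))"
  shows "\<exists>g J. SKT br g J"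
proof -
  obtain v1 v2 v3 v4 where v: "frame v1 v2 v3 v4" and t: "br v1 v2 = v2" "br v1 v3 = (- 1/2) *\<^sub>R v3" "br v1 v4
    = (- 1/2) *\<^sub>R v4" "br v2 v3 = 0" "br v2 v4 = 0" "br v3 v4 = 0"
    using assms(1) unfolding lie_iso_r4_iff[OF br] by auto
  note [simp] = t bracket_simps swap[of v2 v1] swap[of v3 v1] swap[of v4 v1] swap[of v3 v2] swap[of v4 v2]
    swap[of v4 v3]
  define e1 e2 e3 e4 where e: "e1 = v1" "e2 = v2" "e3 = v3" "e4 = v4"
  have "frame e1 e2 e3 e4"
    by (rule frame_change[OF v, of _ 1 0 0 0 _ 0 1 0 0 _ 0 0 1 0 _ 0 0 0 1])
      (auto simp: e algebra_simps)
  then show ?thesis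
    by (rule SKT_frame[OF br, where \<alpha> = 1 and a = "-1/2" and s = 0 and \<rho> = 0 and y = 0 and \<delta> = 0])
      (simp_all add: e algebra_simps)
qed

lemma SKT_if_lie_iso_r4':
  assumes "lie_iso br (r4' (2 * l) (- l))"
  shows "\<exists>g J. SKT br g J"
proof -
  obtain v1 v2 v3 v4 where v: "frame v1 v2 v3 v4" and t: "br v1 v2 = (2 * l) *\<^sub>R v2" "br v1 v3 = (- l) *\<^sub>R v3
    - v4" "br v1 v4 = v3 + (- l) *\<^sub>R v4" "br v2 v3 = 0" "br v2 v4 = 0" "br v3 v4 = 0"
    using assms(1) unfolding lie_iso_r4'_iff[OF br] by auto
  note [simp] = t bracket_simps swap[of v2 v1] swap[of v3 v1] swap[of v4 v1] swap[of v3 v2] swap[of v4 v2]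
    swap[of v4 v3]
  define e1 e2 e3 e4 where e: "e1 = v1" "e2 = v2" "e3 = v3" "e4 = v4"
  have "frame e1 e2 e3 e4"
    by (rule frame_change[OF v, of _ 1 0 0 0 _ 0 1 0 0 _ 0 0 1 0 _ 0 0 0 1])
      (auto simp: e algebra_simps)
  then show ?thesis
    by (rule SKT_frame[OF br, where \<alpha> = "2 * l" and a = "- l" and s = "-1" and \<rho> = 0 and y = 0 and \<delta> = 0])
      (simp_all add: e algebra_simps)
qed

lemma SKT_if_lie_iso_d4:
  assumes "lie_iso br d4"
  shows "\<exists>g J. SKT br g J"
proof -
  obtain v1 v2 v3 v4 where v: "frame v1 v2 v3 v4" and t: "br v1 v2 = v2" "br v1 v3 = - v3" "br v1 v4 = 0" "br
    v2 v3 = v4" "br v2 v4 = 0" "br v3 v4 = 0"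
    using assms(1) unfolding lie_iso_d4_iff[OF br] by auto
  note [simp] = t bracket_simps swap[of v2 v1] swap[of v3 v1] swap[of v4 v1] swap[of v3 v2] swap[of v4 v2]
    swap[of v4 v3]
  \<comment> \<open>Since \<open>e4\<close> commutes with \<open>e1\<close> and \<open>e2\<close>,
    necessarily a = \<rho> = y, and [e1, e3] = e3 makes them 1/2. Then [e2, e3] has to be
    \<open>e4\<close>, which fixes the sign of \<open>e4\<close>.\<close>
  define e1 e2 e3 e4 where e: "e1 = v1" "e2 = v3" "e3 = v2" "e4 = - v4"
  have "frame e1 e2 e3 e4"
    by (rule frame_change[OF v, of _ 1 0 0 0 _ 0 0 1 0 _ 0 1 0 0 _ 0 0 0 "-1"])
      (auto simp: e algebra_simps)
  then show ?thesis
    by (rule SKT_frame[OF br, where \<alpha> = "-1" and a = "1/2" and s = 0 and \<rho> = "1/2" and y = "1/2" and \<delta> = 0])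
      (simp_all add: e algebra_simps)
qed

lemma SKT_if_lie_iso_d4_2:
  assumes "lie_iso br (d4l 2)"
  shows "\<exists>g J. SKT br g J"
proof -
  obtain v1 v2 v3 v4 where v: "frame v1 v2 v3 v4" and t: "br v1 v2 = (2) *\<^sub>R v2" "br v1 v3 = (1 - 2) *\<^sub>R v3"
    "br v1 v4 = v4" "br v2 v3 = v4" "br v2 v4 = 0" "br v3 v4 = 0"
    using assms(1) unfolding lie_iso_d4l_iff[OF br] by auto
  note [simp] = t bracket_simps swap[of v2 v1] swap[of v3 v1] swap[of v4 v1] swap[of v3 v2] swap[of v4 v2]
    swap[of v4 v3]
  \<comment> \<open>The eigenvalues -1 and 1 of ad e1 on \<open>e3\<close> and \<open>e4\<close>
    give a = 0 and \<rho> = -1, and [e2, e4] = 0 gives y = \<rho>. Hence [e2, e3] has to be -2 e4,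
    which fixes the factor -1/2.\<close>
  define e1 e2 e3 e4 where e: "e1 = v1" "e2 = v2" "e3 = v3" "e4 = (- 1/2) *\<^sub>R v4"
  have "frame e1 e2 e3 e4"
    by (rule frame_change[OF v, of _ 1 0 0 0 _ 0 1 0 0 _ 0 0 1 0 _ 0 0 0 "-1/2"])
      (auto simp: e algebra_simps)
  then show ?thesis
    by (rule SKT_frame[OF br, where \<alpha> = "2" and a = 0 and s = 0 and \<rho> = "-1" and y = "-1" and \<delta> = 0])
      (simp_all add: e algebra_simps)
qed

lemma SKT_if_lie_iso_d4'_0:
  assumes "lie_iso br (d4' 0)"
  shows "\<exists>g J. SKT br g J"
proof -
  obtain v1 v2 v3 v4 where v: "frame v1 v2 v3 v4" and t: "br v1 v2 = - v3" "br v1 v3 = v2" "br v1 v4 = 0" "br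
    v2 v3 = v4" "br v2 v4 = 0" "br v3 v4 = 0"
    using assms(1) unfolding lie_iso_d4'_iff[OF br] by auto
  note [simp] = t bracket_simps swap[of v2 v1] swap[of v3 v1] swap[of v4 v1] swap[of v3 v2] swap[of v4 v2]
    swap[of v4 v3]
  define e1 e2 e3 e4 where e: "e1 = v1" "e2 = v4" "e3 = v2" "e4 = v3"
  have "frame e1 e2 e3 e4"
    by (rule frame_change[OF v, of _ 1 0 0 0 _ 0 0 0 1 _ 0 1 0 0 _ 0 0 1 0])
      (auto simp: e algebra_simps)
  then show ?thesis
    by (rule SKT_frame[OF br, where \<alpha> = 0 and a = 0 and s = "-1" and \<rho> = 0 and y = 0 and \<delta> = 1])
      (simp_all add: e algebra_simps)
qed

lemma SKT_if_lie_iso_d4_half: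
  assumes "lie_iso br (d4l (1/2))"
  shows "\<exists>g J. SKT br g J"
proof -
  obtain v1 v2 v3 v4 where v: "frame v1 v2 v3 v4" and t: "br v1 v2 = (1/2) *\<^sub>R v2" "br v1 v3 = (1 - 1/2) *\<^sub>R
    v3" "br v1 v4 = v4" "br v2 v3 = v4" "br v2 v4 = 0" "br v3 v4 = 0"
    using assms(1) unfolding lie_iso_d4l_iff[OF br] by auto
  note [simp] = t bracket_simps swap[of v2 v1] swap[of v3 v1] swap[of v4 v1] swap[of v3 v2] swap[of v4 v2]
    swap[of v4 v3]
  define e1 e2 e3 e4 where e: "e1 = v1" "e2 = v4" "e3 = v2" "e4 = v3"
  have "frame e1 e2 e3 e4"
    by (rule frame_change[OF v, of _ 1 0 0 0 _ 0 0 0 1 _ 0 1 0 0 _ 0 0 1 0])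
      (auto simp: e algebra_simps)
  then show ?thesis
    by (rule SKT_frame[OF br, where \<alpha> = 1 and a = "1/2" and s = 0 and \<rho> = 0 and y = 0 and \<delta> = 1])
      (simp_all add: e algebra_simps)
qed

lemma SKT_if_lie_iso_d4':
  assumes "lie_iso br (d4' l)" "l > 0"
  shows "\<exists>g J. SKT br g J"
proof -
  obtain v1 v2 v3 v4 where v: "frame v1 v2 v3 v4" and t: "br v1 v2 = l *\<^sub>R v2 - v3" "br v1 v3 = v2 + l *\<^sub>R v3"
    "br v1 v4 = (2 * l) *\<^sub>R v4" "br v2 v3 = v4" "br v2 v4 = 0" "br v3 v4 = 0"
    using assms(1) unfolding lie_iso_d4'_iff[OF br] by auto
  note [simp] = t bracket_simps swap[of v2 v1] swap[of v3 v1] swap[of v4 v1] swap[of v3 v2] swap[of v4 v2]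
    swap[of v4 v3]
  \<comment> \<open>Here \<alpha> + 2 a = 4 l is nonzero, so the SKT equation demands \<delta> = 2 a
    = 2 l; the scale of \<open>e2\<close> is chosen accordingly.\<close>
  define e1 e2 e3 e4 where e: "e1 = v1" "e2 = (1/(2*l)) *\<^sub>R v4" "e3 = v2" "e4 = v3"
  have "frame e1 e2 e3 e4"
    by (rule frame_change[OF v, of _ 1 0 0 0 _ 0 0 0 "1/(2*l)" _ 0 1 0 0 _ 0 0 1 0])
      (use assms(2) in \<open>auto simp: e algebra_simps\<close>)
  then show ?thesis
    by (rule SKT_frame[OF br, where \<alpha> = "2 * l" and a = "l" and s = "-1" and \<rho> = 0 and y = 0 and \<delta> = "2 * l"])
      (use assms(2) in \<open>simp_all add: e algebra_simps\<close>)
qed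

end

section \<open>Recognising the algebras of the list\<close>

text \<open>The combination \<open>comb\<close> with its coefficients as separate arguments, in
  which identities between vectors become identities between reals.\<close>

definition lc :: "'v::real_vector \<Rightarrow> 'v \<Rightarrow> 'v \<Rightarrow> 'v \<Rightarrow> real \<Rightarrow> real \<Rightarrow> real \<Rightarrow> real \<Rightarrow> 'v" where
  "lc e1 e2 e3 e4 p q r t = p *\<^sub>R e1 + q *\<^sub>R e2 + r *\<^sub>R e3 + t *\<^sub>R e4"

lemma lc_arith:
  "lc e1 e2 e3 e4 p q r t + lc e1 e2 e3 e4 p' q' r' t' = lc e1 e2 e3 e4 (p + p') (q + q') (r + r') (t + t')"
  "lc e1 e2 e3 e4 p q r t - lc e1 e2 e3 e4 p' q' r' t' = lc e1 e2 e3 e4 (p - p') (q - q') (r - r') (t - t')"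
  "- lc e1 e2 e3 e4 p q r t = lc e1 e2 e3 e4 (- p) (- q) (- r) (- t)"
  "c *\<^sub>R lc e1 e2 e3 e4 p q r t = lc e1 e2 e3 e4 (c * p) (c * q) (c * r) (c * t)"
  by (simp_all add: lc_def algebra_simps)

lemma lc_basis:
  "lc e1 e2 e3 e4 1 0 0 0 = e1" "lc e1 e2 e3 e4 0 1 0 0 = e2" "lc e1 e2 e3 e4 0 0 1 0 = e3" "lc e1 e2 e3 e4 0
    0 0 1 = e4"
  by (simp_all add: lc_def)

lemma lc_eq_0_iff: "frame e1 e2 e3 e4 \<Longrightarrow> lc e1 e2 e3 e4 p q r t = 0 \<longleftrightarrow> p = 0 \<and> q = 0 \<and> r = 0 \<and> t = 0"
  by (auto simp: lc_def frame_def)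

lemma lc_eq_iff:
  assumes "frame e1 e2 e3 e4"
  shows "lc e1 e2 e3 e4 p q r t = lc e1 e2 e3 e4 p' q' r' t' \<longleftrightarrow> p = p' \<and> q = q' \<and> r = r' \<and> t = t'"
  using lc_eq_0_iff[OF assms, of "p - p'" "q - q'" "r - r'" "t - t'"] lc_arith(2)[of e1 e2 e3 e4 p q r t p' q'
    r' t'] by auto

text \<open>Identify the span of \<open>e3\<close> and \<open>e4\<close> with the complex numbers via \<open>e3 = 1\<close>, \<open>e4 = \<i>\<close>. Modulo \<open>e2\<close>,
  the adjoint action of \<open>e1\<close> is \<open>z \<mapsto> (a + s \<i>) z + (\<rho> + \<sigma> \<i>) cnj z\<close> and that of \<open>e2\<close> is
  \<open>z \<mapsto> y \<i> z + \<i> (\<rho> + \<sigma> \<i>) cnj z\<close>. That the parameters of the two actions and of \<open>br e3 e4\<close> are shared is the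
  content of integrability and of \<open>e2\<close>, \<open>e3\<close>, \<open>e4\<close> having trace zero.\<close>
definition complex_frame where
  "complex_frame br e1 e2 e3 e4 \<alpha> k3 k4 f3 f4 a s \<rho> \<sigma> y \<delta> \<longleftrightarrow> frame e1 e2 e3 e4 \<and>
     br e1 e2 = lc e1 e2 e3 e4 0 \<alpha> k3 k4 \<and> br e1 e3 = lc e1 e2 e3 e4 0 f3 (a + \<rho>) (\<sigma> + s) \<and>
     br e1 e4 = lc e1 e2 e3 e4 0 f4 (\<sigma> - s) (a - \<rho>) \<and> br e2 e3 = lc e1 e2 e3 e4 0 (- f4) (- \<sigma>) (\<rho> + y) \<and>
     br e2 e4 = lc e1 e2 e3 e4 0 f3 (\<rho> - y) \<sigma> \<and> br e3 e4 = lc e1 e2 e3 e4 0 \<delta> (- f3) (- f4)"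

lemma complex_frame_bracket:
  assumes br: "bilinear br" "\<And>x. br x x = 0"
    and cf: "complex_frame br e1 e2 e3 e4 \<alpha> k3 k4 f3 f4 a s \<rho> \<sigma> y \<delta>"
  shows "br (lc e1 e2 e3 e4 p q r t) (lc e1 e2 e3 e4 p' q' r' t') = lc e1 e2 e3 e4 0
     (\<alpha> * (p * q' - q * p') + f3 * (p * r' - r * p') + f4 * (p * t' - t * p')
       - f4 * (q * r' - r * q') + f3 * (q * t' - t * q') + \<delta> * (r * t' - t * r'))
     (k3 * (p * q' - q * p') + (a + \<rho>) * (p * r' - r * p') + (\<sigma> - s) * (p * t' - t * p')
       - \<sigma> * (q * r' - r * q') + (\<rho> - y) * (q * t' - t * q') - f3 * (r * t' - t * r'))
     (k4 * (p * q' - q * p') + (\<sigma> + s) * (p * r' - r * p') + (a - \<rho>) * (p * t' - t * p')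
       + (\<rho> + y) * (q * r' - r * q') + \<sigma> * (q * t' - t * q') - f4 * (r * t' - t * r'))"
proof -
  have "lc e1 e2 e3 e4 p q r t = comb e1 e2 e3 e4 (vector [p, q, r, t])" for p q r t
    by (simp add: lc_def comb_vector)
  moreover note bracket_comb[OF br, of e1 e2 e3 e4 "vector [p, q, r, t]" "vector [p', q', r', t']"]
  ultimately show ?thesis
    using cf unfolding complex_frame_def vector_4_nth by (simp add: lc_def comb_vector algebra_simps)
qed

section \<open>Isomorphisms read off from a normal frame\<close>

context
  fixes br :: "real^4 \<Rightarrow> real^4 \<Rightarrow> real^4" and e1 e2 e3 e4 :: "real^4" and \<alpha> k3 k4 a s \<rho> y \<delta> :: real
  assumes br: "bilinear br" "\<And>x. br x x = 0" and cf: "complex_frame br e1 e2 e3 e4 \<alpha> k3 k4 0 0 a s \<rho> 0 y \<delta>"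
begin

abbreviation "L \<equiv> lc e1 e2 e3 e4"

lemma fr: "frame e1 e2 e3 e4"
  using cf by (simp add: complex_frame_def)

text \<open>The sixteen coefficients of the new basis are supplied row by row. What remains are the
  bracket relations \<open>P\<close>, settled by \<open>L_simps\<close>, and the linear independence
  of the rows.\<close>

lemma L_witness:
  assumes "P (L a1 a2 a3 a4) (L b1 b2 b3 b4) (L c1 c2 c3 c4) (L g1 g2 g3 g4)"
    and "\<And>p q r t. p * a1 + q * b1 + r * c1 + t * g1 = 0 \<Longrightarrow> p * a2 + q * b2 + r * c2 + t * g2 = 0 \<Longrightarrow>
      p * a3 + q * b3 + r * c3 + t * g3 = 0 \<Longrightarrow> p * a4 + q * b4 + r * c4 + t * g4 = 0 \<Longrightarrow>
      p = 0 \<and> q = 0 \<and> r = 0 \<and> t = 0"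
  shows "\<exists>v1 v2 v3 v4. frame v1 v2 v3 v4 \<and> P v1 v2 v3 v4"
  using assms(1) frame_change[OF fr lc_def lc_def lc_def lc_def assms(2)] by blast

lemmas L_simps = complex_frame_bracket[OF br cf] lc_arith lc_eq_0_iff[OF fr] lc_eq_iff[OF fr]

lemma normal_frame_heisenberg:
  assumes "\<alpha> = 0" "a = 0" "s = 0" "\<rho> = 0" "y = 0" "k3 = 0" "k4 = 0" "\<delta> \<noteq> 0"
  shows "lie_iso br ((abelian :: real \<Rightarrow> _) \<times>\<^sub>L h3)"
  unfolding lie_iso_R_h3_iff[OF br]
  by (rule L_witness[of _ 1 0 0 0 0 0 1 0 0 0 0 1 0 \<delta> 0 0]) (use assms in \<open>auto simp: L_simps\<close>)

lemma normal_frame_d4'_0: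
  assumes "\<alpha> = 0" "a = 0" "s \<noteq> 0" "\<rho> = 0" "y = 0" "k3 = 0" "k4 = 0" "\<delta> \<noteq> 0"
  shows "lie_iso br (d4' 0)"
  unfolding lie_iso_d4'_iff[OF br]
  by (rule L_witness[of _ "-1/s" 0 0 0 0 0 1 0 0 0 0 1 0 \<delta> 0 0]) (use assms in \<open>auto simp: L_simps\<close>)

lemma normal_frame_d4_half:
  assumes "\<alpha> = 2 * a" "a \<noteq> 0" "s = 0" "\<rho> = 0" "y = 0" "k3 = 0" "k4 = 0" "\<delta> \<noteq> 0"
  shows "lie_iso br (d4l (1/2))"
  unfolding lie_iso_d4l_iff[OF br]
  by (rule L_witness[of _ "1/(2*a)" 0 0 0 0 0 1 0 0 0 0 1 0 \<delta> 0 0]) (use assms in \<open>auto simp: L_simps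
    field_simps\<close>)

text \<open>Dividing \<open>e1\<close> by - s or s normalises the rotation part of ad e1, and one of
  the two signs makes \<open>l\<close> positive. For the second sign the rotation has the wrong
  orientation, which the exchange of \<open>e3\<close> and \<open>e4\<close> corrects at the price
  of the sign of \<delta>.\<close>

lemma normal_frame_d4':
  assumes "\<alpha> = 2 * a" "a \<noteq> 0" "s \<noteq> 0" "\<rho> = 0" "y = 0" "k3 = 0" "k4 = 0" "\<delta> \<noteq> 0"
  shows "\<exists>l>0. lie_iso br (d4' l)"
proof (cases "a / s < 0")
  case True
  have "lie_iso br (d4' (- a / s))"
    unfolding lie_iso_d4'_iff[OF br]
    by (rule L_witness[of _ "-1/s" 0 0 0 0 0 1 0 0 0 0 1 0 \<delta> 0 0]) (use assms in \<open>auto simp: L_simps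
      field_simps\<close>)
  then show ?thesis using True by (intro exI[of _ "- a / s"]) auto
next
  case False
  have "lie_iso br (d4' (a / s))"
    unfolding lie_iso_d4'_iff[OF br]
    by (rule L_witness[of _ "1/s" 0 0 0 0 0 0 1 0 0 1 0 0 "-\<delta>" 0 0]) (use assms in \<open>auto simp: L_simps
      field_simps\<close>)
  moreover have "a / s > 0" using False assms(2,3) by (auto simp: not_less order_le_less)
  ultimately show ?thesis by blast
qed

lemma normal_frame_aff_aff:
  assumes "\<alpha> = 2 * a" "\<alpha> * \<delta> > 0" "s = 0" "\<rho> = y" "\<alpha> = - 2 * y" "k3 = 0" "k4 = 0"
  shows "lie_iso br (aff_R \<times>\<^sub>L aff_R)"
proof -
  \<comment> \<open>On the span of \<open>e2\<close> and \<open>e4\<close>, ad e1 is multiplication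
    by \<alpha>, while ad e3 sends \<open>e2\<close> to \<alpha> e4 and \<open>e4\<close> to
    \<alpha> c^2 e2. The common eigenvectors are c e2 + e4 and - c e2 + e4; they are real because
    \<alpha> \<delta> > 0.\<close>
  define c where "c = sqrt (\<delta> / \<alpha>)"
  have "\<delta> / \<alpha> > 0" "\<alpha> \<noteq> 0" using assms(2) by (auto simp: zero_less_mult_iff zero_less_divide_iff)
  then have "c * c = \<delta> / \<alpha>" "c > 0"
    by (simp_all only: c_def real_sqrt_mult_self abs_of_pos real_sqrt_gt_0_iff)
  then have c: "c > 0" "\<alpha> * (c * c) = \<delta>" using \<open>\<alpha> \<noteq> 0\<close> by simp_all
  have y: "y = - \<alpha> / 2" "a = \<alpha> / 2" using assms by auto
  show ?thesis
    unfolding lie_iso_aff_aff_iff[OF br]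
    by (rule L_witness[of _ "1/(2*\<alpha>)" 0 "1/(2*\<alpha>*c)" 0 0 c 0 1 "1/(2*\<alpha>)" 0 "-1/(2*\<alpha>*c)" 0 0 "-c" 0 1])
      (use assms(3,4,6,7) y c \<open>\<alpha> \<noteq> 0\<close> in \<open>auto simp: L_simps field_simps simp flip: c(2)\<close>)
qed

text \<open>On the span of \<open>e2\<close>, \<open>e3\<close>, \<open>e4\<close> the eigenvalues
  of ad e1 are - 2 y, 2 y and 0. The second witness is \<open>e2\<close> corrected to an
  eigenvector; its denominators 4 y and 2 y are the differences of the eigenvalues.\<close>

lemma normal_frame_d4:
  assumes "\<alpha> = - 2 * y" "y \<noteq> 0" "a = y" "s = 0" "\<rho> = y" "\<delta> = 0"
  shows "lie_iso br d4"
  unfolding lie_iso_d4_iff[OF br]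
  by (rule L_witness[of _ "-1/(2*y)" 0 0 0 0 1 "-k3/(4*y)" "-k4/(2*y)" 0 0 1 0 0 0 0 "2*y"])
    (use assms in \<open>auto simp: L_simps field_simps\<close>)

text \<open>Here the eigenvalues are - 2 y, y and - y, which explains the denominators 3 y and
  y.\<close>

lemma normal_frame_d4_2:
  assumes "\<alpha> = - 2 * y" "y \<noteq> 0" "a = 0" "s = 0" "\<rho> = y" "\<delta> = 0"
  shows "lie_iso br (d4l 2)"
  unfolding lie_iso_d4l_iff[OF br]
  by (rule L_witness[of _ "-1/y" 0 0 0 0 1 "-k3/(3*y)" "-k4/y" 0 0 1 0 0 0 0 "2*y"])
    (use assms in \<open>auto simp: L_simps field_simps\<close>)

text \<open>ad e1 and ad e2 act on the span of \<open>e3\<close> and \<open>e4\<close> as s and y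
  times the same rotation. A combination of \<open>e1\<close> and \<open>e2\<close> therefore acts
  trivially there, and suitable multiples of \<open>e3\<close> and \<open>e4\<close> make it
  central; this is the first witness.\<close>

lemma normal_frame_R_r3'_0:
  assumes "\<alpha> = 0" "a = 0" "\<rho> = 0" "\<delta> = 0" "y \<noteq> 0 \<or> s \<noteq> 0"
  shows "lie_iso br ((abelian :: real \<Rightarrow> _) \<times>\<^sub>L r3' 0)"
proof (cases "y = 0")
  case False
  show ?thesis
    unfolding lie_iso_R_r3'_0_iff[OF br]
    by (rule L_witness[of _ 1 "-s/y" "k4/y" "-k3/y" 0 "-1/y" 0 0 0 0 1 0 0 0 0 1])
      (use assms False in \<open>auto simp: L_simps field_simps\<close>)
next
  case True
  with assms have "s \<noteq> 0" by simp
  then show ?thesis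
    unfolding lie_iso_R_r3'_0_iff[OF br]
    by (intro L_witness[of _ 0 1 "-k4/s" "k3/s" "-1/s" 0 0 0 0 0 1 0 0 0 0 1])
      (use assms True in \<open>auto simp: L_simps field_simps\<close>)
qed

lemma normal_frame_abelian:
  assumes "\<alpha> = 0" "a = 0" "s = 0" "\<rho> = 0" "y = 0" "k3 = 0" "k4 = 0" "\<delta> = 0"
  shows "lie_iso br (abelian :: real^4 \<Rightarrow> _)"
  unfolding lie_iso_abelian_iff[OF br]
  by (rule L_witness[of _ 1 0 0 0 0 1 0 0 0 0 1 0 0 0 0 1]) (use assms in \<open>auto simp: L_simps\<close>)

lemma normal_frame_R_h3:
  assumes "\<alpha> = 0" "a = 0" "s = 0" "\<rho> = 0" "y = 0" "k3 \<noteq> 0 \<or> k4 \<noteq> 0" "\<delta> = 0"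
  shows "lie_iso br ((abelian :: real \<Rightarrow> _) \<times>\<^sub>L h3)"
  unfolding lie_iso_R_h3_iff[OF br]
\<comment> \<open>The only nonzero bracket of basis vectors is [e1, e2] = k3 e3 + k4 e4. The same
  vector turned by a right angle spans the factor R.\<close>
proof (rule L_witness[of _ 0 0 "-k4" k3 1 0 0 0 0 1 0 0 0 0 k3 k4])
  fix p q r t
  assume "p * 0 + q * 1 + r * 0 + t * 0 = 0" "p * 0 + q * 0 + r * 1 + t * 0 = 0"
    and eq: "p * - k4 + q * 0 + r * 0 + t * k3 = 0" "p * k3 + q * 0 + r * 0 + t * k4 = 0"
  moreover have "k3^2 + k4^2 \<noteq> 0" using assms(6) by (simp add: sum_power2_eq_zero_iff)
  moreover have "p * (k3^2 + k4^2) = 0" "t * (k3^2 + k4^2) = 0"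
    using eq by algebra+
  ultimately have "p = 0" "t = 0" unfolding mult_eq_0_iff by blast+
  with \<open>p * 0 + q * 1 + r * 0 + t * 0 = 0\<close> \<open>p * 0 + q * 0 + r * 1 + t * 0 = 0\<close>
  show "p = 0 \<and> q = 0 \<and> r = 0 \<and> t = 0" by simp
qed (use assms in \<open>auto simp: L_simps\<close>)

context
  assumes common: "\<alpha> \<noteq> 0" "\<rho> = 0" "y = 0" "\<delta> = 0" and ne: "\<alpha> \<noteq> a"
begin

text \<open>With z = u + w i this is the complex equation k3 + k4 i = (\<alpha> - a - s i) z,
  solvable because \<alpha> differs from a; \<open>D\<close> is the squared modulus of the
  coefficient. It says that e2 + u e3 + w e4 is an eigenvector of ad e1 with eigenvalue
  \<alpha>.\<close>

lemma eigenvector_coeffs: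
  obtains u w where "k3 = (\<alpha> - a) * u + s * w" "k4 = (\<alpha> - a) * w - s * u"
proof -
  define D where "D = (\<alpha> - a)^2 + s^2"
  have D: "D \<noteq> 0" using ne by (simp add: D_def sum_power2_eq_zero_iff)
  define u w where uw: "u = ((\<alpha> - a) * k3 - s * k4) / D" "w = ((\<alpha> - a) * k4 + s * k3) / D"
  have Du: "D * u = (\<alpha> - a) * k3 - s * k4" and Dw: "D * w = (\<alpha> - a) * k4 + s * k3"
    using D by (simp_all add: uw)
  have "D * k3 = D * ((\<alpha> - a) * u + s * w)" "D * k4 = D * ((\<alpha> - a) * w - s * u)"
    using Du Dw unfolding D_def by algebra+
  then show thesis using D that by simp
qed

lemma normal_frame_R_r3_0:
  assumes "a = 0" "s = 0"
  shows "lie_iso br ((abelian :: real \<Rightarrow> _) \<times>\<^sub>L r3 0)"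
proof -
  obtain u w where uw: "k3 = (\<alpha> - a) * u + s * w" "k4 = (\<alpha> - a) * w - s * u"
    by (rule eigenvector_coeffs)
  show ?thesis
    unfolding lie_iso_R_r3_0_iff[OF br]
    by (rule L_witness[of _ 0 0 1 0 "1/\<alpha>" 0 0 0 0 1 u w 0 0 0 1])
      (use assms common in \<open>auto simp: L_simps uw field_simps\<close>)
qed

lemma normal_frame_r4'_0:
  assumes "a = 0" "s \<noteq> 0"
  shows "\<exists>l>0. lie_iso br (r4' l 0)"
proof -
  obtain u w where uw: "k3 = (\<alpha> - a) * u + s * w" "k4 = (\<alpha> - a) * w - s * u"
    by (rule eigenvector_coeffs)
  show ?thesis
  \<comment> \<open>As in \<open>normal_frame_d4'\<close>, the sign of \<open>e1\<close> makes the
    parameter positive and an exchange of \<open>e3\<close> and \<open>e4\<close> restores the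
    orientation of the rotation.\<close>
  proof (cases "\<alpha> / s < 0")
    case True
    have "lie_iso br (r4' (- \<alpha> / s) 0)"
      unfolding lie_iso_r4'_iff[OF br]
      by (rule L_witness[of _ "-1/s" 0 0 0 0 1 u w 0 0 1 0 0 0 0 1])
        (use assms common in \<open>auto simp: L_simps uw field_simps\<close>)
    then show ?thesis using True by (intro exI[of _ "- \<alpha> / s"]) auto
  next
    case False
    have "lie_iso br (r4' (\<alpha> / s) 0)"
      unfolding lie_iso_r4'_iff[OF br]
      by (rule L_witness[of _ "1/s" 0 0 0 0 1 u w 0 0 0 1 0 0 1 0])
        (use assms common in \<open>auto simp: L_simps uw field_simps\<close>)
    moreover have "\<alpha> / s > 0" using False assms common by (auto simp: not_less order_le_less)
    ultimately show ?thesis by blast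
  qed
qed

lemma normal_frame_r4:
  assumes "\<alpha> + 2 * a = 0" "s = 0"
  shows "lie_iso br (r4 (- 1/2) (- 1/2))"
proof -
  obtain u w where uw: "k3 = (\<alpha> - a) * u + s * w" "k4 = (\<alpha> - a) * w - s * u"
    by (rule eigenvector_coeffs)
  have "\<alpha> = - 2 * a" using assms by simp
  then show ?thesis
    unfolding lie_iso_r4_iff[OF br]
    by (intro L_witness[of _ "1/\<alpha>" 0 0 0 0 1 u w 0 0 1 0 0 0 0 1])
      (use assms(2) common in \<open>auto simp: L_simps uw field_simps\<close>)
qed

lemma normal_frame_r4':
  assumes "\<alpha> + 2 * a = 0" "s \<noteq> 0"
  shows "\<exists>l>0. lie_iso br (r4' (2 * l) (- l))"
proof -
  obtain u w where uw: "k3 = (\<alpha> - a) * u + s * w" "k4 = (\<alpha> - a) * w - s * u"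
    by (rule eigenvector_coeffs)
  have al: "\<alpha> = - 2 * a" using assms by simp
  show ?thesis
  proof (cases "a / s < 0")
    case False
    have "lie_iso br (r4' (2 * (a / s)) (- (a / s)))"
      unfolding lie_iso_r4'_iff[OF br]
      by (rule L_witness[of _ "-1/s" 0 0 0 0 1 u w 0 0 1 0 0 0 0 1])
        (use assms(2) al common in \<open>auto simp: L_simps uw field_simps\<close>)
    moreover have "a / s > 0" using False assms common al by (auto simp: not_less order_le_less)
    ultimately show ?thesis by blast
  next
    case True
    have "lie_iso br (r4' (2 * (- a / s)) (- (- a / s)))"
      unfolding lie_iso_r4'_iff[OF br]
      by (rule L_witness[of _ "1/s" 0 0 0 0 1 u w 0 0 0 1 0 0 1 0])
        (use assms(2) al common in \<open>auto simp: L_simps uw field_simps\<close>)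
    then show ?thesis using True by (intro exI[of _ "- a / s"]) auto
  qed
qed

end

end

section \<open>The classification\<close>

lemma trace_matrix_frame:
  fixes f :: "real^4 \<Rightarrow> real^4"
  assumes f: "linear f" and v: "frame v1 v2 v3 v4"
    and c: "f v1 = comb v1 v2 v3 v4 c1" "f v2 = comb v1 v2 v3 v4 c2" "f v3 = comb v1 v2 v3 v4 c3" "f v4 = comb
      v1 v2 v3 v4 c4"
  shows "trace (matrix f) = c1 $ 1 + c2 $ 2 + c3 $ 3 + c4 $ 4"
proof -
  let ?V = "comb v1 v2 v3 v4" and ?C = "comb c1 c2 c3 c4"
  have "f \<circ> ?V = ?V \<circ> ?C"
    by (simp add: fun_eq_iff comb_linear[OF f] comb_linear[OF linear_comb] c)
  then have eq: "matrix f ** matrix ?V = matrix ?V ** matrix ?C"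
    by (metis matrix_compose linear_comb f)
  have "inj ((*v) (matrix ?V))"
    using v by (simp add: frame_iff_inj matrix_vector_mul(2)[OF linear_comb])
  then obtain E where E: "E ** matrix ?V = mat 1"
    using matrix_left_invertible_injective by blast
  then have E': "matrix ?V ** E = mat 1"
    by (simp add: matrix_left_right_inverse)
  have "trace (matrix f) = trace (matrix f ** (matrix ?V ** E))" by (simp add: E')
  also have "\<dots> = trace (matrix ?V ** (matrix ?C ** E))" by (simp add: matrix_mul_assoc eq)
  also have "\<dots> = trace (matrix ?C ** E ** matrix ?V)" by (rule trace_mul_sym)
  also have "\<dots> = trace (matrix ?C)" by (simp add: E flip: matrix_mul_assoc)
  also have "\<dots> = c1 $ 1 + c2 $ 2 + c3 $ 3 + c4 $ 4"
    by (simp add: trace_def sum_4 matrix_def comb_def axis_def)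
  finally show ?thesis .
qed

lemma trace_matrix_linear:
  assumes "bilinear (br :: real^'n \<Rightarrow> real^'n \<Rightarrow> real^'n)"
  shows "linear (\<lambda>x. trace (matrix (br x)))"
  by (auto simp: linear_iff trace_def matrix_def bilinear_ladd[OF assms] bilinear_lmul[OF assms] sum.distrib
    sum_distrib_left)

text \<open>By the Jacobi identity ad of a bracket is a commutator of linear maps, and such
  commutators have trace zero.\<close>

lemma trace_matrix_bracket:
  fixes br :: "real^'n \<Rightarrow> real^'n \<Rightarrow> real^'n"
  assumes br: "bilinear br" "\<And>x. br x x = 0"
    and jacobi: "\<And>u v w. br (br u v) w + br (br v w) u + br (br w u) v = 0"
  shows "trace (matrix (br (br x y))) = 0"
proof -
  have lin: "linear (br x)" for x using br(1) by (simp add: bilinear_def)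
  have "br (br x y) z = br x (br y z) - br y (br x z)" for z
  proof -
    have "br (br y z) x = - br x (br y z)" "br (br z x) y = - br y (br z x)" "br z x = - br x z"
      using alternating_swap[OF br] by blast+
    then have "br (br y z) x = - br x (br y z)" "br (br z x) y = br y (br x z)"
      by (simp_all add: bilinear_rneg[OF br(1)])
    then show ?thesis using jacobi[of x y z] by (simp add: algebra_simps)
  qed
  then have "br (br x y) = (\<lambda>z. (br x \<circ> br y) z - (br y \<circ> br x) z)" by auto
  then have "trace (matrix (br (br x y))) = trace (matrix (br x \<circ> br y)) - trace (matrix (br y \<circ> br x))"
    by (simp add: trace_def matrix_def sum_subtractf)
  also have "\<dots> = 0"
    using trace_mul_sym[of "matrix (br x)" "matrix (br y)"] by (simp add: matrix_compose lin)
  finally show ?thesis .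
qed

text \<open>The trace of the adjoint action is such a character unless it vanishes identically, in which case any
  functional
  that kills all brackets will do.\<close>
lemma exists_unimodular_character:
  fixes br :: "real^'n \<Rightarrow> real^'n \<Rightarrow> real^'n"
  assumes br: "bilinear br" "\<And>x. br x x = 0"
    and jacobi: "\<And>u v w. br (br u v) w + br (br v w) u + br (br w u) v = 0"
    and not_perfect: "span {br x y | x y. True} \<noteq> UNIV"
  obtains \<kappa> :: "real^'n \<Rightarrow> real" where "linear \<kappa>" "\<exists>x. \<kappa> x \<noteq> 0" "\<forall>x y. \<kappa> (br x y) = 0"
    "\<forall>x. \<kappa> x = 0 \<longrightarrow> trace (matrix (br x)) = 0"
proof (cases "\<exists>x. trace (matrix (br x)) \<noteq> 0")
  case True
  show ?thesis
  proof (rule that)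
    show "linear (\<lambda>x. trace (matrix (br x)))" by (rule trace_matrix_linear[OF br(1)])
    show "\<forall>x y. trace (matrix (br (br x y))) = 0"
      using trace_matrix_bracket[of br, OF br jacobi] by blast
  qed (use True in auto)
next
  case False
  obtain n where n: "n \<noteq> 0" "\<And>x. x \<in> span {br x y | x y. True} \<Longrightarrow> n \<bullet> x = 0"
    using span_not_UNIV_orthogonal[OF not_perfect] by blast
  show ?thesis
  proof (rule that[of "\<lambda>x. n \<bullet> x"])
    show "linear ((\<bullet>) n)" by (simp add: linear_iff inner_add_right)
    show "\<exists>x. n \<bullet> x \<noteq> 0" using n(1) by (intro exI[of _ n]) simp
    show "\<forall>x y. n \<bullet> br x y = 0" by (intro allI n(2)) (auto intro: span_base)
  qed (use False in auto)
qed

section \<open>Frames adapted to the metric, the complex structure and the character\<close>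

lemma inner_product_facts:
  assumes "inner_product g"
  shows "bilinear g" "g x y = g y x" "g x x = 0 \<longleftrightarrow> x = 0" "x \<noteq> 0 \<Longrightarrow> g x x > 0"
proof -
  have lin: "linear (g x)" and sym: "g x y = g y x" for x y using assms by (auto simp: inner_product_def)
  have "(\<lambda>x. g x y) = g y" for y using sym by auto
  then show b: "bilinear g" using lin by (simp add: bilinear_def)
  show "g x y = g y x" by (rule sym)
  show "x \<noteq> 0 \<Longrightarrow> g x x > 0" using assms by (simp add: inner_product_def)
  then show "g x x = 0 \<longleftrightarrow> x = 0" using bilinear_lzero[OF b] by fastforce
qed

lemma inner_product_riesz:
  fixes g :: "real^4 \<Rightarrow> real^4 \<Rightarrow> real"
  assumes g: "inner_product g" and "linear \<kappa>"
  obtains N where "\<And>x. g N x = \<kappa> x"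
proof -
  let ?A = "axis :: 4 \<Rightarrow> real \<Rightarrow> real^4"
  note b = inner_product_facts[OF g]
  have comb: "comb (?A 1 1) (?A 2 1) (?A 3 1) (?A 4 1) x = x" for x
    by (simp add: comb_def vec_eq_iff forall_4 axis_def)
  have ext: "h x = k x" if "linear h" "linear k" "\<And>i. h (?A i 1) = k (?A i 1)" for h k :: "real^4 \<Rightarrow> real" and x
    using comb_linear[OF that(1), of "?A 1 1" "?A 2 1" "?A 3 1" "?A 4 1" x]
      comb_linear[OF that(2), of "?A 1 1" "?A 2 1" "?A 3 1" "?A 4 1" x] that(3) by (simp add: comb)
  let ?\<Gamma> = "\<lambda>x. \<chi> i. g x (?A i 1)"
  have lin: "linear ?\<Gamma>"
    by (auto simp: linear_iff vec_eq_iff bilinear_ladd[OF b(1)] bilinear_lmul[OF b(1)])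
  have glin: "linear (g x)" for x using g by (simp add: inner_product_def)
  have "x = 0" if "?\<Gamma> x = 0" for x
  proof -
    have "g x x = 0"
      using ext[OF glin linear_zero, of x x] that by (simp add: vec_eq_iff)
    then show ?thesis by (simp add: b)
  qed
  then have "inj ?\<Gamma>"
    by (simp only: linear_inj_iff_eq_0[OF lin]) simp
  then have "surj ?\<Gamma>"
    using linear_injective_imp_surjective[OF lin] by simp
  from surjD[OF this, of "\<chi> i. \<kappa> (?A i 1)"] obtain N where "(\<chi> i. \<kappa> (?A i 1)) = ?\<Gamma> N" by (rule exE)
  then have "g N x = \<kappa> x" for x
    by - (rule ext[OF glin assms(2)], simp add: vec_eq_iff)
  then show ?thesis using that by blast
qed

locale skt_algebra =
  fixes br :: "real^4 \<Rightarrow> real^4 \<Rightarrow> real^4" and g :: "real^4 \<Rightarrow> real^4 \<Rightarrow> real" and J :: "real^4 \<Rightarrow> real^4"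
    and \<kappa> :: "real^4 \<Rightarrow> real"
  assumes br: "bilinear br" "br x x = 0"
    and jacobi: "br (br u v) w + br (br v w) u + br (br w u) v = 0"
    and skt: "SKT br g J"
    and linear_\<kappa>: "linear \<kappa>" and \<kappa>_nontrivial: "\<exists>x. \<kappa> x \<noteq> 0" and \<kappa>_bracket: "\<kappa> (br x y) = 0"
    and trace_ker: "\<kappa> x = 0 \<Longrightarrow> trace (matrix (br x)) = 0"
begin

definition T where "T x = trace (matrix (br x))"

lemma linear_T: "linear T"
  unfolding T_def by (rule trace_matrix_linear[OF br(1)])

lemma J: "linear J" "J (J x) = - x" and J_isometry: "g (J x) (J y) = g x y" and inner_product_g:
  "inner_product g"
  using skt by (auto simp: SKT_iff almost_hermitian_def)

lemmas g = inner_product_facts[OF inner_product_g]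

lemma linear_br: "linear (br x)"
  using br(1) by (simp add: bilinear_def)

text \<open>The metric is kept apart in \<open>orthonormal\<close>: the later changes of frame
  preserve \<open>adapted\<close> only.\<close>

definition adapted where
  "adapted e1 e2 e3 e4 \<longleftrightarrow> frame e1 e2 e3 e4 \<and> \<kappa> e2 = 0 \<and> \<kappa> e3 = 0 \<and> \<kappa> e4 = 0 \<and> J e1 = e2 \<and> J e3 = e4"

definition orthonormal where
  "orthonormal e1 e2 e3 e4 \<longleftrightarrow> g e1 e1 = 1 \<and> g e2 e2 = 1 \<and> g e3 e3 = 1 \<and> g e4 e4 = 1 \<and>
     g e1 e2 = 0 \<and> g e1 e3 = 0 \<and> g e1 e4 = 0 \<and> g e2 e3 = 0 \<and> g e2 e4 = 0 \<and> g e3 e4 = 0"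

lemma exists_orthonormal_adapted: "\<exists>e1 e2 e3 e4. adapted e1 e2 e3 e4 \<and> orthonormal e1 e2 e3 e4"
proof -
  have unit: "g ((1 / sqrt (g x x)) *\<^sub>R x) ((1 / sqrt (g x x)) *\<^sub>R x) = 1" if "x \<noteq> 0" for x
    using g(4)[OF that] by (simp add: bilinear_lmul[OF g(1)] bilinear_rmul[OF g(1)])
  have JJ: "g x (J x) = 0" "g (J x) y = - g x (J y)" for x y
    using J_isometry[of x "J x"] J_isometry[of x "J y"] g(2)[of x "J x"]
    by (simp_all add: J(2) bilinear_rneg[OF g(1)])
  obtain N where N: "\<And>x. g N x = \<kappa> x"
    using inner_product_riesz[OF inner_product_g linear_\<kappa>] by blast
  have "N \<noteq> 0"
    using \<kappa>_nontrivial N bilinear_lzero[OF g(1)] by metis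
  define e1 where "e1 = (1 / sqrt (g N N)) *\<^sub>R N"
  define e2 where "e2 = J e1"
  have ker: "\<kappa> x = 0" if "g e1 x = 0" for x
    using that g(4)[OF \<open>N \<noteq> 0\<close>] by (simp add: e1_def bilinear_lmul[OF g(1)] N)
  \<comment> \<open>A nonzero vector orthogonal to \<open>e1\<close> and \<open>e2\<close> comes
    from a dimension count: \<open>?P\<close> misses the third axis, hence is not injective.\<close>
  let ?P = "\<lambda>x. vector [g e1 x, g e2 x, 0, 0] :: real^4"
  have lin: "linear ?P"
    by (auto simp: linear_iff vec_eq_iff forall_4 vector_4_nth bilinear_radd[OF g(1)] bilinear_rmul[OF g(1)])
  have "\<not> surj ?P"
  proof
    assume "surj ?P"
    from surjD[OF this, of "axis 3 1"] obtain x where "axis 3 1 = ?P x" by (rule exE)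
    then show False by (simp add: vec_eq_iff forall_4 vector_4_nth axis_def)
  qed
  then have "\<not> inj ?P" using linear_injective_imp_surjective[OF lin] by auto
  then obtain z where z: "z \<noteq> 0" "g e1 z = 0" "g e2 z = 0"
    unfolding linear_inj_iff_eq_0[OF lin] by (auto simp: vec_eq_iff forall_4 vector_4_nth)
  define e3 where "e3 = (1 / sqrt (g z z)) *\<^sub>R z"
  define e4 where "e4 = J e3"
  have on13: "g e1 e1 = 1" "g e3 e3 = 1" "g e1 e3 = 0" "g e2 e3 = 0"
    using unit[OF \<open>N \<noteq> 0\<close>] unit[OF z(1)] z(2,3) by (simp_all only: e1_def e3_def bilinear_rmul[OF g(1)]
      scaleR_zero_right)
  moreover have "g e2 e2 = 1" "g e4 e4 = 1" "g e2 e4 = 0"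
    using on13 by (simp_all only: e2_def e4_def J_isometry)
  moreover have "g e1 e2 = 0" "g e3 e4 = 0" "g e1 e4 = 0"
    using on13(4) JJ(1) JJ(2)[of e1 e3] by (simp_all add: e2_def e4_def)
  ultimately have on: "orthonormal e1 e2 e3 e4"
    by (simp add: orthonormal_def)
  have "frame e1 e2 e3 e4"
    unfolding frame_def
  proof (intro allI impI)
    fix p q r t assume eq: "p *\<^sub>R e1 + q *\<^sub>R e2 + r *\<^sub>R e3 + t *\<^sub>R e4 = 0"
    have "g e (p *\<^sub>R e1 + q *\<^sub>R e2 + r *\<^sub>R e3 + t *\<^sub>R e4) = 0" for e
      unfolding eq by (rule bilinear_rzero[OF g(1)])
    then have exp: "p * g e e1 + q * g e e2 + r * g e e3 + t * g e e4 = 0" for e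
      by (simp add: bilinear_radd[OF g(1)] bilinear_rmul[OF g(1)])
    show "p = 0 \<and> q = 0 \<and> r = 0 \<and> t = 0"
      using exp[of e1] exp[of e2] exp[of e3] exp[of e4] on
      by (simp add: orthonormal_def g(2)[of e2 e1] g(2)[of e3 e1] g(2)[of e3 e2] g(2)[of e4 e1] g(2)[of e4 e2]
        g(2)[of e4 e3])
  qed
  moreover have "\<kappa> e2 = 0" "\<kappa> e3 = 0" "\<kappa> e4 = 0"
    using on by (auto intro!: ker simp: orthonormal_def)
  ultimately have "adapted e1 e2 e3 e4"
    by (simp add: adapted_def e2_def e4_def)
  with on show ?thesis by blast
qed

lemma adapted_ker:
  assumes "adapted e1 e2 e3 e4" "\<kappa> x = 0"
  obtains q r t where "x = lc e1 e2 e3 e4 0 q r t"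
proof -
  have fr: "frame e1 e2 e3 e4" and ker: "\<kappa> e2 = 0" "\<kappa> e3 = 0" "\<kappa> e4 = 0"
    using assms(1) by (auto simp: adapted_def)
  have \<kappa>: "\<kappa> (p *\<^sub>R e1 + q *\<^sub>R e2 + r *\<^sub>R e3 + t *\<^sub>R e4) = p * \<kappa> e1" for p q r t
    by (simp add: linear_add[OF linear_\<kappa>] linear_scale[OF linear_\<kappa>] ker)
  have "\<kappa> e1 \<noteq> 0"
    using \<kappa>_nontrivial \<kappa> frame_coords[OF fr] by (metis mult_zero_right)
  obtain p q r t where x: "x = p *\<^sub>R e1 + q *\<^sub>R e2 + r *\<^sub>R e3 + t *\<^sub>R e4"
    using frame_coords[OF fr] by blast
  then have "p = 0" using assms(2) \<kappa> \<open>\<kappa> e1 \<noteq> 0\<close> by simp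
  then show ?thesis using that[of q r t] x by (simp add: lc_def)
qed

lemma adapted_J:
  assumes "adapted e1 e2 e3 e4"
  shows "J (lc e1 e2 e3 e4 p q r t) = lc e1 e2 e3 e4 (- q) p (- t) r"
proof -
  have J1: "J e1 = e2" "J e3 = e4" using assms by (auto simp: adapted_def)
  then have J2: "J e2 = - e1" "J e4 = - e3" using J(2) by auto
  show ?thesis
    by (simp add: lc_def linear_add[OF J(1)] linear_scale[OF J(1)] J1 J2)
qed

text \<open>Brackets have no \<open>e1\<close>-component, which leaves 18 structure constants. The
  Nijenhuis tensor at \<open>e1\<close>, \<open>e3\<close> gives four equations and determines all
  its other values through N(J X, Y) = - J N(X, Y). The traces of ad e2, ad e3 and ad e4 give three
  more, so eleven parameters remain.\<close>

lemma adapted_imp_complex_frame: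
  assumes ad: "adapted e1 e2 e3 e4"
  shows "\<exists>\<alpha> k3 k4 f3 f4 a s \<rho> \<sigma> y \<delta>. complex_frame br e1 e2 e3 e4 \<alpha> k3 k4 f3 f4 a s \<rho> \<sigma> y \<delta> \<and> T e1 = \<alpha> + 2 * a"
proof -
  let ?L = "lc e1 e2 e3 e4"
  have fr: "frame e1 e2 e3 e4" and ker: "\<kappa> e2 = 0" "\<kappa> e3 = 0" "\<kappa> e4 = 0"
    using ad by (auto simp: adapted_def)
  obtain \<alpha> k3 k4 where b12: "br e1 e2 = ?L 0 \<alpha> k3 k4" by (rule adapted_ker[OF ad \<kappa>_bracket])
  obtain f3 A C where b13: "br e1 e3 = ?L 0 f3 A C" by (rule adapted_ker[OF ad \<kappa>_bracket])
  obtain f4 B E where b14: "br e1 e4 = ?L 0 f4 B E" by (rule adapted_ker[OF ad \<kappa>_bracket])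
  obtain h3 q1 q2 where b23: "br e2 e3 = ?L 0 h3 q1 q2" by (rule adapted_ker[OF ad \<kappa>_bracket])
  obtain h4 q3 q4 where b24: "br e2 e4 = ?L 0 h4 q3 q4" by (rule adapted_ker[OF ad \<kappa>_bracket])
  obtain \<delta> n3 n4 where b34: "br e3 e4 = ?L 0 \<delta> n3 n4" by (rule adapted_ker[OF ad \<kappa>_bracket])
  note b = b12 b13 b14 b23 b24 b34
  have "nijenhuis br J e1 e3 = 0"
    using skt by (simp add: SKT_iff integrable_cs_def)
  moreover have "J e1 = e2" "J e3 = e4" using ad by (auto simp: adapted_def)
  ultimately have N: "h3 + f4 = 0" "h4 = f3" "q3 + q2 + E - A = 0" "q4 - q1 - B - C = 0"
    by (simp_all add: nijenhuis_def b adapted_J[OF ad] lc_arith lc_eq_0_iff[OF fr])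
  have lc_comb: "?L p q r t = comb e1 e2 e3 e4 (vector [p, q, r, t])" for p q r t
    by (simp add: lc_def comb_vector)
  have zero: "0 = ?L 0 0 0 0" by (simp add: lc_def)
  note sw = alternating_swap[OF br]
  have b': "br e2 e1 = ?L 0 (- \<alpha>) (- k3) (- k4)" "br e3 e1 = ?L 0 (- f3) (- A) (- C)" "br e4 e1 = ?L 0 (- f4)
    (- B) (- E)"
    "br e3 e2 = ?L 0 (- h3) (- q1) (- q2)" "br e4 e2 = ?L 0 (- h4) (- q3) (- q4)" "br e4 e3 = ?L 0 (- \<delta>) (-
      n3) (- n4)"
    "br x x = ?L 0 0 0 0" for x
    using sw[of e2 e1] sw[of e3 e1] sw[of e4 e1] sw[of e3 e2] sw[of e4 e2] sw[of e4 e3] br(2)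
    by (simp_all add: b lc_arith flip: zero)
  note tr = trace_matrix_frame[OF linear_br fr, folded T_def]
  have t1: "T e1 = \<alpha> + A + E"
    by (subst tr) (rule b'(7)[unfolded lc_comb] b[unfolded lc_comb] b'[unfolded lc_comb] | simp add:
      vector_4_nth)+
  have t2: "T e2 = q1 + q4"
    by (subst tr) (rule b'(7)[unfolded lc_comb] b[unfolded lc_comb] b'[unfolded lc_comb] | simp add:
      vector_4_nth)+
  have t3: "T e3 = - h3 + n4"
    by (subst tr) (rule b'(7)[unfolded lc_comb] b[unfolded lc_comb] b'[unfolded lc_comb] | simp add:
      vector_4_nth)+
  have t4: "T e4 = - h4 - n3"
    by (subst tr) (rule b'(7)[unfolded lc_comb] b[unfolded lc_comb] b'[unfolded lc_comb] | simp add: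
      vector_4_nth)+
  have "T e2 = 0" "T e3 = 0" "T e4 = 0"
    using ker trace_ker by (auto simp: T_def)
  define a s \<rho> \<sigma> y where d: "a = (A + E) / 2" "s = (C - B) / 2" "\<rho> = (A - E) / 2" "\<sigma> = (B + C) / 2" "y = (q2 -
    q3) / 2"
  have "complex_frame br e1 e2 e3 e4 \<alpha> k3 k4 f3 f4 a s \<rho> \<sigma> y \<delta>"
    unfolding complex_frame_def b lc_eq_iff[OF fr] using fr N \<open>T e2 = 0\<close> \<open>T e3 = 0\<close> \<open>T e4 = 0\<close> t2 t3 t4
    by (simp add: d field_simps)
  moreover have "T e1 = \<alpha> + 2 * a" using t1 by (simp add: d)
  ultimately show ?thesis by blast
qed

end

section \<open>The Jacobi and SKT equations in a frame\<close>

context skt_algebra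
begin

text \<open>The \<open>e2\<close>-component of the Jacobi identity for \<open>e1\<close>,
  \<open>e3\<close>, \<open>e4\<close>. The sum of squares serves twice: it makes \<delta> (\<alpha>
  - 2 a) nonnegative, and it forces f3 = f4 = 0 when \<delta> = 0.\<close>

lemma complex_frame_jacobi:
  assumes cf: "complex_frame br e1 e2 e3 e4 \<alpha> k3 k4 f3 f4 a s \<rho> \<sigma> y \<delta>"
  shows "\<delta> * (\<alpha> - 2 * a) = 2 * (f3^2 + f4^2)"
proof -
  let ?L = "lc e1 e2 e3 e4"
  have fr: "frame e1 e2 e3 e4" using cf by (simp add: complex_frame_def)
  have "br (br (?L 1 0 0 0) (?L 0 0 1 0)) (?L 0 0 0 1) + br (br (?L 0 0 1 0) (?L 0 0 0 1)) (?L 1 0 0 0)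
     + br (br (?L 0 0 0 1) (?L 1 0 0 0)) (?L 0 0 1 0) = 0"
    by (rule jacobi)
  then show ?thesis
    by (simp add: complex_frame_bracket[OF br cf] lc_arith lc_eq_0_iff[OF fr]) algebra
qed

text \<open>On the span of \<open>e3\<close> and \<open>e4\<close>, taken modulo \<open>e2\<close>,
  the Jacobi identity says that the commutator of ad e1 and ad e2 is \<alpha> times ad e2. With
  \<mu> = \<rho> + \<sigma> i its complex linear part is \<alpha> y = - 2 |\<mu>|^2, and its
  antilinear part is (\<alpha> + 2 y - 2 s i) \<mu> = 0. The equations with \<delta> come from
  \<open>e1\<close>, \<open>e3\<close>, \<open>e4\<close>.\<close>

lemma straight_frame_jacobi:
  assumes cf: "complex_frame br e1 e2 e3 e4 \<alpha> k3 k4 0 0 a s \<rho> \<sigma> y \<delta>"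
  shows "\<delta> * k3 = 0" "\<delta> * k4 = 0" "\<alpha> * y = - 2 * (\<rho>^2 + \<sigma>^2)"
    "(\<alpha> + 2 * y) * \<rho> + 2 * s * \<sigma> = 0" "(\<alpha> + 2 * y) * \<sigma> - 2 * s * \<rho> = 0"
proof -
  let ?L = "lc e1 e2 e3 e4"
  have fr: "frame e1 e2 e3 e4" using cf by (simp add: complex_frame_def)
  note L = complex_frame_bracket[OF br cf] lc_arith lc_eq_0_iff[OF fr]
  have "br (br (?L 1 0 0 0) (?L 0 0 1 0)) (?L 0 0 0 1) + br (br (?L 0 0 1 0) (?L 0 0 0 1)) (?L 1 0 0 0)
     + br (br (?L 0 0 0 1) (?L 1 0 0 0)) (?L 0 0 1 0) = 0"
    by (rule jacobi)
  then show "\<delta> * k3 = 0" "\<delta> * k4 = 0" by (auto simp: L)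
  have "br (br (?L 1 0 0 0) (?L 0 1 0 0)) (?L 0 0 1 0) + br (br (?L 0 1 0 0) (?L 0 0 1 0)) (?L 1 0 0 0)
     + br (br (?L 0 0 1 0) (?L 1 0 0 0)) (?L 0 1 0 0) = 0"
    by (rule jacobi)
  note j3 = this[simplified L]
  have "br (br (?L 1 0 0 0) (?L 0 1 0 0)) (?L 0 0 0 1) + br (br (?L 0 1 0 0) (?L 0 0 0 1)) (?L 1 0 0 0)
     + br (br (?L 0 0 0 1) (?L 1 0 0 0)) (?L 0 1 0 0) = 0"
    by (rule jacobi)
  note j4 = this[simplified L]
  show "\<alpha> * y = - 2 * (\<rho>^2 + \<sigma>^2)" "(\<alpha> + 2 * y) * \<rho> + 2 * s * \<sigma> = 0" "(\<alpha> + 2 * y) * \<sigma> - 2 * s * \<rho> = 0"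
    using j3 j4 by (simp_all, algebra+)
qed

text \<open>The only consequence of \<open>d(Jd\<omega>) = 0\<close> that is used below. It determines the sign of \<open>\<delta> * (\<alpha> + 2 * a)\<close>,
  without which the real Lie algebra of the complex affine group would also survive.\<close>
lemma orthonormal_scalar_equation:
  assumes ad: "adapted e1 e2 e3 e4" and on: "orthonormal e1 e2 e3 e4"
    and cf: "complex_frame br e1 e2 e3 e4 \<alpha> k3 k4 f3 f4 a s \<rho> \<sigma> y \<delta>"
  shows "(\<delta> - 2 * a) * (\<alpha> + 2 * a) = 0"
proof -
  let ?L = "lc e1 e2 e3 e4"
  have gL: "g (?L p q r t) (?L p' q' r' t') = p * p' + q * q' + r * r' + t * t'" for p q r t p' q' r' t'
    using on unfolding orthonormal_def lc_def
    by (simp add: bilinear_ladd[OF g(1)] bilinear_radd[OF g(1)] bilinear_lmul[OF g(1)] bilinear_rmul[OF g(1)]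
        g(2)[of e2 e1] g(2)[of e3 e1] g(2)[of e3 e2] g(2)[of e4 e1] g(2)[of e4 e2] g(2)[of e4 e3])
  let ?H = "JdJ br g J"
  have "?H (br (?L 1 0 0 0) (?L 0 1 0 0)) (?L 0 0 1 0) (?L 0 0 0 1) - ?H (br (?L 1 0 0 0) (?L 0 0 1 0)) (?L 0
    1 0 0) (?L 0 0 0 1)
     + ?H (br (?L 1 0 0 0) (?L 0 0 0 1)) (?L 0 1 0 0) (?L 0 0 1 0) + ?H (br (?L 0 1 0 0) (?L 0 0 1 0)) (?L 1 0
       0 0) (?L 0 0 0 1)
     - ?H (br (?L 0 1 0 0) (?L 0 0 0 1)) (?L 1 0 0 0) (?L 0 0 1 0) + ?H (br (?L 0 0 1 0) (?L 0 0 0 1)) (?L 1 0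
       0 0) (?L 0 1 0 0) = 0"
    using skt by (simp add: SKT_iff)
  then show ?thesis
    by (simp add: JdJ_def complex_frame_bracket[OF br cf] adapted_J[OF ad] gL) algebra
qed

text \<open>If \<open>\<delta>\<close> vanishes then so do \<open>f3\<close> and \<open>f4\<close> by the Jacobi identity; otherwise they are removed by replacing
  \<open>e2\<close> with a multiple of \<open>br e3 e4\<close>, which destroys the orthonormality but not the sign of \<open>\<delta> * (\<alpha> + 2 * a)\<close>.\<close>
lemma exists_straight_frame:
  "\<exists>e1 e2 e3 e4 \<alpha> k3 k4 a s \<rho> \<sigma> y \<delta>. adapted e1 e2 e3 e4 \<and> complex_frame br e1 e2 e3 e4 \<alpha> k3 k4 0 0 a s \<rho> \<sigma> y
    \<delta> \<and>
     T e1 = \<alpha> + 2 * a \<and> \<delta> * (\<alpha> + 2 * a) \<ge> 0 \<and> (\<delta> = 0 \<longrightarrow> \<alpha> + 2 * a = 0 \<or> a = 0)"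
proof -
  obtain e1 e2 e3 e4 where ad: "adapted e1 e2 e3 e4" and on: "orthonormal e1 e2 e3 e4"
    using exists_orthonormal_adapted by blast
  obtain \<alpha> k3 k4 f3 f4 a s \<rho> \<sigma> y \<delta> where cf: "complex_frame br e1 e2 e3 e4 \<alpha> k3 k4 f3 f4 a s \<rho> \<sigma> y \<delta>"
    and T1: "T e1 = \<alpha> + 2 * a"
    using adapted_imp_complex_frame[OF ad] by blast
  note j = complex_frame_jacobi[OF cf] and scal = orthonormal_scalar_equation[OF ad on cf]
  have fr: "frame e1 e2 e3 e4" using cf by (simp add: complex_frame_def)
  have ker: "\<kappa> e2 = 0" "\<kappa> e3 = 0" "\<kappa> e4 = 0" using ad by (auto simp: adapted_def)
  show ?thesis
  proof (cases "\<delta> = 0")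
    case True
    with j have "f3^2 + f4^2 = 0" by (simp del: distrib_left_numeral)
    then have "f3 = 0" "f4 = 0" by (simp_all add: sum_power2_eq_zero_iff)
    moreover have "\<alpha> + 2 * a = 0 \<or> a = 0" using scal True by auto
    ultimately show ?thesis using ad cf True T1 by (metis mult_zero_left order_refl)
  next
    case False
    let ?L = "lc e1 e2 e3 e4"
    \<comment> \<open>\<open>e2'\<close> is \<open>br e3 e4\<close> divided by \<delta>, and
      \<open>e1'\<close> is \<open>- J e2'\<close>.\<close>
    define e1' where "e1' = ?L 1 0 (- f4 / \<delta>) (f3 / \<delta>)"
    define e2' where "e2' = ?L 0 1 (- f3 / \<delta>) (- f4 / \<delta>)"
    have fr': "frame e1' e2' e3 e4"
      by (rule frame_change[OF fr e1'_def[unfolded lc_def] e2'_def[unfolded lc_def]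
            lc_basis(3)[symmetric, of e3 e1 e2 e4, unfolded lc_def] lc_basis(4)[symmetric, of e4 e1 e2 e3,
              unfolded lc_def]]) simp
    have "J e1' = e2'"
      by (simp add: e1'_def e2'_def adapted_J[OF ad])
    moreover have "\<kappa> e2' = 0"
      by (simp add: e2'_def lc_def linear_add[OF linear_\<kappa>] linear_scale[OF linear_\<kappa>] linear_diff[OF linear_\<kappa>]
        ker)
    ultimately have ad': "adapted e1' e2' e3 e4"
      using ad fr' by (auto simp: adapted_def)
    obtain \<alpha>' k3' k4' f3' f4' a' s' \<rho>' \<sigma>' y' \<delta>' where cf': "complex_frame br e1' e2' e3 e4 \<alpha>' k3' k4' f3' f4'
      a' s' \<rho>' \<sigma>' y' \<delta>'"
      and T1': "T e1' = \<alpha>' + 2 * a'"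
      using adapted_imp_complex_frame[OF ad'] by blast
    have "br e3 e4 = \<delta> *\<^sub>R e2'"
      using cf False by (simp add: complex_frame_def e2'_def lc_arith)
    also have "\<delta> *\<^sub>R e2' = lc e1' e2' e3 e4 0 \<delta> 0 0" by (simp add: lc_def)
    finally have eq: "\<delta>' = \<delta>" "f3' = 0" "f4' = 0"
      using cf' by (simp_all add: complex_frame_def lc_eq_iff[OF fr'])
    have "T e3 = 0" "T e4 = 0"
      using ker trace_ker by (simp_all add: T_def)
    \<comment> \<open>Thus \<alpha> + 2 a is the same in both frames, even if \<alpha> and a change
      separately.\<close>
    then have "T e1' = T e1"
      by (simp add: e1'_def lc_def linear_add[OF linear_T] linear_scale[OF linear_T] linear_diff[OF linear_T])
    moreover have "\<delta> * (\<alpha> + 2 * a) \<ge> 0"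
    proof (cases "\<alpha> + 2 * a = 0")
      case False
      with scal have "\<delta> = 2 * a" by simp
      \<comment> \<open>The difference 4 a \<delta> of the two products is 2 \<delta>^2 because
        \<delta> = 2 a; the first summand is nonnegative by the Jacobi identity
        \<open>j\<close>.\<close>
      then have "\<delta> * (\<alpha> + 2 * a) = \<delta> * (\<alpha> - 2 * a) + 2 * \<delta>^2"
        by (simp add: algebra_simps power2_eq_square)
      then show ?thesis using j by simp
    qed simp
    ultimately show ?thesis using ad' cf' T1 T1' False unfolding eq by metis
  qed
qed

text \<open>If \<open>\<rho> + \<sigma> \<i>\<close> is nonzero then the action of \<open>e2\<close> on the span of \<open>e3\<close> and \<open>e4\<close> is singular, and \<open>e4\<close> can be
  chosen in its kernel.\<close>
lemma exists_normal_frame: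
  "\<exists>e1 e2 e3 e4 \<alpha> k3 k4 a s \<rho> y \<delta>. complex_frame br e1 e2 e3 e4 \<alpha> k3 k4 0 0 a s \<rho> 0 y \<delta> \<and>
     \<delta> * (\<alpha> + 2 * a) \<ge> 0 \<and> (\<delta> = 0 \<longrightarrow> \<alpha> + 2 * a = 0 \<or> a = 0) \<and> (\<rho> = 0 \<or> \<rho> = y)"
proof -
  obtain e1 e2 e3 e4 \<alpha> k3 k4 a s \<rho> \<sigma> y \<delta> where ad: "adapted e1 e2 e3 e4"
    and cf: "complex_frame br e1 e2 e3 e4 \<alpha> k3 k4 0 0 a s \<rho> \<sigma> y \<delta>"
    and T1: "T e1 = \<alpha> + 2 * a"
    and pos: "\<delta> * (\<alpha> + 2 * a) \<ge> 0" and zero: "\<delta> = 0 \<longrightarrow> \<alpha> + 2 * a = 0 \<or> a = 0"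
    using exists_straight_frame by blast
  note j = straight_frame_jacobi[OF cf]
  have fr: "frame e1 e2 e3 e4" using cf by (simp add: complex_frame_def)
  show ?thesis
  proof (cases "\<rho> = 0 \<and> \<sigma> = 0")
    case True
    then show ?thesis using cf pos zero by metis
  next
    case False
    define n where "n = \<rho>^2 + \<sigma>^2"
    have n: "n > 0" using False by (simp add: n_def sum_power2_gt_zero_iff)
    have "(\<alpha> + 2 * y) * n = 0" using j(4,5) unfolding n_def by algebra
    then have \<alpha>: "\<alpha> = - 2 * y" using n by simp
    then have y2: "y^2 = \<rho>^2 + \<sigma>^2" using j(3) by (simp add: power2_eq_square)
    have "s * \<rho> = 0" "s * \<sigma> = 0" using j(4,5) \<alpha> by simp_all
    then have s: "s = 0" using False by auto
    \<comment> \<open>The equations say that u e3 + w e4 lies in the kernel of ad e2. On the span of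
      \<open>e3\<close> and \<open>e4\<close> that map has determinant y^2 - \<rho>^2 - \<sigma>^2 =
      0. The solution (\<rho> - y, \<sigma>) degenerates only for \<rho> = y, where (0, 1) takes its
      place.\<close>
    obtain u w where uw: "u * (\<sigma>) = (\<rho> - y) * w" "(\<rho> + y) * u = - (\<sigma> * w)" "u^2 + w^2 > 0"
    proof (cases "\<rho> = y")
      case True
      then have "\<sigma> = 0" using y2 by simp
      then show ?thesis using that[of 0 1] True by simp
    next
      case False
      then have "(\<rho> - y)^2 + \<sigma>^2 > 0" by (simp add: sum_power2_gt_zero_iff)
      moreover have "(\<rho> + y) * (\<rho> - y) = - (\<sigma> * \<sigma>)" using y2 by algebra
      ultimately show ?thesis using that[of "\<rho> - y" \<sigma>] by simp
    qed
    let ?L = "lc e1 e2 e3 e4"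
    define e3' where "e3' = ?L 0 0 w (- u)"
    define e4' where "e4' = ?L 0 0 u w"
    have fr': "frame e1 e2 e3' e4'"
    proof (rule frame_change[OF fr lc_basis(1)[symmetric, of e1 e2 e3 e4, unfolded lc_def]
          lc_basis(2)[symmetric, of e2 e1 e3 e4, unfolded lc_def] e3'_def[unfolded lc_def] e4'_def[unfolded
            lc_def]])
      fix p q r t assume "p * 1 + q * 0 + r * 0 + t * 0 = 0" "p * 0 + q * 1 + r * 0 + t * 0 = 0"
        and eq: "p * 0 + q * 0 + r * w + t * u = 0" "p * 0 + q * 0 + r * - u + t * w = 0"
      moreover have "r * (u^2 + w^2) = 0" "t * (u^2 + w^2) = 0" using eq by algebra+
      moreover have "u^2 + w^2 \<noteq> 0" using uw(3) by (metis less_irrefl)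
      ultimately have "r = 0" "t = 0" unfolding mult_eq_0_iff by blast+
      with \<open>p * 1 + q * 0 + r * 0 + t * 0 = 0\<close> \<open>p * 0 + q * 1 + r * 0 + t * 0 = 0\<close>
      show "p = 0 \<and> q = 0 \<and> r = 0 \<and> t = 0" by simp
    qed
    have "J e3' = e4'" by (simp add: e3'_def e4'_def adapted_J[OF ad])
    moreover have "\<kappa> e3' = 0" "\<kappa> e4' = 0"
      using ad by (simp_all add: adapted_def e3'_def e4'_def lc_def linear_add[OF linear_\<kappa>] linear_scale[OF
        linear_\<kappa>] linear_diff[OF linear_\<kappa>])
    ultimately have ad': "adapted e1 e2 e3' e4'"
      using ad fr' by (auto simp: adapted_def)
    obtain \<alpha>' k3' k4' f3' f4' a' s' \<rho>' \<sigma>' y' \<delta>' where cf': "complex_frame br e1 e2 e3' e4' \<alpha>' k3' k4' f3' f4'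
      a' s' \<rho>' \<sigma>' y' \<delta>'"
      and T1': "T e1 = \<alpha>' + 2 * a'"
      using adapted_imp_complex_frame[OF ad'] by blast
    have "br e2 e4' = br (?L 0 1 0 0) (?L 0 0 u w)" by (simp add: e4'_def lc_basis)
    also have "\<dots> = 0"
      using uw(1,2) by (simp add: complex_frame_bracket[OF br cf] lc_eq_0_iff[OF fr] algebra_simps)
    finally have 1: "f3' = 0" "\<rho>' = y'" "\<sigma>' = 0"
      using cf' by (simp_all add: complex_frame_def lc_eq_0_iff[OF fr'])
    have "br e3' e4' = ?L 0 (\<delta> * (u^2 + w^2)) 0 0"
      unfolding e3'_def e4'_def by (simp add: complex_frame_bracket[OF br cf] algebra_simps power2_eq_square)
    also have "\<dots> = lc e1 e2 e3' e4' 0 (\<delta> * (u^2 + w^2)) 0 0" by (simp add: lc_def)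
    finally have 2: "\<delta>' = \<delta> * (u^2 + w^2)" "f4' = 0"
      using cf' by (simp_all add: complex_frame_def lc_eq_iff[OF fr'])
    have "lc e1 e2 e3 e4 0 \<alpha> k3 k4 = lc e1 e2 e3' e4' 0 \<alpha>' k3' k4'"
      using cf cf' by (simp add: complex_frame_def)
    also have "\<dots> = lc e1 e2 e3 e4 0 \<alpha>' (k3' * w + k4' * u) (k4' * w - k3' * u)"
      by (simp add: e3'_def e4'_def lc_def algebra_simps)
    finally have 3: "\<alpha>' = \<alpha>" by (simp add: lc_eq_iff[OF fr])
    have 4: "a' = a" using T1 T1' 3 by simp
    \<comment> \<open>\<open>u\<close> and \<open>w\<close> are not normalised; the positive factor
      leaves the sign intact.\<close>
    have "\<delta>' * (\<alpha>' + 2 * a') = (\<delta> * (\<alpha> + 2 * a)) * (u^2 + w^2)"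
      using 2 3 4 by simp
    then have "\<delta>' * (\<alpha>' + 2 * a') \<ge> 0"
      using pos uw(3) by (metis less_imp_le mult_nonneg_nonneg)
    moreover have "\<delta>' = 0 \<longrightarrow> \<alpha>' + 2 * a' = 0 \<or> a' = 0"
      using zero 2 3 4 uw(3) by auto
    ultimately show ?thesis
      using cf' unfolding 1 2(2) by blast
  qed
qed

text \<open>The cases are governed by \<rho> and \<delta>. For \<rho> = 0 the Jacobi identity gives
  \<alpha> = 0 or y = 0, otherwise s = 0 and \<alpha> = - 2 y; a nonzero \<delta> forces \<alpha> =
  2 a and k3 = k4 = 0.\<close>

theorem classification:
  assumes no_perfect: "\<And>S. S \<subseteq> span {br v w | v w. v \<in> S \<and> w \<in> S} \<Longrightarrow> S \<subseteq> {0}"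
  shows "lie_iso br (abelian :: real^4 \<Rightarrow> _)
    \<or> lie_iso br ((abelian :: real \<Rightarrow> _) \<times>\<^sub>L h3)
    \<or> lie_iso br ((abelian :: real \<Rightarrow> _) \<times>\<^sub>L r3 0)
    \<or> lie_iso br ((abelian :: real \<Rightarrow> _) \<times>\<^sub>L r3' 0)
    \<or> lie_iso br (aff_R \<times>\<^sub>L aff_R)
    \<or> (\<exists>l>0. lie_iso br (r4' l 0))
    \<or> lie_iso br (r4 (- 1/2) (- 1/2))
    \<or> (\<exists>l>0. lie_iso br (r4' (2 * l) (- l)))
    \<or> lie_iso br d4
    \<or> lie_iso br (d4l 2)
    \<or> lie_iso br (d4' 0)
    \<or> lie_iso br (d4l (1/2))
    \<or> (\<exists>l>0. lie_iso br (d4' l))"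
proof -
  obtain e1 e2 e3 e4 \<alpha> k3 k4 a s \<rho> y \<delta> where cf: "complex_frame br e1 e2 e3 e4 \<alpha> k3 k4 0 0 a s \<rho> 0 y \<delta>"
    and pos: "\<delta> * (\<alpha> + 2 * a) \<ge> 0" and zero: "\<delta> = 0 \<longrightarrow> \<alpha> + 2 * a = 0 \<or> a = 0" and \<rho>: "\<rho> = 0 \<or> \<rho> = y"
    using exists_normal_frame by blast
  note j = complex_frame_jacobi[OF cf] straight_frame_jacobi[OF cf]
  \<comment> \<open>In this case \<open>e2\<close>, \<open>e3\<close>, \<open>e4\<close> span a copy
    of so(3) or sl(2,R), depending on the sign of y \<delta>. Only here does solvability enter the
    case distinction.\<close>
  have perfect: False if "y \<noteq> 0" "\<rho> = 0" "\<delta> \<noteq> 0"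
  proof -
    let ?S = "{e2, e3, e4}"
    have b: "br e2 e3 = y *\<^sub>R e4" "br e2 e4 = - y *\<^sub>R e3" "br e3 e4 = \<delta> *\<^sub>R e2"
      using cf that by (simp_all add: complex_frame_def lc_def)
    have "?S \<subseteq> span {br v w | v w. v \<in> ?S \<and> w \<in> ?S}"
    proof -
      have "br e2 e3 \<in> span {br v w | v w. v \<in> ?S \<and> w \<in> ?S}" "br e2 e4 \<in> span {br v w | v w. v \<in> ?S \<and> w \<in> ?S}"
        "br e3 e4 \<in> span {br v w | v w. v \<in> ?S \<and> w \<in> ?S}"
        by (blast intro: span_base)+
      from span_scale[OF this(1), of "1 / y"] span_scale[OF this(2), of "- 1 / y"] span_scale[OF this(3), of
        "1 / \<delta>"]
      show ?thesis using that by (simp add: b)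
    qed
    from no_perfect[OF this] have "e2 = 0" by simp
    moreover have "frame e1 e2 e3 e4" using cf by (simp add: complex_frame_def)
    ultimately show False
      using lc_eq_0_iff[of e1 e2 e3 e4 0 1 0 0] by (simp add: lc_def)
  qed
  show ?thesis
  proof (cases "\<rho> = 0")
    case r0: True
    then have ay: "\<alpha> = 0 \<or> y = 0" using j by simp
    show ?thesis
    proof (cases "\<delta> = 0")
      case d0: True
      show ?thesis
      proof (cases "\<alpha> = 0")
        case al: True
        then have "a = 0" using zero d0 by simp
        then show ?thesis
          using normal_frame_R_r3'_0[OF br cf al] normal_frame_abelian[OF br cf al] normal_frame_R_h3[OF br cf
            al] r0 d0 by blast
      next
        case al: False
        then have y0: "y = 0" using ay by simp
        consider "a = 0" | "\<alpha> + 2 * a = 0" using zero d0 by blast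
        then show ?thesis
        proof cases
          case 1
          then have "\<alpha> \<noteq> a" using al by simp
          from normal_frame_R_r3_0[OF br cf al r0 y0 d0 this 1] normal_frame_r4'_0[OF br cf al r0 y0 d0 this 1]
          show ?thesis by blast
        next
          case 2
          then have "\<alpha> \<noteq> a" using al by auto
          from normal_frame_r4[OF br cf al r0 y0 d0 this 2] normal_frame_r4'[OF br cf al r0 y0 d0 this 2]
          show ?thesis by blast
        qed
      qed
    next
      case d: False
      then have *: "\<alpha> = 2 * a" "k3 = 0" "k4 = 0" and "y = 0" using j perfect r0 by auto
      then show ?thesis
        using normal_frame_heisenberg[OF br cf] normal_frame_d4'_0[OF br cf] normal_frame_d4_half[OF br cf
          *(1)] normal_frame_d4'[OF br cf *(1)] r0 d
        by (cases "a = 0"; cases "s = 0") simp_all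
    qed
  next
    case r: False
    with \<rho> have ry: "\<rho> = y" and y: "y \<noteq> 0" by auto
    have "s = 0" and al: "\<alpha> = - 2 * y" using j(5,6) r by auto
    show ?thesis
    proof (cases "\<delta> = 0")
      case True
      then have "a = y \<or> a = 0" using zero al by auto
      then show ?thesis
        using normal_frame_d4[OF br cf al y] normal_frame_d4_2[OF br cf al y] \<open>s = 0\<close> ry True by blast
    next
      case False
      then have *: "\<alpha> = 2 * a" "k3 = 0" "k4 = 0" using j by auto
      \<comment> \<open>With \<alpha> = 2 a the sign condition \<open>pos\<close> reads 2 \<alpha>
        \<delta> \<ge> 0, and \<alpha> = - 2 y is nonzero.\<close>
      have "\<alpha> * \<delta> > 0"
      proof -
        have "0 \<le> 2 * (\<alpha> * \<delta>)" using pos *(1) by (simp add: algebra_simps)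
        moreover have "\<alpha> * \<delta> \<noteq> 0" using False al y by simp
        ultimately show ?thesis by linarith
      qed
      from normal_frame_aff_aff[OF br cf *(1) this \<open>s = 0\<close> ry al *(2,3)] show ?thesis by blast
    qed
  qed
qed

end

theorem theorem5p1:
  fixes G :: "('a::{t2_space, second_countable_topology}) monoid"
    and A :: "('a, real^4) chart set"
    and c :: "('a, real^4) chart"
  assumes "lie_group G A"
    and "simply_connected (UNIV :: 'a set)"
    and "solvable G"
    and "c \<in> A" and "\<one>\<^bsub>G\<^esub> \<in> fst c"
  shows "(\<exists>g J. SKT (lie_bracket G c) g J) \<longleftrightarrow>
      lie_iso (lie_bracket G c) (abelian :: real^4 \<Rightarrow> _)
    \<or> lie_iso (lie_bracket G c) ((abelian :: real \<Rightarrow> _) \<times>\<^sub>L h3)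
    \<or> lie_iso (lie_bracket G c) ((abelian :: real \<Rightarrow> _) \<times>\<^sub>L r3 0)
    \<or> lie_iso (lie_bracket G c) ((abelian :: real \<Rightarrow> _) \<times>\<^sub>L r3' 0)
    \<or> lie_iso (lie_bracket G c) (aff_R \<times>\<^sub>L aff_R)
    \<or> (\<exists>l>0. lie_iso (lie_bracket G c) (r4' l 0))
    \<or> lie_iso (lie_bracket G c) (r4 (- 1/2) (- 1/2))
    \<or> (\<exists>l>0. lie_iso (lie_bracket G c) (r4' (2 * l) (- l)))
    \<or> lie_iso (lie_bracket G c) d4
    \<or> lie_iso (lie_bracket G c) (d4l 2)
    \<or> lie_iso (lie_bracket G c) (d4' 0)
    \<or> lie_iso (lie_bracket G c) (d4l (1/2))
    \<or> (\<exists>l>0. lie_iso (lie_bracket G c) (d4' l))"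
proof -
  interpret lie_group_chart G A c
    using assms by unfold_locales
  note br = lie_bracket_bilinear lie_bracket_alternating
  show ?thesis (is "_ \<longleftrightarrow> ?R")
  proof
    assume "\<exists>g J. SKT (lie_bracket G c) g J"
    then obtain g J where skt: "SKT (lie_bracket G c) g J" by blast
    \<comment> \<open>This supplies the character when all traces vanish: it is then the inner
      product with a vector orthogonal to all brackets.\<close>
    have not_perfect: "span {lie_bracket G c x y | x y. True} \<noteq> UNIV"
    proof
      assume "span {lie_bracket G c x y | x y. True} = UNIV"
      then have "(UNIV :: (real^4) set) \<subseteq> {0}"
        by (intro no_perfect_subspace[OF assms(3)]) simp
      then have "axis 1 1 = (0 :: real^4)" by blast
      then show False by simp
    qed
    obtain \<kappa> :: "real^4 \<Rightarrow> real" where \<kappa>: "linear \<kappa>" "\<exists>x. \<kappa> x \<noteq> 0" "\<forall>x y. \<kappa> (lie_bracket G c x y) = 0"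
      "\<forall>x. \<kappa> x = 0 \<longrightarrow> trace (matrix (lie_bracket G c x)) = 0"
      by (rule exists_unimodular_character[of "lie_bracket G c", OF br lie_bracket_jacobi not_perfect]) blast
    interpret skt_algebra "lie_bracket G c" g J \<kappa>
      by (rule skt_algebra.intro) (use br lie_bracket_jacobi skt \<kappa> in auto)
    show "?R" by (rule classification) (rule no_perfect_subspace[OF assms(3)])
  next
    assume "?R"
    then show "\<exists>g J. SKT (lie_bracket G c) g J"
      using SKT_if_lie_iso_abelian[OF br] SKT_if_lie_iso_R_h3[OF br] SKT_if_lie_iso_R_r3_0[OF br] SKT_if_lie_iso_R_r3'_0[OF br] SKT_if_lie_iso_aff_aff[OF br]
        SKT_if_lie_iso_r4'_0[OF br] SKT_if_lie_iso_r4[OF br] SKT_if_lie_iso_r4'[OF br] SKT_if_lie_iso_d4[OF br] SKT_if_lie_iso_d4_2[OF br] SKT_if_lie_iso_d4'_0[OF br]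
        SKT_if_lie_iso_d4_half[OF br] SKT_if_lie_iso_d4'[OF br]
      by (elim disjE exE conjE) blast+
  qed
qed

end
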